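(* Let $\Lambda$ be a subgroup of $\mathbf{R}/\mathbf{Z}$. Suppose that $\Lambda$ has $\mathbf{Q}$-rank $\ge 2$, or is infinitely generated of $\mathbf{Q}$-rank $1$. Then $\mathrm{IET}^{+}_{\Lambda}$ has only two lifts to $\widehat{\mathrm{IET}^{+}}$ up to conjugation by finitely supported permutations, namely the left-continuous and the right-continuous lift.
   Context: Let $\mathbf{S}=\mathbf{R}/\mathbf{Z}$. Let $\widehat{\mathrm{PC}^{\bowtie}}(\mathbf{S})$ be the group of permutations of $\mathbf{S}$ that are continuous outside a finite subset, and $\mathrm{PC}^{\bowtie}(\mathbf{S})$ its quotient by the normal subgroup of finitely supported permutations, with quotient homomorphism $\pi$. $\mathrm{IET}^{+}$ is the subgroup of $\mathrm{PC}^{\bowtie}(\mathbf{S})$ of piecewise translations (interval exchanges) and $\widehat{\mathrm{IET}^{+}}=\pi^{-1}(\mathrm{IET}^{+})$. A lift of a subgroup $\Gamma\subset\mathrm{IET}^{+}$ is a subgroup $\tilde\Gamma\subset\widehat{\mathrm{IET}^{+}}$ such that $\pi$ restricts to a bijection $\tilde\Gamma\to\Gamma$; the left-continuous (resp. right-continuous) lift is the group of left-continuous (resp. right-continuous) representatives of elements of $\Gamma$. For a subgroup $\Lambda$ of $\mathbf{R}/\mathbf{Z}$, $\mathrm{IET}^{+}_{\Lambda}$ is the subgroup of elements of $\mathrm{IET}^{+}$ with all discontinuities in $\Lambda$ and which are locally (outside a finite set) of the form $x\mapsto x+\lambda$ with $\lambda\in\Lambda$. The $\mathbf{Q}$-rank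 of an abelian group $A$ is $\dim_{\mathbf{Q}}(A\otimes_{\mathbf{Z}}\mathbf{Q})$. *)

theory Defs
  imports
    "HOL-Analysis.Analysis"
    "HOL-Algebra.Bij"
    "HOL-Algebra.Coset"
    "HOL-Algebra.Generated_Groups"
    "HOL-Algebra.Free_Abelian_Groups"
    "HOL-Library.Extended_Nat"
begin

section \<open>The circle \<open>\<real>/\<int>\<close>\<close>

quotient_type circle = real / "\<lambda>x y. x - y \<in> \<int>"
  morphisms rep_circle circle_of
proof (intro equivpI reflpI sympI transpI)
  fix x y z :: real
  show "x - x \<in> \<int>" by simp
  show "y - x \<in> \<int>" if "x - y \<in> \<int>" using Ints_minus[OF that] by simp
  show "x - z \<in> \<int>" if "x - y \<in> \<int>" "y - z \<in> \<int>" using Ints_add[OF that] by simp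
qed

lemma circle_of_eq_iff: "circle_of x = circle_of y \<longleftrightarrow> x - y \<in> \<int>"
  by (rule circle.abs_eq_iff)

lemma circle_of_cases: obtains x where "c = circle_of x"
  using circle.abs_induct[of "\<lambda>c. \<exists>x. c = circle_of x" c] by blast

instantiation circle :: ab_group_add
begin

lift_definition zero_circle :: circle is "0 :: real" .

lift_definition plus_circle :: "circle \<Rightarrow> circle \<Rightarrow> circle" is "(+)"
  using Ints_add by (fastforce simp: algebra_simps)

lift_definition uminus_circle :: "circle \<Rightarrow> circle" is uminus
  using Ints_minus by (fastforce simp: algebra_simps)

lift_definition minus_circle :: "circle \<Rightarrow> circle \<Rightarrow> circle" is "(-)"
  using Ints_diff by (fastforce simp: algebra_simps)

instance
  by standard (transfer, simp)+

end

instantiation circle :: t2_space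
begin

definition open_circle :: "circle set \<Rightarrow> bool"
  where "open_circle U \<longleftrightarrow> open (circle_of -` U)"  \<comment> \<open>quotient topology\<close>

instance
proof
  show "open (UNIV :: circle set)" by (simp add: open_circle_def)
  show "open (S \<inter> T)" if "open S" "open T" for S T :: "circle set"
    using that by (simp add: open_circle_def open_Int)
  show "open (\<Union> K)" if "\<forall>S\<in>K. open S" for K :: "circle set set"
    using that by (auto simp: open_circle_def vimage_Union)
  have open_image: "open (circle_of ` ball a r)" for a r
  proof -
    have "circle_of -` (circle_of ` ball a r) = (\<Union>n::int. ball (a + of_int n) r)"
    proof (intro equalityI subsetI)
      fix s assume "s \<in> circle_of -` (circle_of ` ball a r)"
      then obtain t where t: "dist a t < r" "s - t \<in> \<int>"
        by (auto simp: circle_of_eq_iff)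
      then obtain n where "s - t = of_int n" by (auto elim: Ints_cases)
      with t show "s \<in> (\<Union>n::int. ball (a + of_int n) r)"
        by (auto simp: dist_real_def intro!: exI[of _ n])
    next
      fix s assume "s \<in> (\<Union>n::int. ball (a + of_int n) r)"
      then obtain n :: int where n: "dist (a + of_int n) s < r" by auto
      have "circle_of s = circle_of (s - of_int n)" by (simp add: circle_of_eq_iff)
      moreover have "s - of_int n \<in> ball a r" using n by (simp add: dist_real_def algebra_simps)
      ultimately show "s \<in> circle_of -` (circle_of ` ball a r)" by auto
    qed
    then show ?thesis by (simp add: open_circle_def open_UN)
  qed
  fix x y :: circle
  assume "x \<noteq> y"
  obtain a b where ab: "x = circle_of a" "y = circle_of b"
    by (metis circle_of_cases)
  define d where "d = \<bar>(a - b) - of_int (round (a - b))\<bar>"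
  have "a - b \<notin> \<int>" using \<open>x \<noteq> y\<close> ab by (simp add: circle_of_eq_iff)
  then have "d > 0" unfolding d_def by (metis Ints_of_int eq_iff_diff_eq_0 zero_less_abs_iff)
  have "circle_of ` ball a (d/2) \<inter> circle_of ` ball b (d/2) = {}"
  proof (rule ccontr)
    assume "\<not> ?thesis"
    then obtain s t where st: "\<bar>a - s\<bar> < d/2" "\<bar>b - t\<bar> < d/2" "circle_of s = circle_of t"
      by (auto simp: dist_real_def)
    then obtain n :: int where "s - t = of_int n" by (auto simp: circle_of_eq_iff elim: Ints_cases)
    with st have "\<bar>(a - b) - of_int n\<bar> < d" by linarith
    moreover have "d \<le> \<bar>(a - b) - of_int n\<bar>" unfolding d_def by (rule round_diff_minimal)
    ultimately show False by simp
  qed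
  with ab \<open>d > 0\<close> open_image
  show "\<exists>U V. open U \<and> open V \<and> x \<in> U \<and> y \<in> V \<and> U \<inter> V = {}"
    by (intro exI[of _ "circle_of ` ball a (d/2)"] exI[of _ "circle_of ` ball b (d/2)"]) auto
qed

end

definition circle_group :: "circle monoid"
  where "circle_group = \<lparr>carrier = UNIV, monoid.mult = (+), one = 0\<rparr>"


section \<open>Piecewise continuous permutations and interval exchanges\<close>

definition PC_hat :: "(circle \<Rightarrow> circle) monoid"
  where "PC_hat = BijGroup UNIV\<lparr>carrier := {f \<in> Bij UNIV. finite {x. \<not> isCont f x}}\<rparr>"

definition fin_perms :: "(circle \<Rightarrow> circle) set"
  where "fin_perms = {f \<in> Bij UNIV. finite {x. f x \<noteq> x}}"

definition PC :: "(circle \<Rightarrow> circle) set monoid"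
  where "PC = PC_hat Mod fin_perms"

definition PC_proj :: "(circle \<Rightarrow> circle) \<Rightarrow> (circle \<Rightarrow> circle) set"
  where "PC_proj f = fin_perms #>\<^bsub>PC_hat\<^esub> f"

definition locally_translation_at :: "circle set \<Rightarrow> (circle \<Rightarrow> circle) \<Rightarrow> circle \<Rightarrow> bool"
  where "locally_translation_at \<Lambda> f x \<longleftrightarrow> (\<exists>l\<in>\<Lambda>. \<forall>\<^sub>F y in nhds x. f y = y + l)"

text \<open>
  A local property required off a finite set does not depend on the representative of a class
  in \<^const>\<open>PC\<close>, so one representative is enough below.  By compactness of the circle, being a
  translation near every point off a finite set is the same as being a translation on each of
  finitely many arcs.
\<close>

definition IET :: "(circle \<Rightarrow> circle) set set"
  where "IET = {a \<in> carrier PC. \<exists>f\<in>a. finite {x. \<not> locally_translation_at UNIV f x}}"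

definition IET_hat :: "(circle \<Rightarrow> circle) set"
  where "IET_hat = {f \<in> carrier PC_hat. PC_proj f \<in> IET}"

text \<open>
  A point is a discontinuity of a class if no representative is continuous there: a
  discontinuity that a finitely supported permutation can remove does not count.
\<close>

definition discontinuities :: "(circle \<Rightarrow> circle) set \<Rightarrow> circle set"
  where "discontinuities a = {x. \<forall>f\<in>a. \<not> isCont f x}"

definition IET_over :: "circle set \<Rightarrow> (circle \<Rightarrow> circle) set set"
  where "IET_over \<Lambda> = {a \<in> IET. discontinuities a \<subseteq> \<Lambda> \<and>
           (\<exists>f\<in>a. finite {x. \<not> locally_translation_at \<Lambda> f x})}"


section \<open>Lifts\<close>

definition is_lift :: "(circle \<Rightarrow> circle) set set \<Rightarrow> (circle \<Rightarrow> circle) set \<Rightarrow> bool"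
  where "is_lift \<Gamma> L \<longleftrightarrow> subgroup L (PC_hat\<lparr>carrier := IET_hat\<rparr>) \<and> bij_betw PC_proj L \<Gamma>"

definition left_lift :: "(circle \<Rightarrow> circle) set set \<Rightarrow> (circle \<Rightarrow> circle) set"
  where "left_lift \<Gamma> =
    {f \<in> carrier PC_hat. PC_proj f \<in> \<Gamma> \<and> (\<forall>t::real. continuous (at_left t) (f \<circ> circle_of))}"

definition right_lift :: "(circle \<Rightarrow> circle) set set \<Rightarrow> (circle \<Rightarrow> circle) set"
  where "right_lift \<Gamma> =
    {f \<in> carrier PC_hat. PC_proj f \<in> \<Gamma> \<and> (\<forall>t::real. continuous (at_right t) (f \<circ> circle_of))}"

definition fin_conjugate :: "(circle \<Rightarrow> circle) set \<Rightarrow> (circle \<Rightarrow> circle) set \<Rightarrow> bool"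
  where "fin_conjugate L M \<longleftrightarrow>
    (\<exists>s\<in>fin_perms. M = (\<lambda>f. s \<otimes>\<^bsub>PC_hat\<^esub> f \<otimes>\<^bsub>PC_hat\<^esub> inv\<^bsub>PC_hat\<^esub> s) ` L)"


section \<open>The \<open>\<rat>\<close>-rank of an abelian group\<close>

definition tensor_rat_relations :: "('a, 'b) monoid_scheme \<Rightarrow> ('a \<times> rat \<Rightarrow>\<^sub>0 int) set"
  where "tensor_rat_relations G =
    generate (free_Abelian_group (carrier G \<times> UNIV))
      ({frag_of (a \<otimes>\<^bsub>G\<^esub> b, q) - frag_of (a, q) - frag_of (b, q) |a b q. a \<in> carrier G \<and> b \<in> carrier G} \<union>
       {frag_of (a, q + r) - frag_of (a, q) - frag_of (a, r) |a q r. a \<in> carrier G})"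

text \<open>The abelian group \<open>G \<otimes>\<^sub>\<int> \<rat>\<close>, written multiplicatively as all quotient groups in the library.\<close>

definition tensor_rat :: "('a, 'b) monoid_scheme \<Rightarrow> ('a \<times> rat \<Rightarrow>\<^sub>0 int) set monoid"
  where "tensor_rat G = free_Abelian_group (carrier G \<times> UNIV) Mod tensor_rat_relations G"

text \<open>The scalar action of \<open>\<rat>\<close>, determined by \<open>r \<cdot> (a \<otimes> q) = a \<otimes> (r * q)\<close>.\<close>

definition tensor_rat_scale ::
    "('a, 'b) monoid_scheme \<Rightarrow> rat \<Rightarrow> ('a \<times> rat \<Rightarrow>\<^sub>0 int) set \<Rightarrow> ('a \<times> rat \<Rightarrow>\<^sub>0 int) set"
  where "tensor_rat_scale G r v =
    tensor_rat_relations G <#>\<^bsub>free_Abelian_group (carrier G \<times> UNIV)\<^esub>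
      (frag_extend (\<lambda>(a, q). frag_of (a, r * q)) ` v)"

definition tensor_rat_lincomb ::
    "('a, 'b) monoid_scheme \<Rightarrow> (('a \<times> rat \<Rightarrow>\<^sub>0 int) set \<Rightarrow> rat) \<Rightarrow>
     ('a \<times> rat \<Rightarrow>\<^sub>0 int) set set \<Rightarrow> ('a \<times> rat \<Rightarrow>\<^sub>0 int) set"
  where "tensor_rat_lincomb G u B = finprod (tensor_rat G) (\<lambda>v. tensor_rat_scale G (u v) v) B"

definition finite_rat_basis ::
    "('a, 'b) monoid_scheme \<Rightarrow> ('a \<times> rat \<Rightarrow>\<^sub>0 int) set set \<Rightarrow> bool"
  where "finite_rat_basis G B \<longleftrightarrow>
    finite B \<and> B \<subseteq> carrier (tensor_rat G) \<and>
    (\<forall>u. tensor_rat_lincomb G u B = \<one>\<^bsub>tensor_rat G\<^esub> \<longrightarrow> (\<forall>v\<in>B. u v = 0)) \<and>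
    (\<forall>w\<in>carrier (tensor_rat G). \<exists>u. w = tensor_rat_lincomb G u B)"

definition rat_rank :: "('a, 'b) monoid_scheme \<Rightarrow> enat"
  where "rat_rank G =
    (if \<exists>B. finite_rat_basis G B then enat (card (SOME B. finite_rat_basis G B)) else \<infinity>)"

definition finitely_generated_group :: "('a, 'b) monoid_scheme \<Rightarrow> bool"
  where "finitely_generated_group G \<longleftrightarrow>
    (\<exists>X. finite X \<and> X \<subseteq> carrier G \<and> generate G X = carrier G)"

end

theory Submission
  imports Defs
begin

text \<open>
  A lift amounts to a homomorphism \<open>\<alpha>\<close> from the interval exchanges over \<open>\<Lambda>\<close> to the permutations of
  the circle with \<open>\<alpha> f = f\<close> off a finite set.  The rotations of an arc with endpoints in \<open>\<Lambda>\<close> form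
  an abelian group acting freely on the arc; the hypothesis on \<open>\<Lambda>\<close> gives this group an
  infinite cyclic subgroup of infinite index, so that an almost invariant function on it is almost
  constant.  Hence \<open>\<alpha>\<close> restricted to the rotations of the arc is conjugate to the
  standard action by an almost identical injection.  For the whole circle this lets one assume that
  \<open>\<alpha>\<close> fixes all translations.  For general arcs it singles out the set of points moved by the
  rotations: these sets partition the circle whenever the arcs do, and they are compatible with
  translations, so each is the arc with one of its endpoints, always the left one or always the
  right one.  Since \<open>\<alpha> f\<close> permutes these sets as \<open>f\<close> permutes the arcs, \<open>\<alpha> f\<close> is the one-sided
  representative of \<open>f\<close>.
\<close>

text \<open>A lift consists of genuine permutations, while all that is known about them holds up to
  finite sets. Two devices bridge the gap. A relation between interval exchanges that holds off a
  finite set becomes an exact relation between their images under \<open>\<alpha>\<close>. And an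
  infinite group of rotations carries any point of its support away from the finitely many places
  where \<open>\<alpha> f\<close> and \<open>f\<close> differ. After rescaling, the rotations of an
  arc of length c form the preimage of \<Lambda> in the reals modulo c. Nonzero rank supplies an
  irrational real over \<Lambda>, hence a rotation of infinite order. Infinite index uses the rest
  of the hypothesis: the preimage contains the integers, so a covering by finitely many cosets would
  cover \<Lambda> by finitely many cosets of a cyclic subgroup, making it finitely generated of rank
  at most 1. What no argument can remove is one binary choice, the endpoint kept by an arc.
  Translations and comparison of lengths make it the same for all arcs, and passing to the
  complementary arc settles the other endpoint.\<close>

section \<open>Germs of piecewise translations\<close>

text \<open>The name \<open>inv\<close> is taken by the notation for group inverses.\<close>

abbreviation perm_inv :: "('a \<Rightarrow> 'b) \<Rightarrow> 'b \<Rightarrow> 'a"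
  where "perm_inv \<equiv> inv_into UNIV"

section \<open>The circle in real coordinates and its neighbourhoods\<close>

lemma circle_of_add: "circle_of (x + y) = circle_of x + circle_of y"
  by (simp add: plus_circle.abs_eq)

lemma circle_of_minus: "circle_of (- x) = - circle_of x"
  by (simp add: uminus_circle.abs_eq)

lemma circle_of_diff: "circle_of (x - y) = circle_of x - circle_of y"
  by (simp add: minus_circle.abs_eq)

lemma circle_of_0: "circle_of 0 = 0"
  by (simp add: zero_circle_def)

lemma circle_of_eq_0_iff: "circle_of x = 0 \<longleftrightarrow> x \<in> \<int>"
  by (simp add: circle_of_eq_iff flip: circle_of_0)

lemma circle_of_Ints: "n \<in> \<int> \<Longrightarrow> circle_of n = 0"
  by (simp add: circle_of_eq_0_iff)

lemma Ints_abs_less_1: "n \<in> \<int> \<Longrightarrow> \<bar>n\<bar> < 1 \<Longrightarrow> n = (0::real)"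
  by (auto elim!: Ints_cases)

lemma circle_of_inj_near: "circle_of x = circle_of y \<Longrightarrow> \<bar>x - y\<bar> < 1 \<Longrightarrow> x = y"
  using Ints_abs_less_1[of "x - y"] by (auto simp: circle_of_eq_iff)

lemma open_vimage_circle_of: "open U \<Longrightarrow> open (circle_of -` U)"
  by (simp add: open_circle_def)

lemma open_image_circle_of:
  assumes "open U"
  shows "open (circle_of ` U)"
proof -
  have "circle_of -` (circle_of ` U) = (\<Union>n::int. (\<lambda>x. x - of_int n) -` U)"
  proof (intro equalityI subsetI)
    fix s assume "s \<in> circle_of -` (circle_of ` U)"
    then obtain t where t: "t \<in> U" "s - t \<in> \<int>" by (auto simp: circle_of_eq_iff)
    then obtain n where "s - t = of_int n" by (auto elim: Ints_cases)
    then have "s - of_int n = t" by simp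
    with t show "s \<in> (\<Union>n::int. (\<lambda>x. x - of_int n) -` U)" by auto
  next
    fix s assume "s \<in> (\<Union>n::int. (\<lambda>x. x - of_int n) -` U)"
    then obtain n :: int where n: "s - of_int n \<in> U" by auto
    have "circle_of s = circle_of (s - of_int n)" by (simp add: circle_of_eq_iff)
    with n show "s \<in> circle_of -` (circle_of ` U)" by auto
  qed
  moreover have "open ((\<lambda>x. x - of_int n) -` U)" for n :: int
    using assms by (intro open_vimage continuous_intros) auto
  ultimately show ?thesis by (simp add: open_circle_def open_UN)
qed

text \<open>\<open>circle_of\<close> is continuous and open, so germs on the circle can be computed
  along the real line, where left and right make sense.\<close>

lemma nhds_circle_of: "nhds (circle_of t) = filtermap circle_of (nhds t)"
proof (rule filter_eqI)
  fix P
  show "eventually P (nhds (circle_of t)) \<longleftrightarrow> eventually P (filtermap circle_of (nhds t))"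
  proof
    assume "eventually P (nhds (circle_of t))"
    then obtain U where "open U" "circle_of t \<in> U" "\<forall>x\<in>U. P x" by (auto simp: eventually_nhds)
    then show "eventually P (filtermap circle_of (nhds t))"
      unfolding eventually_filtermap eventually_nhds
      by (intro exI[of _ "circle_of -` U"]) (auto simp: open_vimage_circle_of)
  next
    assume "eventually P (filtermap circle_of (nhds t))"
    then obtain U where "open U" "t \<in> U" "\<forall>x\<in>U. P (circle_of x)"
      by (auto simp: eventually_filtermap eventually_nhds)
    then show "eventually P (nhds (circle_of t))"
      unfolding eventually_nhds
      by (intro exI[of _ "circle_of ` U"]) (auto simp: open_image_circle_of)
  qed
qed

lemma nhds_add_real: "nhds (a + t) = filtermap (\<lambda>s. a + s) (nhds t)" for a t :: real
  using filtermap_nhds_shift[of "- a" t] by (simp add: add.commute)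

lemma nhds_circle_add: "nhds (x + circle_of t) = filtermap (\<lambda>s. x + circle_of s) (nhds t)"
proof -
  obtain a where a: "x = circle_of a" by (rule circle_of_cases)
  show ?thesis
    unfolding a circle_of_add[symmetric] nhds_circle_of nhds_add_real filtermap_filtermap ..
qed

lemma nhds_circle_shift: "nhds (x + l) = filtermap (\<lambda>y. y + l) (nhds x)" for x l :: circle
proof -
  obtain t where t: "x = circle_of t" by (rule circle_of_cases)
  have "nhds (l + circle_of t) = filtermap (\<lambda>s. l + s) (nhds (circle_of t))"
    by (simp add: nhds_circle_add nhds_circle_of filtermap_filtermap)
  then show ?thesis by (simp add: t add.commute)
qed

lemma tendsto_circle_of: "F \<le> nhds t \<Longrightarrow> ((\<lambda>s. x + circle_of s) \<longlongrightarrow> x + circle_of t) F"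
  unfolding nhds_circle_add filterlim_def by (rule filtermap_mono)

lemma tendsto_circle_of_0: "F \<le> at 0 \<Longrightarrow> ((\<lambda>s. x + circle_of s) \<longlongrightarrow> x) F"
  using tendsto_circle_of[of F 0 x] order_trans[of F "at 0" "nhds 0"]
  by (simp add: circle_of_0 at_within_le_nhds)

lemma eventually_not_in_finite:
  fixes x :: "'a :: t1_space"
  shows "finite D \<Longrightarrow> x \<notin> D \<Longrightarrow> \<forall>\<^sub>F y in nhds x. y \<notin> D"
  by (rule eventually_nhds_in_open[of "- D", simplified])
     (auto simp: finite_imp_closed open_Compl)

text \<open>The filter must not see 0: the other points of D are avoided because finite sets are
  closed, and x itself because no t with 0 < |t| < 1 is an integer.\<close>

lemma eventually_circle_not_in_finite:
  assumes "finite D" "F \<le> at 0"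
  shows "\<forall>\<^sub>F t in F. x + circle_of t \<notin> D"
proof -
  have "\<forall>\<^sub>F y in nhds (x + circle_of 0). y \<notin> D - {x}"
    using assms by (intro eventually_not_in_finite) (auto simp: circle_of_0)
  then have "\<forall>\<^sub>F t in nhds 0. x + circle_of t \<notin> D - {x}"
    unfolding nhds_circle_add eventually_filtermap .
  then have 1: "\<forall>\<^sub>F t in at 0. x + circle_of t \<notin> D - {x}"
    by (auto simp: eventually_at_filter elim: eventually_mono)
  have 2: "\<forall>\<^sub>F t in at (0::real). x + circle_of t \<noteq> x"
    unfolding eventually_at
    by (intro exI[of _ 1]) (auto simp: circle_of_eq_0_iff dest: Ints_abs_less_1)
  have "\<forall>\<^sub>F t in at 0. x + circle_of t \<notin> D"
    using 1 2 by eventually_elim auto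
  with assms(2) show ?thesis by (rule filter_leD)
qed

text \<open>For permutations this is equality modulo \<open>fin_perms\<close>. The generality serves
  injections such as \<open>arc_map a c\<close>, which need not be onto.\<close>

definition near :: "('a \<Rightarrow> 'b) \<Rightarrow> ('a \<Rightarrow> 'b) \<Rightarrow> bool"
  where "near f g \<longleftrightarrow> finite {x. f x \<noteq> g x}"

lemma near_refl [simp]: "near f f"
  by (simp add: near_def)

lemma near_sym: "near f g \<Longrightarrow> near g f"
  unfolding near_def by (simp add: eq_commute)

lemma near_trans: "near f g \<Longrightarrow> near g h \<Longrightarrow> near f h"
  unfolding near_def
  by (rule finite_subset[of _ "{x. f x \<noteq> g x} \<union> {x. g x \<noteq> h x}"]) auto

lemma near_comp:
  assumes "near f f'" "near g g'" "inj g"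
  shows "near (f \<circ> g) (f' \<circ> g')"
  unfolding near_def
proof (rule finite_subset)
  show "{x. (f \<circ> g) x \<noteq> (f' \<circ> g') x} \<subseteq> g -` {x. f x \<noteq> f' x} \<union> {x. g x \<noteq> g' x}" by auto
  show "finite (g -` {x. f x \<noteq> f' x} \<union> {x. g x \<noteq> g' x})"
    using assms finite_vimageI[of "{x. f x \<noteq> f' x}" g] by (simp add: near_def)
qed

lemma near_inv:
  assumes "near f g" "bij f" "bij g"
  shows "near (perm_inv f) (perm_inv g)"
  unfolding near_def
proof (rule finite_subset)
  show "{x. perm_inv f x \<noteq> perm_inv g x} \<subseteq> f ` {x. f x \<noteq> g x}"
  proof
    fix y assume "y \<in> {x. perm_inv f x \<noteq> perm_inv g x}"
    then have "f (perm_inv f y) \<noteq> g (perm_inv f y)"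
      using inv_f_f[OF bij_is_inj[OF assms(3)], of "perm_inv f y"]
        surj_f_inv_f[OF bij_is_surj[OF assms(2)], of y] by auto
    then show "y \<in> f ` {x. f x \<noteq> g x}"
      using assms(2) by (intro image_eqI[of _ _ "perm_inv f y"]) (auto simp: bij_is_surj surj_f_inv_f)
  qed
  show "finite (f ` {x. f x \<noteq> g x})" using assms by (simp add: near_def)
qed

text \<open>
  The relevant filters \<open>F\<close> are \<^term>\<open>at_left (0::real)\<close> and \<^term>\<open>at_right (0::real)\<close>:
  \<open>germ F f x l\<close> says that \<open>f\<close> translates by \<open>l\<close> just before, respectively just after, \<open>x\<close>.
\<close>

definition germ :: "real filter \<Rightarrow> (circle \<Rightarrow> circle) \<Rightarrow> circle \<Rightarrow> circle \<Rightarrow> bool"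
  where "germ F f x l \<longleftrightarrow> (\<forall>\<^sub>F t in F. f (x + circle_of t) = x + circle_of t + l)"

lemma germ_near:
  assumes "germ F f x l" "near f g" "F \<le> at 0"
  shows "germ F g x l"
  using eventually_circle_not_in_finite[OF assms(2)[unfolded near_def] assms(3), of x] assms(1)
  unfolding germ_def by eventually_elim auto

lemma germ_unique:
  assumes "germ F f x l" "germ F f x m" "F \<noteq> bot"
  shows "l = m"
proof -
  have "\<forall>\<^sub>F t in F. l = m"
    using assms(1,2) unfolding germ_def by eventually_elim auto
  with assms(3) show ?thesis by simp
qed

text \<open>A translation carries each side of x to the same side of \<open>x + l\<close>, so one
  filter serves both factors.\<close>

lemma germ_comp:
  assumes "germ F g x l" "germ F f (x + l) m"
  shows "germ F (f \<circ> g) x (l + m)"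
  using assms unfolding germ_def
  by eventually_elim (simp add: add_ac)

lemma germ_inv:
  assumes "germ F f x l" "inj f"
  shows "germ F (perm_inv f) (x + l) (- l)"
  using assms(1) unfolding germ_def
proof eventually_elim
  case (elim t)
  then have "x + l + circle_of t = f (x + circle_of t)" by (simp add: add_ac)
  then have "perm_inv f (x + l + circle_of t) = x + circle_of t" using assms(2) by simp
  then show ?case by simp
qed

lemma germ_tendsto:
  assumes "germ F f x l" "F \<le> at 0"
  shows "((\<lambda>t. f (x + circle_of t)) \<longlongrightarrow> x + l) F"
proof -
  have "((\<lambda>t. (x + l) + circle_of t) \<longlongrightarrow> x + l) F"
    by (rule tendsto_circle_of_0[OF assms(2)])
  moreover have "\<forall>\<^sub>F t in F. (x + l) + circle_of t = f (x + circle_of t)"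
    using assms(1) unfolding germ_def by eventually_elim (simp add: add_ac)
  ultimately show ?thesis by (rule Lim_transform_eventually)
qed

lemma locally_translation_at_iff:
  "locally_translation_at \<Lambda> f x \<longleftrightarrow> f x - x \<in> \<Lambda> \<and> (\<forall>\<^sub>F y in nhds x. f y = y + (f x - x))"
proof -
  have "f x - x = l" if "\<forall>\<^sub>F y in nhds x. f y = y + l" for l
    using eventually_nhds_x_imp_x[OF that] by simp
  then show ?thesis unfolding locally_translation_at_def by metis
qed

lemma locally_translation_at_mono:
  "locally_translation_at \<Lambda> f x \<Longrightarrow> \<Lambda> \<subseteq> \<Lambda>' \<Longrightarrow> locally_translation_at \<Lambda>' f x"
  by (auto simp: locally_translation_at_def)

lemma germ_locally_translation:
  assumes "\<forall>\<^sub>F y in nhds x. f y = y + l" "F \<le> at 0"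
  shows "germ F f x l"
proof -
  have "\<forall>\<^sub>F t in nhds 0. f (x + circle_of t) = x + circle_of t + l"
    using assms(1) nhds_circle_add[of x 0] by (simp add: circle_of_0 eventually_filtermap)
  then show ?thesis
    unfolding germ_def by (rule filter_leD[OF order_trans[OF assms(2) at_within_le_nhds]])
qed

lemma isCont_locally_translation:
  assumes "locally_translation_at \<Lambda> f x"
  shows "isCont f x"
proof -
  obtain l where l: "\<forall>\<^sub>F y in nhds x. f y = y + l"
    using assms unfolding locally_translation_at_def by blast
  have "((\<lambda>y. y + l) \<longlongrightarrow> x + l) (nhds x)"
    unfolding nhds_circle_shift filterlim_def by simp
  moreover have "\<forall>\<^sub>F y in nhds x. y + l = f y" using l by eventually_elim simp
  ultimately have "(f \<longlongrightarrow> x + l) (nhds x)" by (rule Lim_transform_eventually)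
  moreover have "f x = x + l" using l by (rule eventually_nhds_x_imp_x)
  ultimately have "(f \<longlongrightarrow> f x) (nhds x)" by simp
  then show ?thesis
    unfolding isCont_def by (rule tendsto_mono[OF at_within_le_nhds])
qed

text \<open>The displacement is locally constant along J, hence constant by connectedness.\<close>

lemma germ_exists_connected:
  assumes "connected J" "\<forall>\<^sub>F t in F. t \<in> J" "F \<noteq> bot"
    "\<And>t. t \<in> J \<Longrightarrow> locally_translation_at \<Lambda> f (x + circle_of t)"
  shows "\<exists>l\<in>\<Lambda>. germ F f x l"
proof -
  define d where "d t = f (x + circle_of t) - (x + circle_of t)" for t
  have loc: "\<forall>\<^sub>F s in at t within J. d t = d s" if "t \<in> J" for t
  proof -
    have "\<forall>\<^sub>F y in nhds (x + circle_of t). f y = y + d t"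
      using assms(4)[OF that] by (simp add: locally_translation_at_iff d_def)
    then have "\<forall>\<^sub>F s in nhds t. f (x + circle_of s) = x + circle_of s + d t"
      unfolding nhds_circle_add eventually_filtermap .
    then have "\<forall>\<^sub>F s in nhds t. d t = d s"
      by eventually_elim (simp add: d_def)
    then show ?thesis by (rule filter_leD[OF at_within_le_nhds])
  qed
  obtain a where a: "a \<in> J" using eventually_happens[OF assms(2)] assms(3) by auto
  have const: "d t = d a" if "t \<in> J" for t
    using connected_local_const[OF assms(1) that a] loc by blast
  have "germ F f x (d a)"
    unfolding germ_def using assms(2)
  proof eventually_elim
    case (elim t)
    from const[OF elim] have "f (x + circle_of t) - (x + circle_of t) = d a" by (simp only: d_def)
    then show ?case by (simp add: algebra_simps)
  qed
  moreover have "d a \<in> \<Lambda>" using assms(4)[OF a] by (simp add: locally_translation_at_iff d_def)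
  ultimately show ?thesis by blast
qed

lemma at_left_0_le: "at_left (0::real) \<le> at 0" and at_right_0_le: "at_right (0::real) \<le> at 0"
  by (simp_all add: at_le)

definition one_sided :: "real filter \<Rightarrow> bool"
  where "one_sided F \<longleftrightarrow> F = at_left 0 \<or> F = at_right 0"

lemma one_sided_left [simp]: "one_sided (at_left 0)" and one_sided_right [simp]: "one_sided (at_right 0)"
  by (simp_all add: one_sided_def)

lemma one_sided_le: "one_sided F \<Longrightarrow> F \<le> at 0"
  by (auto simp: one_sided_def at_left_0_le at_right_0_le)

lemma one_sided_neq_bot: "one_sided F \<Longrightarrow> F \<noteq> bot"
  using trivial_limit_at_left_real[of 0] trivial_limit_at_right_real[of 0]
  by (auto simp: one_sided_def trivial_limit_def)

lemma germ_exists: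
  assumes "finite {x. \<not> locally_translation_at \<Lambda> f x}" "one_sided F"
  shows "\<exists>l\<in>\<Lambda>. germ F f x l"
proof -
  have "\<forall>\<^sub>F t in at 0. x + circle_of t \<notin> {x. \<not> locally_translation_at \<Lambda> f x}"
    using eventually_circle_not_in_finite[OF assms(1) order_refl] .
  then obtain d where d: "d > 0" "\<And>t. t \<noteq> 0 \<Longrightarrow> \<bar>t\<bar> < d \<Longrightarrow> locally_translation_at \<Lambda> f (x + circle_of t)"
    by (auto simp: eventually_at dist_real_def)
  have "\<forall>\<^sub>F t in at_right (0::real). t \<in> {0<..<d}" "\<forall>\<^sub>F t in at_left (0::real). t \<in> {-d<..<0}"
    using d(1) by (auto intro: eventually_at_rightI[of 0 d] eventually_at_leftI[of "-d" 0])
  then obtain J where "connected J" "\<forall>\<^sub>F t in F. t \<in> J" "J = {0<..<d} \<or> J = {-d<..<0}"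
    using assms(2) connected_Ioo unfolding one_sided_def by blast
  then show ?thesis
    using d one_sided_neq_bot[OF assms(2)] by (intro germ_exists_connected[of J]) auto
qed

section \<open>Piecewise translations with parameters in a subgroup\<close>

locale circle_subgroup =
  fixes \<Lambda> :: "circle set"
  assumes zero_mem [simp, intro]: "0 \<in> \<Lambda>"
    and add_mem [intro]: "a \<in> \<Lambda> \<Longrightarrow> b \<in> \<Lambda> \<Longrightarrow> a + b \<in> \<Lambda>"
    and uminus_mem [intro]: "a \<in> \<Lambda> \<Longrightarrow> - a \<in> \<Lambda>"
begin

lemma diff_mem [intro]: "a \<in> \<Lambda> \<Longrightarrow> b \<in> \<Lambda> \<Longrightarrow> a - b \<in> \<Lambda>"
  using add_mem[of a "- b"] by auto

lemma add_mem_iff: "b \<in> \<Lambda> \<Longrightarrow> a + b \<in> \<Lambda> \<longleftrightarrow> a \<in> \<Lambda>"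
  using diff_mem[of "a + b" b] by auto

end

interpretation circle_UNIV: circle_subgroup UNIV
  by standard auto

definition piecewise_translations :: "circle set \<Rightarrow> (circle \<Rightarrow> circle) set"
  where "piecewise_translations \<Lambda> = {f. bij f \<and> finite {x. \<not> locally_translation_at \<Lambda> f x}}"

text \<open>These are all representatives of the classes in \<open>IET_over \<Lambda>\<close>, as
  \<open>mem_IET_over_iff\<close> shows. Equal germs on both sides mean that a discontinuity is
  removable; the value at x is left free.\<close>

definition iet_maps :: "circle set \<Rightarrow> (circle \<Rightarrow> circle) set"
  where "iet_maps \<Lambda> = {f \<in> piecewise_translations \<Lambda>.
    \<forall>x. x \<notin> \<Lambda> \<longrightarrow> (\<exists>l. germ (at_left 0) f x l \<and> germ (at_right 0) f x l)}"

text \<open>The left- or right-continuous representative of the class of \<open>f\<close>: the germ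
  at x is continued to x itself.\<close>

definition side :: "real filter \<Rightarrow> (circle \<Rightarrow> circle) \<Rightarrow> circle \<Rightarrow> circle"
  where "side F f x = x + (THE l. germ F f x l)"

lemma iet_maps_piecewise_translations: "f \<in> iet_maps \<Lambda> \<Longrightarrow> f \<in> piecewise_translations \<Lambda>"
  by (simp add: iet_maps_def)

lemma iet_maps_two_sided:
  assumes "f \<in> iet_maps \<Lambda>" "x \<notin> \<Lambda>"
  obtains l where "germ (at_left 0) f x l" "germ (at_right 0) f x l"
  using assms unfolding iet_maps_def by blast

lemma iet_mapsI:
  assumes "f \<in> piecewise_translations \<Lambda>"
    "\<And>x. x \<notin> \<Lambda> \<Longrightarrow> \<exists>l. germ (at_left 0) f x l \<and> germ (at_right 0) f x l"
  shows "f \<in> iet_maps \<Lambda>"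
  using assms by (simp add: iet_maps_def)

lemma piecewise_translations_bij: "f \<in> piecewise_translations \<Lambda> \<Longrightarrow> bij f"
  by (simp add: piecewise_translations_def)

lemma piecewise_translations_germ:
  "f \<in> piecewise_translations \<Lambda> \<Longrightarrow> one_sided F \<Longrightarrow> \<exists>l\<in>\<Lambda>. germ F f x l"
  by (rule germ_exists) (simp_all add: piecewise_translations_def)

lemma side_eqI: "germ F f x l \<Longrightarrow> one_sided F \<Longrightarrow> side F f x = x + l"
  unfolding side_def using germ_unique[OF _ _ one_sided_neq_bot] by (simp add: the_equality)

lemma germ_side:
  assumes "f \<in> piecewise_translations \<Lambda>" "one_sided F"
  shows "germ F f x (side F f x - x)" "side F f x - x \<in> \<Lambda>"
proof -
  obtain l where "l \<in> \<Lambda>" "germ F f x l" using piecewise_translations_germ[OF assms] by blast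
  with side_eqI[OF this(2) assms(2)]
  show "germ F f x (side F f x - x)" "side F f x - x \<in> \<Lambda>" by auto
qed

lemma side_cong_near: "near f g \<Longrightarrow> one_sided F \<Longrightarrow> side F f = side F g"
proof
  fix x assume n: "near f g" and F: "one_sided F"
  have "germ F f x = germ F g x"
    using germ_near[OF _ n one_sided_le[OF F]] germ_near[OF _ near_sym[OF n] one_sided_le[OF F]] by blast
  then show "side F f x = side F g x" by (simp add: side_def)
qed

lemma piecewise_translations_near:
  assumes "f \<in> piecewise_translations \<Lambda>" "near f g" "bij g"
  shows "g \<in> piecewise_translations \<Lambda>"
proof -
  let ?D = "{x. f x \<noteq> g x}"
  have fin: "finite ?D" using assms(2) by (simp add: near_def)
  have "locally_translation_at \<Lambda> g x" if f: "locally_translation_at \<Lambda> f x" and x: "x \<notin> ?D" for x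
  proof -
    obtain l where l: "l \<in> \<Lambda>" "\<forall>\<^sub>F y in nhds x. f y = y + l"
      using f unfolding locally_translation_at_def by blast
    have "\<forall>\<^sub>F y in nhds x. g y = y + l"
      using l(2) eventually_not_in_finite[OF fin x] by eventually_elim auto
    with l(1) show ?thesis by (auto simp: locally_translation_at_def)
  qed
  then have "{x. \<not> locally_translation_at \<Lambda> g x} \<subseteq> {x. \<not> locally_translation_at \<Lambda> f x} \<union> ?D"
    by blast
  moreover have "finite ({x. \<not> locally_translation_at \<Lambda> f x} \<union> ?D)"
    using assms(1) fin by (simp add: piecewise_translations_def)
  ultimately show ?thesis
    using assms(3) finite_subset by (auto simp: piecewise_translations_def)
qed

lemma iet_maps_near:
  assumes "f \<in> iet_maps \<Lambda>" "near f g" "bij g"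
  shows "g \<in> iet_maps \<Lambda>"
proof (rule iet_mapsI)
  show "g \<in> piecewise_translations \<Lambda>"
    by (rule piecewise_translations_near[OF iet_maps_piecewise_translations[OF assms(1)] assms(2,3)])
next
  fix x assume "x \<notin> \<Lambda>"
  then obtain l where "germ (at_left 0) f x l" "germ (at_right 0) f x l"
    by (rule iet_maps_two_sided[OF assms(1)])
  then show "\<exists>l. germ (at_left 0) g x l \<and> germ (at_right 0) g x l"
    using germ_near[OF _ assms(2) at_left_0_le] germ_near[OF _ assms(2) at_right_0_le] by blast
qed

lemma near_side:
  assumes "f \<in> piecewise_translations \<Lambda>" "one_sided F"
  shows "near (side F f) f"
  unfolding near_def
proof (rule finite_subset)
  show "finite {x. \<not> locally_translation_at \<Lambda> f x}" using assms by (simp add: piecewise_translations_def)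
  have "side F f x = f x" if "locally_translation_at \<Lambda> f x" for x
  proof -
    have "germ F f x (f x - x)"
      using that by (intro germ_locally_translation one_sided_le assms(2)) (simp add: locally_translation_at_iff)
    from side_eqI[OF this assms(2)] show ?thesis by simp
  qed
  then show "{x. side F f x \<noteq> f x} \<subseteq> {x. \<not> locally_translation_at \<Lambda> f x}" by blast
qed

context circle_subgroup
begin

lemma id_piecewise_translation: "id \<in> piecewise_translations \<Lambda>"
proof -
  have "locally_translation_at \<Lambda> id x" for x
    unfolding locally_translation_at_def by (rule bexI[of _ 0]) simp_all
  then show ?thesis by (simp add: piecewise_translations_def)
qed

lemma piecewise_translations_comp:
  assumes "f \<in> piecewise_translations \<Lambda>" "g \<in> piecewise_translations \<Lambda>"
  shows "f \<circ> g \<in> piecewise_translations \<Lambda>"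
proof -
  have inj: "inj g" using assms(2) by (simp add: piecewise_translations_def bij_is_inj)
  have "locally_translation_at \<Lambda> (f \<circ> g) x"
    if g: "locally_translation_at \<Lambda> g x" and f: "locally_translation_at \<Lambda> f (g x)" for x
  proof -
    obtain l where l: "l \<in> \<Lambda>" "\<forall>\<^sub>F y in nhds x. g y = y + l"
      using g unfolding locally_translation_at_def by blast
    obtain m where m: "m \<in> \<Lambda>" "\<forall>\<^sub>F y in nhds (g x). f y = y + m"
      using f unfolding locally_translation_at_def by blast
    have gx: "g x = x + l" using l(2) by (rule eventually_nhds_x_imp_x)
    have "\<forall>\<^sub>F y in nhds x. f (y + l) = y + l + m"
      using m(2) unfolding gx nhds_circle_shift eventually_filtermap .
    with l(2) have "\<forall>\<^sub>F y in nhds x. (f \<circ> g) y = y + (l + m)"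
      by eventually_elim (simp add: add_ac)
    with add_mem[OF l(1) m(1)] show ?thesis unfolding locally_translation_at_def by blast
  qed
  then have "{x. \<not> locally_translation_at \<Lambda> (f \<circ> g) x} \<subseteq>
      {x. \<not> locally_translation_at \<Lambda> g x} \<union> g -` {x. \<not> locally_translation_at \<Lambda> f x}" by blast
  moreover have "finite ({x. \<not> locally_translation_at \<Lambda> g x} \<union> g -` {x. \<not> locally_translation_at \<Lambda> f x})"
    using assms finite_vimageI[OF _ inj] unfolding piecewise_translations_def by blast
  ultimately have "finite {x. \<not> locally_translation_at \<Lambda> (f \<circ> g) x}" by (rule finite_subset)
  then show ?thesis using assms bij_comp[of g f] by (simp add: piecewise_translations_def)
qed

lemma piecewise_translations_inv:
  assumes "f \<in> piecewise_translations \<Lambda>"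
  shows "perm_inv f \<in> piecewise_translations \<Lambda>"
proof -
  have bij: "bij f" using assms by (rule piecewise_translations_bij)
  have "locally_translation_at \<Lambda> (perm_inv f) (f x)" if f: "locally_translation_at \<Lambda> f x" for x
  proof -
    obtain l where l: "l \<in> \<Lambda>" "\<forall>\<^sub>F y in nhds x. f y = y + l"
      using f unfolding locally_translation_at_def by blast
    have fx: "f x = x + l" using l(2) by (rule eventually_nhds_x_imp_x)
    have "\<forall>\<^sub>F y in nhds x. perm_inv f (y + l) = y + l + - l"
      using l(2)
    proof eventually_elim
      case (elim y)
      then have "y + l = f y" by simp
      then have "perm_inv f (y + l) = y" using bij_is_inj[OF bij] by simp
      then show ?case by simp
    qed
    then have "\<forall>\<^sub>F y in nhds (f x). perm_inv f y = y + - l"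
      unfolding fx nhds_circle_shift eventually_filtermap .
    with uminus_mem[OF l(1)] show ?thesis unfolding locally_translation_at_def by blast
  qed
  then have "perm_inv f y \<in> {x. \<not> locally_translation_at \<Lambda> f x}" if "\<not> locally_translation_at \<Lambda> (perm_inv f) y" for y
    using that surj_f_inv_f[OF bij_is_surj[OF bij], of y] by (metis mem_Collect_eq)
  then have "{x. \<not> locally_translation_at \<Lambda> (perm_inv f) x} \<subseteq> f ` {x. \<not> locally_translation_at \<Lambda> f x}"
    using surj_f_inv_f[OF bij_is_surj[OF bij]] by (intro subsetI image_eqI[of _ _ "perm_inv f _"]) auto
  moreover have "finite (f ` {x. \<not> locally_translation_at \<Lambda> f x})"
    using assms by (simp add: piecewise_translations_def)
  ultimately have "finite {x. \<not> locally_translation_at \<Lambda> (perm_inv f) x}" by (rule finite_subset)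
  then show ?thesis using bij_imp_bij_inv[OF bij] by (simp add: piecewise_translations_def)
qed

text \<open>This exact multiplicativity makes the one-sided representatives a lift and not just a
  choice of representatives.\<close>

lemma side_comp:
  assumes "f \<in> piecewise_translations \<Lambda>" "g \<in> piecewise_translations \<Lambda>" "one_sided F"
  shows "side F (f \<circ> g) = side F f \<circ> side F g"
proof
  fix x
  obtain l where l: "germ F g x l" using piecewise_translations_germ[OF assms(2,3)] by blast
  obtain m where m: "germ F f (x + l) m" using piecewise_translations_germ[OF assms(1,3)] by blast
  show "side F (f \<circ> g) x = (side F f \<circ> side F g) x"
    using side_eqI[OF germ_comp[OF l m]] side_eqI[OF l] side_eqI[OF m] assms(3)
    by (simp add: add_ac)
qed

lemma side_id: "one_sided F \<Longrightarrow> side F id = id"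
  by (rule ext) (use side_eqI[of F id _ 0] in \<open>auto simp: germ_def\<close>)

lemma side_inv:
  assumes "f \<in> piecewise_translations \<Lambda>" "one_sided F"
  shows "side F f \<circ> side F (perm_inv f) = id" "side F (perm_inv f) \<circ> side F f = id"
proof -
  have bij: "bij f" using assms by (simp add: piecewise_translations_bij)
  have "f \<circ> perm_inv f = id" "perm_inv f \<circ> f = id"
    using bij by (auto simp: bij_is_inj bij_is_surj surj_f_inv_f fun_eq_iff)
  then show "side F f \<circ> side F (perm_inv f) = id" "side F (perm_inv f) \<circ> side F f = id"
    using side_comp[OF assms(1) piecewise_translations_inv[OF assms(1)] assms(2)]
      side_comp[OF piecewise_translations_inv[OF assms(1)] assms] side_id[OF assms(2)]
    by simp_all
qed

text \<open>Bijectivity is not visible in single germs; it comes from the one-sided representative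
  of the inverse.\<close>

lemma side_piecewise_translation:
  assumes "f \<in> piecewise_translations \<Lambda>" "one_sided F"
  shows "side F f \<in> piecewise_translations \<Lambda>"
  by (rule piecewise_translations_near[OF assms(1) near_sym[OF near_side[OF assms]] o_bij])
     (rule side_inv[OF assms])+

lemma iet_maps_side:
  assumes "f \<in> iet_maps \<Lambda>" "one_sided F"
  shows "side F f \<in> iet_maps \<Lambda>"
proof (rule iet_maps_near[OF assms(1)])
  note f = iet_maps_piecewise_translations[OF assms(1)]
  show "near f (side F f)" by (rule near_sym[OF near_side[OF f assms(2)]])
  show "bij (side F f)"
    using side_piecewise_translation[OF f assms(2)] by (rule piecewise_translations_bij)
qed

lemma id_iet_maps: "id \<in> iet_maps \<Lambda>"
  by (rule iet_mapsI[OF id_piecewise_translation]) (rule exI[of _ 0], simp add: germ_def)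

lemma iet_maps_comp:
  assumes "f \<in> iet_maps \<Lambda>" "g \<in> iet_maps \<Lambda>"
  shows "f \<circ> g \<in> iet_maps \<Lambda>"
proof (rule iet_mapsI)
  note f = iet_maps_piecewise_translations[OF assms(1)]
  note g = iet_maps_piecewise_translations[OF assms(2)]
  show "f \<circ> g \<in> piecewise_translations \<Lambda>" by (rule piecewise_translations_comp[OF f g])
  fix x assume x: "x \<notin> \<Lambda>"
  then obtain l where l: "germ (at_left 0) g x l" "germ (at_right 0) g x l"
    by (rule iet_maps_two_sided[OF assms(2)])
  obtain m where "m \<in> \<Lambda>" "germ (at_left 0) g x m"
    using piecewise_translations_germ[OF g one_sided_left] by blast
  then have "l \<in> \<Lambda>"
    using germ_unique[OF l(1) _ one_sided_neq_bot[OF one_sided_left]] by blast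
  \<comment> \<open>Points outside \<Lambda> are moved by elements of \<Lambda>, so they stay
    outside, where the two germs of \<open>f\<close> agree as well.\<close>
  then have "x + l \<notin> \<Lambda>" using x add_mem_iff by blast
  then obtain m where "germ (at_left 0) f (x + l) m" "germ (at_right 0) f (x + l) m"
    by (rule iet_maps_two_sided[OF assms(1)])
  with l show "\<exists>l. germ (at_left 0) (f \<circ> g) x l \<and> germ (at_right 0) (f \<circ> g) x l"
    using germ_comp by blast
qed

lemma iet_maps_inv:
  assumes "f \<in> iet_maps \<Lambda>"
  shows "perm_inv f \<in> iet_maps \<Lambda>"
proof (rule iet_mapsI)
  note f = iet_maps_piecewise_translations[OF assms(1)]
  note f' = piecewise_translations_inv[OF f]
  note inj = bij_is_inj[OF piecewise_translations_bij[OF f]]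
  show "perm_inv f \<in> piecewise_translations \<Lambda>" by (rule f')
  fix x assume x: "x \<notin> \<Lambda>"
  define l where "l = side (at_left 0) (perm_inv f) x - x"
  have l: "germ (at_left 0) (perm_inv f) x l" "l \<in> \<Lambda>"
    using germ_side[OF f' one_sided_left] by (simp_all add: l_def)
  then have "x + l \<notin> \<Lambda>" using x add_mem_iff by blast
  then obtain m where m: "germ (at_left 0) f (x + l) m" "germ (at_right 0) f (x + l) m"
    by (rule iet_maps_two_sided[OF assms(1)])
  \<comment> \<open>Inverting the inverse recovers the left germ of \<open>f\<close> at
    \<open>x + l\<close> and so identifies \<open>m\<close>; the right germ of \<open>f\<close> can
    then be inverted.\<close>
  have "germ (at_left 0) f (x + l) (- l)"
    using germ_inv[OF l(1) bij_is_inj[OF piecewise_translations_bij[OF f']]]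
    by (simp add: inv_inv_eq piecewise_translations_bij[OF f])
  then have "m = - l"
    by (rule germ_unique[OF m(1) _ one_sided_neq_bot[OF one_sided_left]])
  then have "germ (at_right 0) (perm_inv f) x l" using germ_inv[OF m(2) inj] by simp
  with l show "\<exists>l. germ (at_left 0) (perm_inv f) x l \<and> germ (at_right 0) (perm_inv f) x l"
    by blast
qed

end

section \<open>Rigidity of near free actions\<close>

text \<open>For abelian groups this is the algebraic substitute for one-endedness.\<close>

locale broad_subgroup =
  fixes M :: "'k::ab_group_add set" and z :: "int \<Rightarrow> 'k"
  assumes zero_in: "0 \<in> M"
    and add_in: "a \<in> M \<Longrightarrow> b \<in> M \<Longrightarrow> a + b \<in> M"
    and uminus_in: "a \<in> M \<Longrightarrow> - a \<in> M"
    and z_add: "z (i + j) = z i + z j"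
    and inj_z: "inj z"
    and z_in: "z i \<in> M"
    and new_coset: "finite T \<Longrightarrow> \<exists>h\<in>M. \<forall>t\<in>T. h - t \<notin> range z"
begin

lemma diff_in: "a \<in> M \<Longrightarrow> b \<in> M \<Longrightarrow> a - b \<in> M"
  using add_in[of a "- b"] uminus_in by simp

lemma z_0: "z 0 = 0"
  using z_add[of 0 0] by simp

lemma z_minus: "z (- i) = - z i"
  using z_add[of i "- i"] z_0 by (simp add: eq_neg_iff_add_eq_0 add.commute)

lemma infinite_M: "infinite M"
  using finite_subset[of "range z" M] z_in inj_z finite_imageD[of z UNIV] by auto

lemma finite_z_preimage: "finite E \<Longrightarrow> finite {i. h + z i \<in> E}"
  using finite_vimageI[of E "\<lambda>i. h + z i"] inj_z by (auto simp: inj_def vimage_def)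

text \<open>
  An almost invariant function is constant along each coset of \<open>range z\<close> that avoids the
  exceptional set of \<open>z 1\<close>; comparison with one such coset controls the ends of all others.
\<close>

lemma almost_invariant_almost_constant:
  assumes "\<And>m. m \<in> M \<Longrightarrow> finite {h \<in> M. c (h + m) \<noteq> c h}"
  shows "\<exists>v. finite {h \<in> M. c h \<noteq> v}"
proof -
  define E where "E = {h \<in> M. c (h + z 1) \<noteq> c h}"
  have finE: "finite E" unfolding E_def by (rule assms[OF z_in])
  have const: "c (h + z i) = c h" if h: "h \<in> M" "\<forall>t\<in>E. h - t \<notin> range z" for h i
  proof -
    have step: "c (h + z (i + 1)) = c (h + z i)" for i
    proof (rule ccontr)
      assume "c (h + z (i + 1)) \<noteq> c (h + z i)"
      then have "h + z i \<in> E" using h(1) z_in add_in by (simp add: E_def z_add add.assoc)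
      moreover have "h - (h + z i) = z (- i)" by (simp add: z_minus)
      ultimately show False using h(2) by (metis rangeI)
    qed
    show ?thesis
    proof (induction i rule: int_induct[where k = 0])
      case (step2 i)
      then show ?case using step[of "i - 1"] by simp
    qed (simp_all add: z_0 step)
  qed
  obtain h0 where h0: "h0 \<in> M" "\<forall>t\<in>E. h0 - t \<notin> range z" using new_coset[OF finE] by blast
  \<comment> \<open>Translation by \<open>h - h0\<close> carries the constant coset through
    \<open>h0\<close> to the coset through \<open>h\<close> and changes \<open>c\<close> at finitely
    many places only.\<close>
  have ends: "finite {i. c (h + z i) \<noteq> c h0}" if "h \<in> M" for h
  proof -
    have "finite {i. h0 + z i \<in> {x \<in> M. c (x + (h - h0)) \<noteq> c x}}"
      by (intro finite_z_preimage assms diff_in that h0(1))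
    then show ?thesis
    proof (rule rev_finite_subset, safe)
      fix i assume "c (h + z i) \<noteq> c h0"
      moreover have "h0 + z i + (h - h0) = h + z i" by simp
      ultimately show "c (h0 + z i + (h - h0)) = c (h0 + z i) \<Longrightarrow> False"
        using const[OF h0] by simp
    qed (simp add: h0 z_in add_in)
  qed
  have "{h \<in> M. c h \<noteq> c h0} \<subseteq> (\<Union>e\<in>E. (\<lambda>i. e + z i) ` {i. c (e + z i) \<noteq> c h0})"
  proof
    fix h assume h: "h \<in> {h \<in> M. c h \<noteq> c h0}"
    show "h \<in> (\<Union>e\<in>E. (\<lambda>i. e + z i) ` {i. c (e + z i) \<noteq> c h0})"
    proof (cases "\<forall>t\<in>E. h - t \<notin> range z")
      case True
      \<comment> \<open>A coset avoiding \<open>E\<close> is constant, so a value other than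
        \<open>c h0\<close> would make the finite set in \<open>ends\<close> all of the
        integers.\<close>
      then have "{i. c (h + z i) \<noteq> c h0} = UNIV" using const h by auto
      with ends h show ?thesis by force
    next
      case False
      then obtain e i where "e \<in> E" "h - e = z i" by blast
      then have "e \<in> E" "h = e + z i" by (auto simp: algebra_simps)
      with h show ?thesis by blast
    qed
  qed
  moreover have "finite (\<Union>e\<in>E. (\<lambda>i. e + z i) ` {i. c (e + z i) \<noteq> c h0})"
    using finE ends by (auto simp: E_def)
  ultimately have "finite {h \<in> M. c h \<noteq> c h0}" by (rule finite_subset)
  then show ?thesis by blast
qed

lemma common_generic:
  assumes "finite {h \<in> M. \<not> P h}" "finite {h \<in> M. \<not> Q h}"
  obtains h where "h \<in> M" "P h" "Q h"
proof -
  have "infinite (M - ({h \<in> M. \<not> P h} \<union> {h \<in> M. \<not> Q h}))"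
    using assms infinite_M by (intro Diff_infinite_finite) auto
  then obtain h where "h \<in> M - ({h \<in> M. \<not> P h} \<union> {h \<in> M. \<not> Q h})"
    by (metis finite.emptyI equals0I)
  then show ?thesis using that by auto
qed

text \<open>The conjugating map sends \<open>x\<close> to the generic value of \<open>h \<mapsto> A (- h) (\<iota> (x + h))\<close>.\<close>

theorem near_free_action_rigid:
  fixes \<iota> :: "'k \<Rightarrow> 's" and A :: "'k \<Rightarrow> 's \<Rightarrow> 's"
  assumes "inj \<iota>"
    and A_add: "\<And>m n y. m \<in> M \<Longrightarrow> n \<in> M \<Longrightarrow> A (m + n) y = A m (A n y)"
    and A_0: "\<And>y. A 0 y = y"
    and A_near: "\<And>m. m \<in> M \<Longrightarrow> finite {x. A m (\<iota> x) \<noteq> \<iota> (x + m)}"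
  obtains \<phi> where "inj \<phi>" "\<And>m x. m \<in> M \<Longrightarrow> \<phi> (x + m) = A m (\<phi> x)" "near \<phi> \<iota>"
proof -
  define c where "c x h = A (- h) (\<iota> (x + h))" for x h
  have A_cancel: "A (- m) (A m y) = y" "A m (A (- m) y) = y" if "m \<in> M" for m y
    using A_add[of m "- m"] A_add[of "- m" m] A_0 that uminus_in by auto
  \<comment> \<open>\<open>c x (h + m)\<close> and \<open>c x h\<close> agree as soon as
    \<open>A m\<close> acts in the standard way at \<open>\<iota> (x + h)\<close>, which fails for
    finitely many h only.\<close>
  have "\<exists>v. finite {h \<in> M. c x h \<noteq> v}" for x
  proof (rule almost_invariant_almost_constant)
    fix m assume m: "m \<in> M"
    have fin: "finite ((\<lambda>h. x + h) -` {y. A m (\<iota> y) \<noteq> \<iota> (y + m)})"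
      by (intro finite_vimageI A_near m) (simp add: inj_def)
    show "finite {h \<in> M. c x (h + m) \<noteq> c x h}"
    proof (rule finite_subset[OF _ fin], intro subsetI, rule ccontr)
      fix h assume "h \<in> {h \<in> M. c x (h + m) \<noteq> c x h}"
        and "h \<notin> (\<lambda>h. x + h) -` {y. A m (\<iota> y) \<noteq> \<iota> (y + m)}"
      then have h: "h \<in> M" "c x (h + m) \<noteq> c x h" "A m (\<iota> (x + h)) = \<iota> (x + h + m)" by auto
      have "c x (h + m) = A (- h) (A (- m) (\<iota> (x + h + m)))"
        using A_add[of "- h" "- m"] h(1) m uminus_in by (simp add: c_def add.assoc)
      also have "\<dots> = c x h" using A_cancel m by (simp add: c_def flip: h(3))
      finally show False using h(2) by simp
    qed
  qed
  then obtain \<phi> where \<phi>: "finite {h \<in> M. c x h \<noteq> \<phi> x}" for x by metis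
  \<comment> \<open>A sequence of distinct elements of \<open>M\<close> meets the generic ones, so a
    constant value along it is the generic value.\<close>
  have \<phi>_eq: "\<phi> x = v" if "range s \<subseteq> M" "inj s" "\<And>n. c x (s n) = v" for x v and s :: "nat \<Rightarrow> 'k"
  proof (rule ccontr)
    assume "\<phi> x \<noteq> v"
    then have "range s \<subseteq> {h \<in> M. c x h \<noteq> \<phi> x}" using that by auto
    then show False using \<phi> finite_subset finite_imageD[OF _ that(2)] by blast
  qed
  have "inj \<phi>"
  proof
    fix x y assume eq: "\<phi> x = \<phi> y"
    obtain h where h: "h \<in> M" "c x h = \<phi> x" "c y h = \<phi> y" by (rule common_generic[OF \<phi> \<phi>])
    then have "A h (c x h) = A h (c y h)" using eq by simp
    then have "\<iota> (x + h) = \<iota> (y + h)" using A_cancel h(1) by (simp add: c_def)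
    then show "x = y" using \<open>inj \<iota>\<close> by (simp add: inj_eq)
  qed
  moreover have "\<phi> (x + m) = A m (\<phi> x)" if m: "m \<in> M" for m x
  proof -
    have "{h \<in> M. \<not> c x (h + m) = \<phi> x} \<subseteq> (\<lambda>h. h - m) ` {h \<in> M. c x h \<noteq> \<phi> x}"
      using add_in[OF _ m] by (auto simp: image_iff) (metis add_diff_cancel_right')
    then have "finite {h \<in> M. \<not> c x (h + m) = \<phi> x}"
      using \<phi> finite_subset by blast
    then obtain h where h: "h \<in> M" "c x (h + m) = \<phi> x" "c (x + m) h = \<phi> (x + m)"
      by (rule common_generic[OF _ \<phi>])
    have "c (x + m) h = A (m + - (h + m)) (\<iota> (x + (h + m)))"
      by (simp add: c_def algebra_simps)
    also have "\<dots> = A m (c x (h + m))"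
      unfolding c_def using m h(1) by (intro A_add uminus_in add_in)
    finally show ?thesis using h by simp
  qed
  moreover have "near \<phi> \<iota>"
  proof -
    \<comment> \<open>Only \<open>z 1\<close> is examined. If the forward or the backward ray of its
      orbit through x avoids \<open>F\<close>, then \<open>c x\<close> equals
      \<open>\<iota> x\<close> at infinitely many elements of \<open>M\<close>.\<close>
    define F where "F = {x. A (z 1) (\<iota> x) \<noteq> \<iota> (x + z 1)}"
    have finF: "finite F" unfolding F_def by (rule A_near[OF z_in])
    have fwd: "\<phi> x = \<iota> x" if x: "\<And>n. x + z (int n) \<notin> F" for x
    proof (rule \<phi>_eq[where s = "\<lambda>n. z (int n)"])
      have "A (z (int n)) (\<iota> x) = \<iota> (x + z (int n))" for n
      proof (induction n)
        case (Suc n)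
        have z_Suc: "z (int (Suc n)) = z 1 + z (int n)" using z_add[of 1 "int n"] by simp
        then have "A (z (int (Suc n))) (\<iota> x) = A (z 1) (A (z (int n)) (\<iota> x))"
          using A_add[OF z_in z_in] by simp
        also have "\<dots> = \<iota> (x + z (int (Suc n)))"
          using x[of n] by (simp add: Suc F_def add_ac z_Suc del: of_nat_Suc)
        finally show ?case .
      qed (simp add: z_0 A_0)
      then show "c x (z (int n)) = \<iota> x" for n
        using A_cancel(1)[OF z_in, of "int n" "\<iota> x"] by (simp add: c_def)
    qed (auto intro!: injI z_in simp: inj_eq[OF inj_z])
    \<comment> \<open>The shift by one: climbing from \<open>x - z n\<close> to x applies
      \<open>A (z 1)\<close> at \<open>x - z n\<close>, ..., \<open>x - z 1\<close>, but not at
      x.\<close>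
    have bwd: "\<phi> x = \<iota> x" if x: "\<And>n. x - z (int n + 1) \<notin> F" for x
    proof (rule \<phi>_eq[where s = "\<lambda>n. - z (int n)"])
      have "A (z (int n)) (\<iota> (x - z (int n))) = \<iota> x" for n
      proof (induction n)
        case (Suc n)
        have "A (z (int (Suc n))) (\<iota> (x - z (int (Suc n))))
            = A (z (int n)) (A (z 1) (\<iota> (x - z (int n + 1))))"
          using A_add[OF z_in z_in, of "int n" 1] by (simp add: add.commute flip: z_add)
        also have "\<dots> = \<iota> x"
          using x[of n] Suc by (simp add: F_def z_add algebra_simps)
        finally show ?case .
      qed (simp add: z_0 A_0)
      then show "c x (- z (int n)) = \<iota> x" for n by (simp add: c_def)
    qed (auto intro!: injI uminus_in z_in simp: inj_eq[OF inj_z])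
    \<comment> \<open>A remaining x lies on its coset between two points of the finite set
      \<open>F\<close>; its distance to the upper one is bounded by their separation.\<close>
    have "{x. \<phi> x \<noteq> \<iota> x} \<subseteq> (\<Union>f\<in>F. \<Union>f'\<in>F. (\<lambda>n. f - z n) ` {0..inv_into UNIV z (f - f')})"
    proof
      fix x assume "x \<in> {x. \<phi> x \<noteq> \<iota> x}"
      then obtain n n' where n: "x + z (int n) \<in> F" "x - z (int n' + 1) \<in> F"
        using fwd bwd by blast
      have "(x + z (int n)) - (x - z (int n' + 1)) = z (int n + (int n' + 1))"
        by (simp add: z_add)
      then have "int n \<in> {0..inv_into UNIV z ((x + z (int n)) - (x - z (int n' + 1)))}"
        using inj_z by simp
      moreover have "x = (x + z (int n)) - z (int n)" by simp
      ultimately show "x \<in> (\<Union>f\<in>F. \<Union>f'\<in>F. (\<lambda>n. f - z n) ` {0..inv_into UNIV z (f - f')})"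
        using n by blast
    qed
    then show ?thesis unfolding near_def by (rule finite_subset) (use finF in auto)
  qed
  ultimately show ?thesis using that by blast
qed

end

section \<open>The rank of a subgroup of the circle\<close>

text \<open>Only upper bounds on the rank are wanted: if every element has a positive power in one
  fixed cyclic subgroup, the rank is at most 1. Tensors are handled through representatives in
  \<open>F\<close>.\<close>

locale rational_tensor = comm_group G for G :: "('a, 'b) monoid_scheme" (structure)
begin

abbreviation R where "R \<equiv> tensor_rat_relations G"
abbreviation F where "F \<equiv> free_Abelian_group (carrier G \<times> (UNIV :: rat set))"
abbreviation cls where "cls x \<equiv> R #>\<^bsub>F\<^esub> x"

lemma relation_generators:
  "{frag_of (a \<otimes> b, q) - frag_of (a, q) - frag_of (b, q) |a b q. a \<in> carrier G \<and> b \<in> carrier G} \<union>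
   {frag_of (a, q + r) - frag_of (a, q) - frag_of (a, r) |a q r. a \<in> carrier G} \<subseteq> carrier F"
  (is "?X \<subseteq> _")
proof -
  have keys: "Poly_Mapping.keys (frag_of x - frag_of y - frag_of z) \<subseteq> {x, y, z}" for x y z :: "'a \<times> rat"
    using keys_diff[of "frag_of x - frag_of y" "frag_of z"] keys_diff[of "frag_of x" "frag_of y"]
    by auto
  have *: "frag_of x - frag_of y - frag_of z \<in> carrier F"
    if "{x, y, z} \<subseteq> carrier G \<times> UNIV" for x y z :: "'a \<times> rat"
    unfolding carrier_free_Abelian_group_iff by (rule order_trans[OF keys that])
  show ?thesis by (auto intro!: * simp del: carrier_free_Abelian_group_iff)
qed

lemma R_subgroup: "subgroup R F"
  unfolding tensor_rat_relations_def
  by (rule group.generate_is_subgroup[OF group_free_Abelian_group relation_generators])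

lemma R_normal: "R \<lhd> F"
  by (rule comm_group.subgroup_imp_normal[OF abelian_free_Abelian_group R_subgroup])

lemma R_carrier: "x \<in> R \<Longrightarrow> x \<in> carrier F"
  using subgroup.mem_carrier[OF R_subgroup] .

lemma R_0: "0 \<in> R"
  using subgroup.one_closed[OF R_subgroup] by simp

lemma R_add: "x \<in> R \<Longrightarrow> y \<in> R \<Longrightarrow> x + y \<in> R"
  using subgroup.m_closed[OF R_subgroup] by fastforce

lemma R_uminus: "x \<in> R \<Longrightarrow> - x \<in> R"
  using subgroup.m_inv_closed[OF R_subgroup, of x] R_carrier[of x] by simp

lemma R_diff: "x \<in> R \<Longrightarrow> y \<in> R \<Longrightarrow> x - y \<in> R"
  using R_add[of x "- y"] R_uminus by simp

lemma R_left: "a \<in> carrier G \<Longrightarrow> b \<in> carrier G \<Longrightarrow> frag_of (a \<otimes> b, q) - frag_of (a, q) - frag_of (b, q) \<in> R"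
  and R_right: "a \<in> carrier G \<Longrightarrow> frag_of (a, q + r) - frag_of (a, q) - frag_of (a, r) \<in> R"
  unfolding tensor_rat_relations_def by (rule generate.incl, blast)+

lemma mem_cls: "y \<in> cls x \<longleftrightarrow> y - x \<in> R"
  by (auto simp: r_coset_def intro: bexI[of _ "y - x"])

lemma cls_eq_iff: "cls x = cls y \<longleftrightarrow> x - y \<in> R"
proof
  assume "cls x = cls y"
  then show "x - y \<in> R" using R_0 mem_cls[of x x] mem_cls[of x y] by simp
next
  assume xy: "x - y \<in> R"
  have "z - x \<in> R \<longleftrightarrow> z - y \<in> R" for z
    using R_add[OF _ xy, of "z - x"] R_diff[OF _ xy, of "z - y"] by auto
  then show "cls x = cls y" by (auto simp: mem_cls)
qed

lemma cls_0: "cls 0 = R"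
  by (auto simp: mem_cls)

lemma tensor_one: "\<one>\<^bsub>tensor_rat G\<^esub> = cls 0"
  by (simp add: tensor_rat_def FactGroup_def cls_0)

lemma tensor_carrier: "carrier (tensor_rat G) = cls ` carrier F"
  by (auto simp: tensor_rat_def FactGroup_def RCOSETS_def)

lemma tensor_mult:
  "x \<in> carrier F \<Longrightarrow> y \<in> carrier F \<Longrightarrow> cls x \<otimes>\<^bsub>tensor_rat G\<^esub> cls y = cls (x + y)"
  using normal.rcos_sum[OF R_normal, of x y] by (simp add: tensor_rat_def FactGroup_def)

lemma tensor_comm_group: "comm_group (tensor_rat G)"
proof (rule group.group_comm_groupI)
  show "group (tensor_rat G)"
    unfolding tensor_rat_def by (rule normal.factorgroup_is_group[OF R_normal])
  show "x \<otimes>\<^bsub>tensor_rat G\<^esub> y = y \<otimes>\<^bsub>tensor_rat G\<^esub> x"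
    if xy: "x \<in> carrier (tensor_rat G)" "y \<in> carrier (tensor_rat G)" for x y
  proof -
    obtain a b where "x = cls a" "y = cls b" "a \<in> carrier F" "b \<in> carrier F"
      using xy unfolding tensor_carrier by blast
    then show ?thesis by (simp only: tensor_mult add.commute)
  qed
qed

text \<open>Replacing \<open>q\<close> by \<open>r * q\<close> turns each defining relation into a
  defining relation, so the substitution preserves \<open>R\<close> and descends to classes.\<close>

lemma scale_cls:
  assumes "x \<in> carrier F"
  shows "tensor_rat_scale G r (cls x) = cls (frag_extend (\<lambda>(a, q). frag_of (a, r * q)) x)"
proof -
  define e :: "('a \<times> rat \<Rightarrow>\<^sub>0 int) \<Rightarrow> _" where "e = frag_extend (\<lambda>(a, q). frag_of (a, r * q))"
  have eR: "e y \<in> R" if "y \<in> R" for y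
    using that[unfolded tensor_rat_relations_def]
  proof (induction rule: generate.induct)
    case one
    show ?case using R_0 by (simp add: e_def)
  next
    case (incl h)
    then show ?case
      using R_left R_right by (auto simp: e_def frag_extend_diff distrib_left)
  next
    case (inv h)
    then have "h \<in> carrier F" using relation_generators by blast
    moreover have "e h \<in> R"
      using inv R_left R_right by (auto simp: e_def frag_extend_diff distrib_left)
    ultimately show ?case
      using R_uminus by (simp add: e_def frag_extend_minus)
  next
    case (eng h1 h2)
    then show ?case
      using R_add by (simp add: e_def frag_extend_add)
  qed
  have "tensor_rat_scale G r (cls x) = (\<Union>h\<in>R. \<Union>y\<in>cls x. {h + e y})"
    by (simp add: tensor_rat_scale_def set_mult_def e_def)
  also have "\<dots> = cls (e x)"
  proof (intro equalityI subsetI)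
    fix w assume "w \<in> (\<Union>h\<in>R. \<Union>y\<in>cls x. {h + e y})"
    then obtain h y where hy: "h \<in> R" "y - x \<in> R" "w = h + e y" by (auto simp: mem_cls)
    have "e y - e x \<in> R" using eR[OF hy(2)] by (simp add: e_def frag_extend_diff)
    with hy show "w \<in> cls (e x)" using R_add[of h "e y - e x"] by (simp add: mem_cls add_diff_eq)
  next
    fix w assume "w \<in> cls (e x)"
    then have "w - e x \<in> R" by (simp add: mem_cls)
    moreover have "x \<in> cls x" by (simp add: mem_cls R_0)
    ultimately show "w \<in> (\<Union>h\<in>R. \<Union>y\<in>cls x. {h + e y})" by (intro UN_I[of "w - e x"] UN_I[of x]) simp_all
  qed
  finally show ?thesis by (simp add: e_def)
qed

lemma R_nat_pow:
  assumes "a \<in> carrier G"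
  shows "frag_of (a [^] (n::nat), q) - frag_of (a, of_nat n * q) \<in> R"
proof (induction n)
  case 0
  \<comment> \<open>With both group elements \<open>\<one>\<close>, or both scalars 0, a bilinearity
    relation is minus a single generator.\<close>
  have "frag_of (\<one>, q) \<in> R" "frag_of (a, 0) \<in> R"
    using R_uminus[OF R_left[of \<one> \<one> q]] R_uminus[OF R_right[OF assms, of 0 0]] by simp_all
  then show ?case using R_diff by simp
next
  case (Suc n)
  \<comment> \<open>The pattern in which the relation for the product, the induction hypothesis and
    the relation for the scalars telescope.\<close>
  have "(x - y - z) + (y - w) + - (v - w - z) = x - v" for x y z v w :: "'a \<times> rat \<Rightarrow>\<^sub>0 int"
    by simp
  moreover have "of_nat (Suc n) * q = of_nat n * q + q" by (simp add: algebra_simps)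
  ultimately show ?case
    using R_add[OF R_add[OF R_left[of "a [^] n" a q] Suc] R_uminus[OF R_right[OF assms, of "of_nat n * q" q]]] assms
    by (simp only: nat_pow_closed nat_pow_Suc)
qed

lemma R_int_pow:
  assumes "a \<in> carrier G"
  shows "frag_of (a [^] (i::int), q) - frag_of (a, of_int i * q) \<in> R"
proof (cases i rule: int_cases2)
  case (nonneg n)
  show ?thesis using R_nat_pow[OF assms, of n q] unfolding nonneg int_pow_int by (simp only: of_int_of_nat_eq)
next
  case i: (nonpos n)
  have b: "a [^] n \<in> carrier G" using assms by simp
  have pow: "a [^] i = inv (a [^] n)" by (simp add: i int_pow_neg_int assms)
  have one: "frag_of (\<one>, q) \<in> R" "frag_of (a, 0) \<in> R"
    using R_uminus[OF R_left[of \<one> \<one> q]] R_uminus[OF R_right[OF assms, of 0 0]] by simp_all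
  have c1: "frag_of (inv (a [^] n), q) + frag_of (a [^] n, q) \<in> R"
    using R_diff[OF one(1) R_left[of "inv (a [^] n)" "a [^] n" q]] b by (simp add: add.commute)
  have c2: "frag_of (a, - (of_nat n * q)) + frag_of (a, of_nat n * q) \<in> R"
    using R_diff[OF one(2) R_right[OF assms, of "- (of_nat n * q)" "of_nat n * q"]] by (simp add: add.commute)
  have "x + y - (v + w) - (y - w) = x - v" for x y v w :: "'a \<times> rat \<Rightarrow>\<^sub>0 int"
    by simp
  then show ?thesis
    unfolding pow using R_diff[OF R_diff[OF c1 c2] R_nat_pow[OF assms, of n q]] by (simp add: i)
qed

section \<open>Groups commensurable with a cyclic group\<close>

context
  fixes k
  assumes k: "k \<in> carrier G"
    and commensurable: "\<And>a. a \<in> carrier G \<Longrightarrow> \<exists>n>0. \<exists>i::int. a [^] (n::nat) = k [^] i"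
begin

abbreviation P where "P s \<equiv> cls (frag_of (k, s))"

lemma P_carrier: "P s \<in> carrier (tensor_rat G)"
  using k by (auto simp: tensor_carrier)

lemma P_0: "P 0 = \<one>\<^bsub>tensor_rat G\<^esub>"
  unfolding tensor_one cls_eq_iff using R_uminus[OF R_right[OF k, of 0 0]] by simp

lemma P_mult: "P s \<otimes>\<^bsub>tensor_rat G\<^esub> P t = P (s + t)"
proof -
  have "P s \<otimes>\<^bsub>tensor_rat G\<^esub> P t = cls (frag_of (k, s) + frag_of (k, t))"
    using k by (intro tensor_mult) auto
  also have "\<dots> = P (s + t)"
    unfolding cls_eq_iff using R_uminus[OF R_right[OF k, of s t]] by (simp add: algebra_simps)
  finally show ?thesis .
qed

lemma P_scale: "tensor_rat_scale G r (P s) = P (r * s)"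
  using k by (subst scale_cls) auto

text \<open>If \<open>a [^] n = k [^] i\<close>, then a tensor q equals \<open>a [^] n\<close>
  tensor q/n, that is, k tensor i q/n. Differences collapse by additivity in the scalar.\<close>

lemma tensor_cyclic:
  assumes "w \<in> carrier (tensor_rat G)"
  obtains s where "w = P s"
proof -
  obtain x where x: "w = cls x" "Poly_Mapping.keys x \<subseteq> carrier G \<times> UNIV"
    using assms by (auto simp: tensor_carrier)
  have "\<exists>s. x - frag_of (k, s) \<in> R"
    using x(2)
  proof (induction x rule: frag_induction)
    case zero
    show ?case using R_right[OF k, of 0 0] by (intro exI[of _ 0]) simp
  next
    case (one y)
    obtain a q where y: "y = (a, q)" by (cases y)
    then have a: "a \<in> carrier G" using one by auto
    obtain n i where n: "n > 0" and ni: "a [^] (n::nat) = k [^] (i::int)" using commensurable[OF a] by blast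
    have "frag_of (a, of_nat n * (q / of_nat n)) - frag_of (k, of_int i * (q / of_nat n)) \<in> R"
      using R_diff[OF R_int_pow[OF k, of i "q / of_nat n"] R_nat_pow[OF a, of n "q / of_nat n"]]
      by (simp add: ni)
    then show ?case using n by (auto simp: y)
  next
    case (diff x y)
    then obtain s t where st: "x - frag_of (k, s) \<in> R" "y - frag_of (k, t) \<in> R" by blast
    have "(x - a) - (y - b) + (a - c - b) = x - y - c" for a b c :: "'a \<times> rat \<Rightarrow>\<^sub>0 int"
      by simp
    then have "x - y - frag_of (k, s - t) \<in> R"
      using R_add[OF R_diff[OF st] R_right[OF k, of "s - t" t]] by simp
    then show ?case by blast
  qed
  then show ?thesis using that x(1) cls_eq_iff by blast
qed

lemma scale_closed:
  assumes "w \<in> carrier (tensor_rat G)"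
  shows "tensor_rat_scale G r w \<in> carrier (tensor_rat G)"
proof -
  obtain s where "w = P s" by (rule tensor_cyclic[OF assms])
  then show ?thesis by (simp only: P_scale P_carrier)
qed

lemma basis_card_le_1:
  assumes "finite_rat_basis G B"
  shows "card B \<le> 1"
proof (rule ccontr)
  interpret T: comm_group "tensor_rat G" by (rule tensor_comm_group)
  have B: "finite B" "B \<subseteq> carrier (tensor_rat G)"
    and indep: "\<And>u. tensor_rat_lincomb G u B = \<one>\<^bsub>tensor_rat G\<^esub> \<Longrightarrow> \<forall>v\<in>B. u v = 0"
    using assms by (auto simp: finite_rat_basis_def)
  assume "\<not> card B \<le> 1"
  then obtain v w where vw: "v \<in> B" "w \<in> B" "v \<noteq> w"
    using card_le_Suc0_iff_eq[OF B(1)] by auto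
  obtain s where s: "v = P s" using tensor_cyclic vw B by blast
  obtain t where t: "w = P t" using tensor_cyclic vw B by blast
  \<comment> \<open>The combination t v - s w of \<open>v = P s\<close> and \<open>w = P t\<close>
    vanishes; independence then forces s = t = 0 and so v = w.\<close>
  define u where "u = (\<lambda>_. 0)(v := t, w := - s)"
  have "B = insert v (insert w (B - {v, w}))" using vw by blast
  moreover have "tensor_rat_lincomb G u (insert v (insert w (B - {v, w}))) =
      tensor_rat_scale G (u v) v \<otimes>\<^bsub>tensor_rat G\<^esub> (tensor_rat_scale G (u w) w \<otimes>\<^bsub>tensor_rat G\<^esub>
       finprod (tensor_rat G) (\<lambda>v. tensor_rat_scale G (u v) v) (B - {v, w}))"
  proof -
    have cl: "tensor_rat_scale G (u x) x \<in> carrier (tensor_rat G)" if "x \<in> B" for x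
      by (rule scale_closed[OF subsetD[OF B(2) that]])
    then show ?thesis
      unfolding tensor_rat_lincomb_def using vw B(1)
      by (subst T.finprod_insert; auto)+
  qed
  moreover have "finprod (tensor_rat G) (\<lambda>v. tensor_rat_scale G (u v) v) (B - {v, w}) = \<one>\<^bsub>tensor_rat G\<^esub>"
  proof (rule T.finprod_one_eqI)
    fix x assume x: "x \<in> B - {v, w}"
    then obtain r where "x = P r" using tensor_cyclic B by blast
    with x show "tensor_rat_scale G (u x) x = \<one>\<^bsub>tensor_rat G\<^esub>" by (simp add: u_def P_scale P_0)
  qed
  ultimately have "tensor_rat_lincomb G u B = P (t * s) \<otimes>\<^bsub>tensor_rat G\<^esub> P (- s * t)"
    using vw(3) P_carrier by (simp add: u_def s t P_scale)
  then have "\<forall>x\<in>B. u x = 0" using P_0 by (intro indep) (simp add: P_mult)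
  then have "s = 0 \<and> t = 0" using vw by (auto simp: u_def split: if_splits)
  then show False using vw(3) s t by simp
qed

text \<open>Without a finite basis \<open>rat_rank\<close> would be infinite by definition. Whether
  \<open>P 1\<close> vanishes decides between the empty basis and \<open>{P 1}\<close>.\<close>

lemma finite_rat_basis_exists: "\<exists>B. finite_rat_basis G B"
proof (cases "P 1 = \<one>\<^bsub>tensor_rat G\<^esub>")
  case True
  have "w = \<one>\<^bsub>tensor_rat G\<^esub>" if w: "w \<in> carrier (tensor_rat G)" for w
  proof -
    obtain s where "w = P s" by (rule tensor_cyclic[OF w])
    then show ?thesis using P_scale[of s 1] P_scale[of s 0] True P_0 by simp
  qed
  with comm_monoid.finprod_empty[OF comm_group.axioms(1)[OF tensor_comm_group]] have "finite_rat_basis G {}"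
    unfolding finite_rat_basis_def tensor_rat_lincomb_def by fastforce
  then show ?thesis by blast
next
  case False
  interpret T: comm_group "tensor_rat G" by (rule tensor_comm_group)
  have lc: "tensor_rat_lincomb G u {P 1} = P (u (P 1))" for u
    unfolding tensor_rat_lincomb_def using P_carrier by (simp add: P_scale)
  have "u (P 1) = 0" if "P (u (P 1)) = \<one>\<^bsub>tensor_rat G\<^esub>" for u
  proof (rule ccontr)
    assume nz: "u (P 1) \<noteq> 0"
    have "P 1 = tensor_rat_scale G (1 / u (P 1)) (P (u (P 1)))" using nz by (simp only: P_scale) simp
    also have "\<dots> = tensor_rat_scale G (1 / u (P 1)) (P 0)" using that P_0 by simp
    also have "\<dots> = \<one>\<^bsub>tensor_rat G\<^esub>" by (simp only: P_scale) (simp add: P_0)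
    finally show False using False by simp
  qed
  moreover have "\<exists>u. w = P (u (P 1))" if "w \<in> carrier (tensor_rat G)" for w
    using tensor_cyclic[OF that] by metis
  ultimately have "finite_rat_basis G {P 1}"
    unfolding finite_rat_basis_def using P_carrier by (simp add: lc)
  then show ?thesis by blast
qed

lemma rat_rank_le_1: "rat_rank G \<le> 1"
proof -
  have "card (SOME B. finite_rat_basis G B) \<le> 1"
    by (rule basis_card_le_1[OF someI_ex[OF finite_rat_basis_exists]])
  then show ?thesis using finite_rat_basis_exists by (simp add: rat_rank_def one_enat_def)
qed

text \<open>Here every element is torsion and the tensor product is zero, so coefficients all equal
  to 1 would violate the independence of a nonempty basis.\<close>

lemma rat_rank_eq_0:
  assumes "k = \<one>"
  shows "rat_rank G = 0"
proof -
  have trivial: "P s = \<one>\<^bsub>tensor_rat G\<^esub>" for s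
    unfolding tensor_one cls_eq_iff using R_uminus[OF R_left[of \<one> \<one> s]] assms by simp
  have "B = {}" if B: "finite_rat_basis G B" for B
  proof (rule ccontr)
    assume "B \<noteq> {}"
    then obtain v where v: "v \<in> B" by blast
    interpret T: comm_group "tensor_rat G" by (rule tensor_comm_group)
    have "tensor_rat_scale G 1 x = \<one>\<^bsub>tensor_rat G\<^esub>" if "x \<in> B" for x
    proof -
      have "x \<in> carrier (tensor_rat G)" using that B unfolding finite_rat_basis_def by blast
      then obtain s where s: "x = P s" by (rule tensor_cyclic)
      show ?thesis unfolding s P_scale by (rule trivial)
    qed
    then have "tensor_rat_lincomb G (\<lambda>_. 1) B = \<one>\<^bsub>tensor_rat G\<^esub>"
      unfolding tensor_rat_lincomb_def by (rule T.finprod_one_eqI)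
    then have "(1::rat) = 0" using B v unfolding finite_rat_basis_def by blast
    then show False by simp
  qed
  from this[OF someI_ex[OF finite_rat_basis_exists]]
  have "card (SOME B. finite_rat_basis G B) = 0" by (simp only: card.empty)
  then show ?thesis using finite_rat_basis_exists by (simp add: rat_rank_def zero_enat_def)
qed

end

end

section \<open>From the rank of \<Lambda> to its elements and cosets\<close>

lemma circle_group_subgroup:
  assumes "subgroup \<Lambda> circle_group"
  shows "circle_subgroup \<Lambda>"
proof -
  have "group circle_group"
    by (rule groupI) (auto simp: circle_group_def add.assoc intro: exI[of _ "- x" for x])
  then have "inv\<^bsub>circle_group\<^esub> x = - x" for x
    by (rule group.inv_equality) (auto simp: circle_group_def)
  then show ?thesis
    using subgroup.one_closed[OF assms] subgroup.m_closed[OF assms] subgroup.m_inv_closed[OF assms]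
    by unfold_locales (auto simp: circle_group_def)
qed

context circle_subgroup
begin

abbreviation group_of_subgroup ("\<G>") where "\<G> \<equiv> circle_group\<lparr>carrier := \<Lambda>\<rparr>"

lemma one_eq: "\<one>\<^bsub>circle_group\<^esub> = 0" and mult_eq: "a \<otimes>\<^bsub>circle_group\<^esub> b = a + b"
  by (simp_all add: circle_group_def)

lemma comm_group: "comm_group \<G>"
proof (rule comm_groupI)
  show "\<exists>y\<in>carrier \<G>. y \<otimes>\<^bsub>\<G>\<^esub> x = \<one>\<^bsub>\<G>\<^esub>" if "x \<in> carrier \<G>" for x
    using that by (intro bexI[of _ "- x"]) (auto simp: circle_group_def)
qed (auto simp: circle_group_def add_ac)

lemma inv_eq: "a \<in> \<Lambda> \<Longrightarrow> inv\<^bsub>\<G>\<^esub> a = - a"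
  using comm_group by (intro group.inv_equality comm_group.axioms(2)) (auto simp: circle_group_def)

lemma nat_pow_eq: "circle_of \<alpha> [^]\<^bsub>\<G>\<^esub> (n::nat) = circle_of (of_nat n * \<alpha>)"
  by (induction n) (simp_all add: one_eq mult_eq circle_of_0 distrib_right circle_of_add add.commute)

lemma int_multiple_mem:
  assumes "circle_of \<alpha> \<in> \<Lambda>"
  shows "circle_of (of_int i * \<alpha>) \<in> \<Lambda>"
proof -
  have nat: "circle_of (of_nat n * \<alpha>) \<in> \<Lambda>" for n
    using monoid.nat_pow_closed[OF group.is_monoid[OF comm_group.axioms(2)[OF comm_group]], of "circle_of \<alpha>" n]
      assms by (simp add: nat_pow_eq)
  show ?thesis
    using nat uminus_mem[OF nat] by (cases i rule: int_cases2) (simp_all add: circle_of_minus)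
qed

lemma int_pow_eq:
  assumes "circle_of \<alpha> \<in> \<Lambda>"
  shows "circle_of \<alpha> [^]\<^bsub>\<G>\<^esub> (i::int) = circle_of (of_int i * \<alpha>)"
proof (cases i rule: int_cases2)
  case (nonneg n)
  then show ?thesis by (simp add: int_pow_int nat_pow_eq)
next
  case (nonpos n)
  have "circle_of (of_nat n * \<alpha>) \<in> \<Lambda>" using int_multiple_mem[OF assms, of "int n"] by simp
  then show ?thesis
    using group.int_pow_neg_int[OF comm_group.axioms(2)[OF comm_group], of "circle_of \<alpha>" n] assms
    by (simp add: nonpos nat_pow_eq inv_eq circle_of_minus)
qed

text \<open>If only rational reals lay over \<Lambda>, all its elements would have finite order,
  that is, be commensurable with the identity.\<close>

lemma irrational_mem:
  assumes "rat_rank \<G> \<noteq> 0"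
  obtains \<kappa> where "circle_of \<kappa> \<in> \<Lambda>" "\<kappa> \<notin> \<rat>"
proof (rule ccontr)
  assume "\<not> thesis"
  with that have rat: "\<kappa> \<in> \<rat>" if "circle_of \<kappa> \<in> \<Lambda>" for \<kappa> using that by blast
  interpret rational_tensor \<G> by (simp add: rational_tensor_def comm_group)
  have "\<exists>n>0. \<exists>i::int. a [^]\<^bsub>\<G>\<^esub> (n::nat) = \<one>\<^bsub>\<G>\<^esub> [^]\<^bsub>\<G>\<^esub> i" if "a \<in> carrier \<G>" for a
  proof -
    obtain \<alpha> where \<alpha>: "a = circle_of \<alpha>" by (rule circle_of_cases)
    then have "\<alpha> \<in> \<rat>" using that rat by simp
    then obtain p q :: int where "q > 0" "\<alpha> = of_int p / of_int q" by (rule Rats_cases')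
    then obtain q :: nat where q: "q > 0" "\<alpha> = of_int p / of_nat q"
      by (metis of_int_of_nat_eq of_nat_0_less_iff zero_less_imp_eq_int)
    then have "circle_of (of_nat q * \<alpha>) = 0" by (simp add: circle_of_eq_0_iff)
    then have "a [^]\<^bsub>\<G>\<^esub> q = \<one>\<^bsub>\<G>\<^esub> [^]\<^bsub>\<G>\<^esub> (0::int)"
      by (simp add: \<alpha> nat_pow_eq one_eq)
    then show ?thesis using q(1) by blast
  qed
  then have "rat_rank \<G> = 0" by (intro rat_rank_eq_0[of "\<one>\<^bsub>\<G>\<^esub>"]) (auto simp: one_eq)
  with assms show False by simp
qed

text \<open>By pigeonhole two multiples of a given element share a coset, so a positive multiple of
  it is a multiple of \<open>circle_of \<kappa>\<close>. Coset representatives together with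
  \<open>circle_of \<kappa>\<close> generate.\<close>

lemma finitely_many_cosets:
  assumes k: "circle_of \<kappa> \<in> \<Lambda>" and "finite T"
    and cover: "\<And>h. h \<in> \<Lambda> \<Longrightarrow> \<exists>t\<in>T. \<exists>i::int. h = t + circle_of (of_int i * \<kappa>)"
  shows "rat_rank \<G> \<le> 1" "finitely_generated_group \<G>"
proof -
  interpret rational_tensor \<G> by (simp add: rational_tensor_def comm_group)
  have "\<exists>n>0. \<exists>i::int. a [^]\<^bsub>\<G>\<^esub> (n::nat) = circle_of \<kappa> [^]\<^bsub>\<G>\<^esub> i" if "a \<in> carrier \<G>" for a
  proof -
    obtain \<alpha> where \<alpha>: "a = circle_of \<alpha>" by (rule circle_of_cases)
    then have "circle_of (of_nat n * \<alpha>) \<in> \<Lambda>" for n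
      using that int_multiple_mem[of \<alpha> "int n"] by simp
    then have "\<exists>t i. t \<in> T \<and> circle_of (of_nat n * \<alpha>) = t + circle_of (of_int i * \<kappa>)" for n
      using cover by metis
    then obtain t i where ti: "t n \<in> T" "circle_of (of_nat n * \<alpha>) = t n + circle_of (of_int (i n) * \<kappa>)" for n
      by metis
    have "\<not> inj t" using finite_subset[of "range t" T] ti(1) assms(2) finite_imageD[of t UNIV] by auto
    then obtain m n where mn: "t m = t n" "m < n" by (metis injI linorder_neqE_nat)
    have "circle_of (of_nat (n - m) * \<alpha>) = circle_of (of_nat n * \<alpha>) - circle_of (of_nat m * \<alpha>)"
      using mn(2) by (simp add: of_nat_diff left_diff_distrib flip: circle_of_diff)
    also have "\<dots> = circle_of (of_int (i n - i m) * \<kappa>)"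
      unfolding ti(2) mn(1) by (simp add: left_diff_distrib circle_of_diff)
    finally have "a [^]\<^bsub>\<G>\<^esub> (n - m) = circle_of \<kappa> [^]\<^bsub>\<G>\<^esub> (i n - i m)"
      by (simp only: \<alpha> nat_pow_eq int_pow_eq[OF k])
    then show ?thesis using mn(2) by (intro exI[of _ "n - m"]) auto
  qed
  then show "rat_rank \<G> \<le> 1" using k by (intro rat_rank_le_1[of "circle_of \<kappa>"]) auto
  show "finitely_generated_group \<G>"
    unfolding finitely_generated_group_def
  proof (intro exI conjI)
    let ?X = "insert (circle_of \<kappa>) (T \<inter> \<Lambda>)"
    show "finite ?X" using assms(2) by simp
    show X: "?X \<subseteq> carrier \<G>" using k by auto
    have sub: "subgroup (generate \<G> ?X) \<G>" by (rule generate_is_subgroup[OF X])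
    have "h \<in> generate \<G> ?X" if h: "h \<in> \<Lambda>" for h
    proof -
      obtain t i where ti: "t \<in> T" "h = t + circle_of (of_int i * \<kappa>)" using cover[OF h] by blast
      \<comment> \<open>\<open>T\<close> need not lie in \<Lambda>, but every representative
        actually used does.\<close>
      have "t = h - circle_of (of_int i * \<kappa>)" using ti(2) by simp
      then have "t \<in> \<Lambda>" using diff_mem[OF h int_multiple_mem[OF k]] by simp
      with ti(1) have "t \<in> generate \<G> ?X" by (intro generate.incl) simp
      moreover have "circle_of \<kappa> [^]\<^bsub>\<G>\<^esub> i \<in> generate \<G> ?X"
        using sub by (rule subgroup_int_pow_closed) (rule generate.incl, simp)
      ultimately have "t \<otimes>\<^bsub>\<G>\<^esub> circle_of \<kappa> [^]\<^bsub>\<G>\<^esub> i \<in> generate \<G> ?X" by (rule generate.eng)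
      then show ?thesis by (simp add: ti(2) int_pow_eq[OF k] mult_eq)
    qed
    then show "generate \<G> ?X = carrier \<G>" using generate_incl[OF X] by auto
  qed
qed

end

section \<open>Rotations of arcs\<close>

text \<open>Representatives in (0, 1] fit arcs that are closed on the right.\<close>

definition upper_rep :: "circle \<Rightarrow> real"
  where "upper_rep s = (THE t. 0 < t \<and> t \<le> 1 \<and> circle_of t = s)"

lemma upper_rep: "0 < upper_rep s" "upper_rep s \<le> 1" "circle_of (upper_rep s) = s"
proof -
  obtain a where a: "s = circle_of a" by (rule circle_of_cases)
  have "\<exists>!t. 0 < t \<and> t \<le> 1 \<and> circle_of t = s"
  proof (rule ex_ex1I)
    show "\<exists>t>0. t \<le> 1 \<and> circle_of t = s"
      by (intro exI[of _ "a - of_int (\<lceil>a\<rceil> - 1)"]) (auto simp: a circle_of_eq_iff, linarith+)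
  qed (auto intro!: circle_of_inj_near)
  from theI'[OF this] show "0 < upper_rep s" "upper_rep s \<le> 1" "circle_of (upper_rep s) = s"
    by (simp_all add: upper_rep_def)
qed

lemma upper_rep_circle_of: "0 < t \<Longrightarrow> t \<le> 1 \<Longrightarrow> upper_rep (circle_of t) = t"
  using upper_rep[of "circle_of t"] by (intro circle_of_inj_near) auto

lemma circle_point: obtains t where "y = a + circle_of t" "0 < t" "t \<le> 1"
  using upper_rep[of "y - a"] that[of "upper_rep (y - a)"] by simp

text \<open>Half-open, so that consecutive arcs partition their union and c = 1 gives the whole
  circle. The choice of the right endpoint does not prejudge the lift, since \<open>\<alpha>\<close>
  will depend on classes only.\<close>

definition half_arc :: "circle \<Rightarrow> real \<Rightarrow> circle set"
  where "half_arc a c = {a + circle_of t |t. 0 < t \<and> t \<le> c}"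

definition arc_map :: "circle \<Rightarrow> real \<Rightarrow> circle \<Rightarrow> circle"
  where "arc_map a c s = a + circle_of (c * upper_rep s)"

text \<open>The angle m is measured in full turns of the arc: rotations are translations of the
  whole circle transported by \<open>arc_map a c\<close>.\<close>

definition arc_rotation :: "circle \<Rightarrow> real \<Rightarrow> circle \<Rightarrow> circle \<Rightarrow> circle"
  where "arc_rotation a c m y =
    (if y \<in> half_arc a c then arc_map a c (perm_inv (arc_map a c) y + m) else y)"

lemma mem_arc_iff:
  assumes "0 < t" "t \<le> 1" "c \<le> 1"
  shows "a + circle_of t \<in> half_arc a c \<longleftrightarrow> t \<le> c"
  using assms circle_of_inj_near[of t] by (force simp: half_arc_def)

lemma arc_1: "half_arc a 1 = UNIV"
proof -
  have "y \<in> half_arc a 1" for y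
    by (rule circle_point[of y a]) (auto simp: mem_arc_iff)
  then show ?thesis by blast
qed

lemma arc_split:
  assumes "0 < c" "0 < d" "c + d \<le> 1"
  shows "half_arc a c \<union> half_arc (a + circle_of c) d = half_arc a (c + d)"
    and "half_arc a c \<inter> half_arc (a + circle_of c) d = {}"
proof -
  have 2: "a + circle_of t \<in> half_arc (a + circle_of c) d \<longleftrightarrow> c < t \<and> t \<le> c + d" if t: "0 < t" "t \<le> 1" for t
  proof (cases "c < t")
    case True
    have eq: "a + circle_of t = a + circle_of c + circle_of (t - c)"
      by (simp add: add.assoc flip: circle_of_add)
    show ?thesis unfolding eq using True t assms mem_arc_iff[of "t - c" d "a + circle_of c"] by auto
  next
    case False
    \<comment> \<open>Starting from \<open>a + circle_of c\<close>, this point is met only after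
      passing \<open>a\<close>; adding 1 brings its parameter into (0, 1].\<close>
    have eq: "a + circle_of t = a + circle_of c + circle_of (t - c + 1)"
      by (simp add: add.assoc circle_of_eq_iff flip: circle_of_add)
    show ?thesis unfolding eq using False t assms mem_arc_iff[of "t - c + 1" d "a + circle_of c"] by auto
  qed
  have 1: "a + circle_of t \<in> half_arc a c \<longleftrightarrow> t \<le> c" "a + circle_of t \<in> half_arc a (c + d) \<longleftrightarrow> t \<le> c + d"
    if t: "0 < t" "t \<le> 1" for t
    using assms t by (simp_all add: mem_arc_iff)
  show "half_arc a c \<union> half_arc (a + circle_of c) d = half_arc a (c + d)"
  proof (rule Set.set_eqI)
    fix y
    obtain t where "y = a + circle_of t" "0 < t" "t \<le> 1" by (rule circle_point)
    then show "y \<in> half_arc a c \<union> half_arc (a + circle_of c) d \<longleftrightarrow> y \<in> half_arc a (c + d)"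
      using 1 2 assms by auto
  qed
  show "half_arc a c \<inter> half_arc (a + circle_of c) d = {}"
  proof (rule equals0I)
    fix y assume y: "y \<in> half_arc a c \<inter> half_arc (a + circle_of c) d"
    obtain t where "y = a + circle_of t" "0 < t" "t \<le> 1" by (rule circle_point)
    with y show False using 1 2 by auto
  qed
qed

lemma arc_add: "y + l \<in> half_arc (a + l) c \<longleftrightarrow> y \<in> half_arc a c"
  by (auto simp: half_arc_def add_ac)

lemma arc_map_add: "arc_map (a + l) c s = arc_map a c s + l"
  by (simp add: arc_map_def add_ac)

lemma arc_rotation_outside: "y \<notin> half_arc a c \<Longrightarrow> arc_rotation a c m y = y"
  by (simp add: arc_rotation_def)

context
  fixes c :: real
  assumes c: "0 < c" "c \<le> 1"
begin

lemma inj_arc_map: "inj (arc_map a c)"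
proof
  fix s t assume "arc_map a c s = arc_map a c t"
  then have "circle_of (c * upper_rep s) = circle_of (c * upper_rep t)" by (simp add: arc_map_def)
  moreover have "0 < c * upper_rep x" "c * upper_rep x \<le> 1" for x
    using c upper_rep[of x] by (auto simp: mult_le_one)
  ultimately have "c * upper_rep s = c * upper_rep t"
    by (metis upper_rep_circle_of)
  then show "s = t" using c upper_rep(3) by (metis less_irrefl mult_left_cancel)
qed

lemma arc_map_mem: "arc_map a c s \<in> half_arc a c"
  using c upper_rep[of s] by (auto simp: half_arc_def arc_map_def)

lemma arc_map_circle_of: "0 < t \<Longrightarrow> t \<le> c \<Longrightarrow> arc_map a c (circle_of (t / c)) = a + circle_of t"
  using c by (simp add: arc_map_def upper_rep_circle_of)

lemma range_arc_map: "range (arc_map a c) = half_arc a c"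
proof
  show "range (arc_map a c) \<subseteq> half_arc a c" using arc_map_mem by auto
  show "half_arc a c \<subseteq> range (arc_map a c)"
    using arc_map_circle_of by (auto simp: half_arc_def image_iff) metis
qed

lemma arc_rotation_map: "arc_rotation a c m (arc_map a c s) = arc_map a c (s + m)"
  using arc_map_mem by (simp add: arc_rotation_def inv_f_f[OF inj_arc_map])

lemma arc_rotation_mem: "arc_rotation a c m y \<in> half_arc a c \<longleftrightarrow> y \<in> half_arc a c"
  by (simp add: arc_rotation_def arc_map_mem)

lemma arc_rotation_comp: "arc_rotation a c m \<circ> arc_rotation a c n = arc_rotation a c (m + n)"
proof
  fix y
  show "(arc_rotation a c m \<circ> arc_rotation a c n) y = arc_rotation a c (m + n) y"
  proof (cases "y \<in> half_arc a c")
    case True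
    then obtain s where "y = arc_map a c s" using range_arc_map by blast
    then show ?thesis by (simp add: arc_rotation_map add_ac)
  qed (simp add: arc_rotation_outside)
qed

lemma arc_rotation_0: "arc_rotation a c 0 = id"
proof
  fix y
  show "arc_rotation a c 0 y = id y"
  proof (cases "y \<in> half_arc a c")
    case True
    then obtain s where s: "y = arc_map a c s" using range_arc_map by blast
    show ?thesis unfolding s arc_rotation_map by simp
  qed (simp add: arc_rotation_outside)
qed

lemma bij_arc_rotation: "bij (arc_rotation a c m)"
  using arc_rotation_comp[of a m "- m"] arc_rotation_comp[of a "- m" m]
  by (intro o_bij[of "arc_rotation a c (- m)"]) (simp_all add: arc_rotation_0)

lemma arc_rotation_add: "arc_rotation (a + l) c m (y + l) = arc_rotation a c m y + l"
proof (cases "y \<in> half_arc a c")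
  case True
  then obtain s where "y = arc_map a c s" using range_arc_map by blast
  then show ?thesis by (simp add: arc_rotation_map flip: arc_map_add)
next
  case False
  then show ?thesis using arc_add by (simp add: arc_rotation_outside)
qed

text \<open>The rotation exchanges the pieces (0, c - d] and (c - d, c]. As \<open>upper_rep\<close>
  is never 0, m = 0 corresponds to d = c: the first piece is empty and the second branch is the
  identity.\<close>

lemma arc_rotation_eval:
  fixes a m :: circle
  assumes "0 < t" "t \<le> 1"
  defines "d \<equiv> c * upper_rep m"
  shows "arc_rotation a c m (a + circle_of t) =
    a + circle_of (if t \<le> c - d then t + d else if t \<le> c then t + d - c else t)"
proof (cases "t \<le> c")
  case True
  let ?u = "t / c + upper_rep m"
  have "0 < t / c" "t / c \<le> 1" using True assms(1) c by simp_all
  with upper_rep(1,2)[of m] have u: "0 < ?u" "?u - 1 \<le> 1" by linarith+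
  have le: "?u \<le> 1 \<longleftrightarrow> t \<le> c - d" using c by (simp add: d_def field_simps)
  have "arc_rotation a c m (a + circle_of t) = arc_map a c (circle_of ?u)"
    using arc_rotation_map[of a m "circle_of (t / c)"] upper_rep(3)[of m]
    by (simp add: arc_map_circle_of assms(1) True circle_of_add)
  moreover have "upper_rep (circle_of ?u) = (if t \<le> c - d then ?u else ?u - 1)"
  proof (cases "t \<le> c - d")
    case True
    then show ?thesis using u le by (simp add: upper_rep_circle_of)
  next
    case False
    have "circle_of ?u = circle_of (?u - 1)" by (simp add: circle_of_eq_iff)
    then show ?thesis using u le False by (simp only: if_False) (simp add: upper_rep_circle_of)
  qed
  moreover have "c * ?u = t + d" "c * (?u - 1) = t + d - c" using c by (simp_all add: d_def field_simps)
  ultimately show ?thesis using True by (simp add: arc_map_def)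
next
  case False
  moreover have "0 < d" using c upper_rep by (simp add: d_def)
  ultimately show ?thesis using assms c by (simp add: arc_rotation_outside mem_arc_iff)
qed

end

lemma arc_map_0_1: "arc_map 0 1 = id"
  by (rule ext) (simp add: arc_map_def upper_rep)

lemma arc_rotation_0_1: "arc_rotation 0 1 l = (\<lambda>y. y + l)"
  using arc_rotation_map[of 1 0 l] by (simp add: arc_map_0_1 fun_eq_iff)

context circle_subgroup
begin

lemma iet_mapsI_locally:
  assumes "bij f" "finite B" "B \<subseteq> \<Lambda>" "\<And>x. x \<notin> B \<Longrightarrow> locally_translation_at \<Lambda> f x"
  shows "f \<in> iet_maps \<Lambda>"
proof (rule iet_mapsI)
  have "{x. \<not> locally_translation_at \<Lambda> f x} \<subseteq> B" using assms(4) by blast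
  then show "f \<in> piecewise_translations \<Lambda>"
    using assms(1,2) finite_subset by (simp add: piecewise_translations_def)
  fix x assume "x \<notin> \<Lambda>"
  then have "\<forall>\<^sub>F y in nhds x. f y = y + (f x - x)"
    using assms(3,4) locally_translation_at_iff by blast
  then show "\<exists>l. germ (at_left 0) f x l \<and> germ (at_right 0) f x l"
    using germ_locally_translation at_left_0_le at_right_0_le by blast
qed

text \<open>The preimage of \<Lambda> in the reals, taken modulo c and rescaled to circumference 1;
  in general it is not contained in \<Lambda>.\<close>

definition rotation_group :: "real \<Rightarrow> circle set"
  where "rotation_group c = {circle_of (r / c) |r. circle_of r \<in> \<Lambda>}"

lemma circle_subgroup_rotation_group: "circle_subgroup (rotation_group c)"
proof
  show "0 \<in> rotation_group c"
    using zero_mem by (auto simp: rotation_group_def circle_of_0 intro!: exI[of _ 0])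
  show "x + y \<in> rotation_group c" if xy: "x \<in> rotation_group c" "y \<in> rotation_group c" for x y
  proof -
    obtain r s where "x = circle_of (r / c)" "circle_of r \<in> \<Lambda>" "y = circle_of (s / c)" "circle_of s \<in> \<Lambda>"
      using xy unfolding rotation_group_def by blast
    then show ?thesis
      unfolding rotation_group_def
      by (auto intro!: exI[of _ "r + s"] simp: circle_of_add add_divide_distrib)
  qed
  show "- x \<in> rotation_group c" if x: "x \<in> rotation_group c" for x
  proof -
    obtain r where "x = circle_of (r / c)" "circle_of r \<in> \<Lambda>"
      using x unfolding rotation_group_def by blast
    then show ?thesis
      unfolding rotation_group_def by (auto intro!: exI[of _ "- r"] simp: circle_of_minus)
  qed
qed

lemma arc_rotation_iet_map:
  assumes c: "0 < c" "c \<le> 1" "circle_of c \<in> \<Lambda>" and a: "a \<in> \<Lambda>" and m: "m \<in> rotation_group c"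
  shows "arc_rotation a c m \<in> iet_maps \<Lambda>"
proof -
  define d where "d = c * upper_rep m"
  have d: "circle_of d \<in> \<Lambda>"
  proof -
    obtain r where r: "m = circle_of (r / c)" "circle_of r \<in> \<Lambda>"
      using m unfolding rotation_group_def by blast
    then have "upper_rep m - r / c \<in> \<int>" using upper_rep(3)[of m] by (simp add: circle_of_eq_iff)
    then obtain n :: int where "upper_rep m - r / c = of_int n" by (auto elim: Ints_cases)
    \<comment> \<open>Passing to the representative in (0, c] changes \<open>r\<close> by a multiple
      of \<open>c\<close>, and \<open>circle_of c\<close> lies in \<Lambda>.\<close>
    then have "d = r + of_int n * c" using c by (simp add: d_def field_simps)
    then show ?thesis using r(2) int_multiple_mem[OF c(3)] by (auto simp: circle_of_add)
  qed
  \<comment> \<open>The breakpoints are the two ends of the arc and the point between the exchanged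
    pieces.\<close>
  let ?B = "{a, a + circle_of (c - d), a + circle_of c}"
  show ?thesis
  proof (rule iet_mapsI_locally[where B = ?B])
    show "bij (arc_rotation a c m)" by (rule bij_arc_rotation[OF c(1,2)])
    show "?B \<subseteq> \<Lambda>" using a c d by (auto simp: circle_of_diff)
    fix x assume x: "x \<notin> ?B"
    obtain t where t: "x = a + circle_of t" "0 < t" "t \<le> 1" by (rule circle_point)
    have t': "t < 1" "t \<noteq> c - d" "t \<noteq> c"
      using x t by (auto simp: order_less_le circle_of_Ints)
    define \<delta> where "\<delta> = (if t \<le> c - d then d else if t \<le> c then d - c else 0)"
    have "\<forall>\<^sub>F s in nhds t. 0 < s \<and> s < 1 \<and> (s \<le> c - d \<longleftrightarrow> t \<le> c - d) \<and> (s \<le> c \<longleftrightarrow> t \<le> c)"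
    proof -
      have "\<forall>\<^sub>F s in nhds t. 0 < s" "\<forall>\<^sub>F s in nhds t. s < 1"
        using order_tendstoD(1)[OF filterlim_ident t(2)] order_tendstoD(2)[OF filterlim_ident t'(1)] .
      moreover have "\<forall>\<^sub>F s in nhds t. (s \<le> u \<longleftrightarrow> t \<le> u)" if "t \<noteq> u" for u
      proof (cases "t < u")
        case True
        then have "\<forall>\<^sub>F s in nhds t. s < u" by (rule order_tendstoD(2)[OF filterlim_ident])
        then show ?thesis by eventually_elim (use True in auto)
      next
        case False
        then have "u < t" using that by simp
        then have "\<forall>\<^sub>F s in nhds t. u < s" by (rule order_tendstoD(1)[OF filterlim_ident])
        then show ?thesis by eventually_elim (use \<open>u < t\<close> in auto)
      qed
      ultimately show ?thesis using t' by (auto intro!: eventually_conj)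
    qed
    then have "\<forall>\<^sub>F s in nhds t. arc_rotation a c m (a + circle_of s) = a + circle_of s + circle_of \<delta>"
    proof eventually_elim
      case (elim s)
      then show ?case
        using arc_rotation_eval[OF c(1,2), of s a m]
        by (auto simp: \<delta>_def add.assoc add_diff_eq simp flip: d_def circle_of_add)
    qed
    then have "\<forall>\<^sub>F y in nhds x. arc_rotation a c m y = y + circle_of \<delta>"
      unfolding t(1) nhds_circle_add eventually_filtermap .
    moreover have "circle_of \<delta> \<in> \<Lambda>" using c d by (auto simp: \<delta>_def circle_of_diff circle_of_0)
    ultimately show "locally_translation_at \<Lambda> (arc_rotation a c m) x"
      unfolding locally_translation_at_def by blast
  qed simp
qed

lemma rotation_group_1: "rotation_group 1 = \<Lambda>"
proof -
  have "x \<in> rotation_group 1 \<longleftrightarrow> x \<in> \<Lambda>" for x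
    by (rule circle_of_cases[of x]) (auto simp: rotation_group_def)
  then show ?thesis by blast
qed

lemma translation_iet: "l \<in> \<Lambda> \<Longrightarrow> (\<lambda>y. y + l) \<in> iet_maps \<Lambda>"
  using arc_rotation_iet_map[of 1 0 l] by (simp add: rotation_group_1 arc_rotation_0_1 circle_of_Ints)

end

text \<open>The form in which the rank hypothesis is used from here on. For \<kappa> = 0 the second
  condition says that \<Lambda> is infinite.\<close>

locale big_circle_subgroup = circle_subgroup +
  assumes irrational: "\<exists>\<kappa>. circle_of \<kappa> \<in> \<Lambda> \<and> \<kappa> \<notin> \<rat>"
    and many_cosets: "circle_of \<kappa> \<in> \<Lambda> \<Longrightarrow> finite T \<Longrightarrow>
      \<exists>h\<in>\<Lambda>. \<forall>t\<in>T. \<forall>i::int. h \<noteq> t + circle_of (of_int i * \<kappa>)"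
begin

text \<open>Dirichlet approximation puts a multiple of \<kappa> within 1/N of an integer,
  irrationality keeps the difference nonzero, and a change of sign makes it positive.\<close>

lemma small_element:
  assumes "e > 0"
  obtains \<delta> where "0 < \<delta>" "\<delta> < e" "circle_of \<delta> \<in> \<Lambda>"
proof -
  obtain \<kappa> where \<kappa>: "circle_of \<kappa> \<in> \<Lambda>" "\<kappa> \<notin> \<rat>" using irrational by blast
  obtain N where N: "N > 0" "1 / real N < e"
    using assms by (metis inverse_eq_divide reals_Archimedean zero_less_Suc of_nat_Suc)
  obtain h k where hk: "0 < k" "\<bar>of_int k * \<kappa> - of_int h\<bar> < 1 / real N"
    using Dirichlet_approx[OF N(1), of \<kappa>] by metis
  define x where "x = of_int k * \<kappa> - of_int h"
  have "x \<noteq> 0"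
  proof
    assume "x = 0"
    then have "\<kappa> = of_int h / of_int k" using hk(1) by (simp add: x_def field_simps)
    then show False using \<kappa>(2) by simp
  qed
  moreover have "circle_of x \<in> \<Lambda>"
    using int_multiple_mem[OF \<kappa>(1), of k] by (simp add: x_def circle_of_diff circle_of_Ints)
  ultimately show ?thesis
    using that[of "\<bar>x\<bar>"] hk(2) N(2) by (cases "x > 0") (auto simp: x_def[symmetric] circle_of_minus)
qed

lemma dense_element:
  assumes "x < y"
  obtains \<delta> where "x < \<delta>" "\<delta> < y" "circle_of \<delta> \<in> \<Lambda>"
proof -
  obtain d where d: "0 < d" "d < y - x" "circle_of d \<in> \<Lambda>"
    using small_element[of "y - x"] assms by auto
  define n where "n = \<lfloor>x / d\<rfloor> + 1"
  have "x / d < of_int n" "of_int n \<le> x / d + 1" unfolding n_def by linarith+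
  then have "x < of_int n * d" "of_int n * d \<le> x + d" using d(1) by (simp_all add: field_simps)
  then show ?thesis using that[of "of_int n * d"] d(2) int_multiple_mem[OF d(3), of n] by linarith
qed

lemma infinite_small_elements:
  assumes "e > 0"
  shows "infinite {\<delta>. 0 < \<delta> \<and> \<delta> < e \<and> circle_of \<delta> \<in> \<Lambda>}" (is "infinite ?S")
proof
  assume fin: "finite ?S"
  have "?S \<noteq> {}" using small_element[OF assms] by blast
  then have min: "Min ?S \<in> ?S" using fin Min_in by blast
  then obtain \<delta> where "0 < \<delta>" "\<delta> < Min ?S" "circle_of \<delta> \<in> \<Lambda>" using small_element[of "Min ?S"] by blast
  with min have "\<delta> \<in> ?S" by auto
  with \<open>\<delta> < Min ?S\<close> show False using fin Min_le leD by blast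
qed

text \<open>Modulo the integers, \<open>p * r\<close> becomes a multiple of \<open>c\<close>. Hence
  \<open>i * r\<close> reduces to the remainder of i modulo p times \<open>r\<close>, and finitely
  many cosets of the multiples of \<open>c\<close> would cover \<Lambda>.\<close>

lemma not_covered_aux:
  assumes c: "circle_of c \<in> \<Lambda>" and "finite T" and N: "(of_int N :: real) = of_int p * r + of_int q * c" "p \<noteq> 0"
    and cover: "\<And>x. circle_of x \<in> \<Lambda> \<Longrightarrow> \<exists>\<tau>\<in>T. \<exists>i j::int. x = \<tau> + of_int i * r + of_int j * c"
  shows False
proof -
  let ?T = "(\<lambda>(\<tau>, b::int). circle_of (\<tau> + of_int b * r)) ` (T \<times> {-\<bar>p\<bar>..\<bar>p\<bar>})"
  obtain h where h: "h \<in> \<Lambda>" "\<And>t i. t \<in> ?T \<Longrightarrow> h \<noteq> t + circle_of (of_int i * c)"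
    using many_cosets[OF c, of ?T] assms(2) by blast
  obtain x where x: "h = circle_of x" by (rule circle_of_cases)
  obtain \<tau> i j where ij: "\<tau> \<in> T" "x = \<tau> + of_int i * r + of_int j * c" using cover[of x] h(1) x by blast
  define a b where "a = i div p" and "b = i mod p"
  have i: "i = p * a + b" by (simp add: a_def b_def)
  have "\<bar>b\<bar> \<le> \<bar>p\<bar>" using N(2) abs_mod_less[of p i] by (simp add: b_def)
  then have "circle_of (\<tau> + of_int b * r) \<in> ?T" using ij(1) by force
  moreover have "x - (\<tau> + of_int b * r + of_int (j - a * q) * c) = of_int (a * N)"
    by (simp add: ij(2) i N(1) algebra_simps)
  then have "h = circle_of (\<tau> + of_int b * r) + circle_of (of_int (j - a * q) * c)"
    unfolding x circle_of_add[symmetric] circle_of_eq_iff by (metis Ints_of_int)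
  ultimately show False using h(2) by blast
qed

text \<open>All integers lie over 0, so a finite covering puts two of them into one coset and yields
  a nontrivial integer relation between 1, \<open>r\<close> and \<open>c\<close>.\<close>

lemma not_covered:
  assumes r: "circle_of r \<in> \<Lambda>" and c: "circle_of c \<in> \<Lambda>" and fin: "finite T"
  shows "\<exists>x. circle_of x \<in> \<Lambda> \<and> (\<forall>\<tau>\<in>T. \<forall>i j::int. x \<noteq> \<tau> + of_int i * r + of_int j * c)"
proof (rule ccontr)
  assume "\<not> ?thesis"
  then have cover: "\<exists>\<tau>\<in>T. \<exists>i j::int. x = \<tau> + of_int i * r + of_int j * c" if "circle_of x \<in> \<Lambda>" for x
    using that by blast
  have "\<exists>\<tau> i j. \<tau> \<in> T \<and> real n = \<tau> + of_int i * r + of_int j * c" for n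
    using cover[of "real n"] by (auto simp: circle_of_Ints)
  then obtain \<tau> i j where *: "\<tau> n \<in> T" "real n = \<tau> n + of_int (i n) * r + of_int (j n) * c" for n
    by metis
  have "\<not> inj \<tau>" using finite_subset[of "range \<tau>" T] *(1) fin finite_imageD[of \<tau> UNIV] by auto
  then obtain m n where mn: "\<tau> m = \<tau> n" "m \<noteq> n" by (auto simp: inj_def)
  define p q where "p = i m - i n" and "q = j m - j n"
  have N: "of_int (int m - int n) = of_int p * r + of_int q * c"
    using *(2)[of m] *(2)[of n] mn(1) by (simp add: p_def q_def algebra_simps)
  show False
  proof (cases "p = 0")
    case False
    then show ?thesis using not_covered_aux[OF c fin N _ cover] by blast
  next
    case True
    \<comment> \<open>With p = 0 the relation involves \<open>c\<close> alone, so the auxiliary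
      lemma is applied with \<open>r\<close> and \<open>c\<close> exchanged.\<close>
    then have q: "q \<noteq> 0" using N mn(2) by auto
    have N': "of_int (int m - int n) = of_int q * c + of_int p * r" using N by simp
    have "\<exists>\<tau>\<in>T. \<exists>i j::int. x = \<tau> + of_int i * c + of_int j * r" if x: "circle_of x \<in> \<Lambda>" for x
    proof -
      obtain \<tau> i j where "\<tau> \<in> T" "x = \<tau> + of_int i * r + of_int j * c" using cover[OF x] by blast
      then show ?thesis by (intro bexI[of _ \<tau>] exI[of _ j] exI[of _ i]) auto
    qed
    then show ?thesis by (rule not_covered_aux[OF r fin N' q])
  qed
qed

lemma broad_rotation_group:
  assumes c: "0 < c" "circle_of c \<in> \<Lambda>"
  shows "\<exists>z. broad_subgroup (rotation_group c) z"
proof -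
  interpret M: circle_subgroup "rotation_group c" by (rule circle_subgroup_rotation_group)
  obtain \<kappa> where \<kappa>: "circle_of \<kappa> \<in> \<Lambda>" "\<kappa> \<notin> \<rat>" using irrational by blast
  \<comment> \<open>Infinite order requires \<open>r / c\<close> to be irrational. If
    \<open>1 / c\<close> is rational, \<kappa> serves; otherwise 1 serves, which lies over
    0.\<close>
  obtain r where r: "circle_of r \<in> \<Lambda>" "r / c \<notin> \<rat>"
  proof (cases "1 / c \<in> \<rat>")
    case True
    have "\<kappa> / c \<notin> \<rat>"
    proof
      assume "\<kappa> / c \<in> \<rat>"
      then have "(\<kappa> / c) / (1 / c) \<in> \<rat>" using True by (rule Rats_divide)
      then show False using \<kappa>(2) c by simp
    qed
    with that \<kappa>(1) show ?thesis by blast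
  next
    case False
    with that[of 1] show ?thesis by (simp add: circle_of_Ints)
  qed
  define z where "z i = circle_of (of_int i * (r / c))" for i :: int
  have "broad_subgroup (rotation_group c) z"
  proof
    show "z (i + j) = z i + z j" for i j by (simp add: z_def distrib_right add_divide_distrib circle_of_add)
    show "inj z"
    proof (rule injI, rule ccontr)
      fix i j assume "z i = z j" and ij: "i \<noteq> j"
      then have "of_int (i - j) * (r / c) \<in> \<int>"
        by (simp add: z_def circle_of_eq_iff left_diff_distrib diff_divide_distrib)
      then obtain n :: int where "of_int (i - j) * (r / c) = of_int n" by (auto elim: Ints_cases)
      then have "r / c = of_int n / of_int (i - j)"
        using ij by (simp add: eq_divide_eq mult.commute del: of_int_diff)
      then show False using r(2) by simp
    qed
    show "z i \<in> rotation_group c" for i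
      using int_multiple_mem[OF r(1), of i] by (auto simp: z_def rotation_group_def)
    show "\<exists>h\<in>rotation_group c. \<forall>t\<in>T. h - t \<notin> range z" if T: "finite T" for T
    proof -
      \<comment> \<open>In unscaled real coordinates the cosets of \<open>range z\<close> become
        cosets of the group generated by \<open>r\<close> and \<open>c\<close>.\<close>
      obtain x where x: "circle_of x \<in> \<Lambda>"
        "\<And>\<tau> i j. \<tau> \<in> (\<lambda>t. c * upper_rep t) ` T \<Longrightarrow> x \<noteq> \<tau> + of_int i * r + of_int j * c"
        using not_covered[OF r(1) c(2), of "(\<lambda>t. c * upper_rep t) ` T"] T by blast
      have "circle_of (x / c) - t \<noteq> z i" if t: "t \<in> T" for t i
      proof
        assume "circle_of (x / c) - t = z i"
        then have "circle_of (x / c) = circle_of (upper_rep t + of_int i * (r / c))"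
          by (simp add: circle_of_add upper_rep(3) z_def algebra_simps)
        then obtain n :: int where "x / c - (upper_rep t + of_int i * (r / c)) = of_int n"
          by (auto simp: circle_of_eq_iff elim: Ints_cases)
        then have "x = c * upper_rep t + of_int i * r + of_int n * c"
          using c(1) by (simp add: field_simps)
        then show False using x(2) t by blast
      qed
      then show ?thesis using x(1) by (intro bexI[of _ "circle_of (x / c)"]) (auto simp: rotation_group_def)
    qed
  qed (simp_all add: M.zero_mem M.add_mem M.uminus_mem)
  then show ?thesis by blast
qed

end

section \<open>Homomorphisms that are almost the identity\<close>

text \<open>The finite set of points that are not fixed is mapped injectively into itself, hence
  onto itself; every other point is its own image.\<close>

lemma inj_near_id_surj:
  assumes "inj f" "near f id"
  shows "surj f"
proof -
  let ?D = "{x. f x \<noteq> id x}"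
  have "f ` ?D \<subseteq> ?D" using assms(1) by (auto simp: inj_eq)
  then have "f ` ?D = ?D"
    using assms by (intro endo_inj_surj) (auto simp: near_def intro: inj_on_subset)
  then have "x \<in> range f" for x
    by (cases "x \<in> ?D") (blast, metis (mono_tags) id_apply mem_Collect_eq rangeI)
  then show ?thesis by blast
qed

text \<open>The section attached to a lift: \<open>\<alpha> f\<close> is the element of the lift
  near \<open>f\<close>. By \<open>\<alpha>_cong\<close> it depends on the class only.\<close>

locale near_representation = big_circle_subgroup +
  fixes \<alpha> :: "(circle \<Rightarrow> circle) \<Rightarrow> circle \<Rightarrow> circle"
  assumes \<alpha>_bij: "f \<in> iet_maps \<Lambda> \<Longrightarrow> bij (\<alpha> f)"
    and \<alpha>_near: "f \<in> iet_maps \<Lambda> \<Longrightarrow> near (\<alpha> f) f"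
    and \<alpha>_comp: "f \<in> iet_maps \<Lambda> \<Longrightarrow> g \<in> iet_maps \<Lambda> \<Longrightarrow> \<alpha> (f \<circ> g) = \<alpha> f \<circ> \<alpha> g"
    and \<alpha>_cong: "f \<in> iet_maps \<Lambda> \<Longrightarrow> g \<in> iet_maps \<Lambda> \<Longrightarrow> near f g \<Longrightarrow> \<alpha> f = \<alpha> g"
begin

lemma iet_maps_inj: "f \<in> iet_maps \<Lambda> \<Longrightarrow> inj f"
  by (intro bij_is_inj piecewise_translations_bij iet_maps_piecewise_translations)

lemma \<alpha>_inj_eq: "f \<in> iet_maps \<Lambda> \<Longrightarrow> \<alpha> f x = \<alpha> f y \<longleftrightarrow> x = y"
  by (simp add: bij_is_inj[OF \<alpha>_bij] inj_eq)

lemma \<alpha>_id: "\<alpha> id = id"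
proof
  fix x
  have "\<alpha> id (\<alpha> id x) = \<alpha> id x" using \<alpha>_comp[OF id_iet_maps id_iet_maps] by (simp add: fun_eq_iff)
  then show "\<alpha> id x = id x" by (simp add: \<alpha>_inj_eq id_iet_maps)
qed

text \<open>The source of exact information: a commutation rule may fail at finitely many points and
  still hold everywhere after applying \<open>\<alpha>\<close>.\<close>

lemma \<alpha>_near_commute:
  assumes "f \<in> iet_maps \<Lambda>" "g \<in> iet_maps \<Lambda>" "f' \<in> iet_maps \<Lambda>" "g' \<in> iet_maps \<Lambda>" "near (f \<circ> g) (g' \<circ> f')"
  shows "\<alpha> f (\<alpha> g x) = \<alpha> g' (\<alpha> f' x)"
  using \<alpha>_cong[OF iet_maps_comp iet_maps_comp assms(5)] assms \<alpha>_comp by (metis comp_apply)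

definition lambda_arc :: "circle \<Rightarrow> real \<Rightarrow> bool"
  where "lambda_arc a c \<longleftrightarrow> a \<in> \<Lambda> \<and> 0 < c \<and> c \<le> 1 \<and> circle_of c \<in> \<Lambda>"

lemma lambda_arcD:
  assumes "lambda_arc a c"
  shows "a \<in> \<Lambda>" "0 < c" "c \<le> 1" "circle_of c \<in> \<Lambda>"
  using assms by (simp_all add: lambda_arc_def)

lemma lambda_arc_shift: "lambda_arc a c \<Longrightarrow> l \<in> \<Lambda> \<Longrightarrow> lambda_arc (a + l) c"
  by (auto simp: lambda_arc_def)

lemma lambda_arc_complement: "lambda_arc a c \<Longrightarrow> c < 1 \<Longrightarrow> lambda_arc (a + circle_of c) (1 - c)"
  by (auto simp: lambda_arc_def circle_of_diff circle_of_Ints)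

lemma rotation_iet: "lambda_arc a c \<Longrightarrow> m \<in> rotation_group c \<Longrightarrow> arc_rotation a c m \<in> iet_maps \<Lambda>"
  by (intro arc_rotation_iet_map) (auto simp: lambda_arc_def)

definition act :: "circle \<Rightarrow> real \<Rightarrow> circle \<Rightarrow> circle \<Rightarrow> circle"
  where "act a c m = \<alpha> (arc_rotation a c m)"

lemma rotation_group_nonzero:
  assumes "lambda_arc a c"
  obtains m where "m \<in> rotation_group c" "m \<noteq> 0"
proof -
  obtain z where "broad_subgroup (rotation_group c) z"
    using broad_rotation_group[of c] lambda_arcD[OF assms] by blast
  then interpret broad_subgroup "rotation_group c" z .
  have "z 1 \<noteq> 0" using inj_z z_0 by (metis injD zero_neq_one)
  then show ?thesis using that z_in by blast
qed

lemma infinite_rotation_group: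
  assumes "lambda_arc a c"
  shows "infinite (rotation_group c)"
proof -
  obtain z where "broad_subgroup (rotation_group c) z"
    using broad_rotation_group[of c] lambda_arcD[OF assms] by blast
  then interpret broad_subgroup "rotation_group c" z .
  show ?thesis by (rule infinite_M)
qed

definition conjugator :: "circle \<Rightarrow> real \<Rightarrow> (circle \<Rightarrow> circle) \<Rightarrow> bool"
  where "conjugator a c \<phi> \<longleftrightarrow> inj \<phi> \<and> near \<phi> (arc_map a c) \<and>
    (\<forall>m\<in>rotation_group c. \<forall>x. \<phi> (x + m) = act a c m (\<phi> x))"

lemma conjugator_exists:
  assumes "lambda_arc a c"
  shows "\<exists>\<phi>. conjugator a c \<phi>"
proof -
  note c = lambda_arcD[OF assms]
  obtain z where "broad_subgroup (rotation_group c) z"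
    using broad_rotation_group[of c] c by blast
  then interpret broad_subgroup "rotation_group c" z .
  have "act a c (m + n) y = act a c m (act a c n y)" if "m \<in> rotation_group c" "n \<in> rotation_group c" for m n y
    using \<alpha>_comp[OF rotation_iet[OF assms that(1)] rotation_iet[OF assms that(2)]]
    by (simp add: act_def arc_rotation_comp[OF c(2,3)])
  moreover have "act a c 0 y = y" for y by (simp add: act_def arc_rotation_0[OF c(2,3)] \<alpha>_id)
  moreover have "finite {x. act a c m (arc_map a c x) \<noteq> arc_map a c (x + m)}" if m: "m \<in> rotation_group c" for m
  proof -
    have "finite (arc_map a c -` {y. act a c m y \<noteq> arc_rotation a c m y})"
      using \<alpha>_near[OF rotation_iet[OF assms m]]
      by (intro finite_vimageI inj_arc_map c) (simp add: near_def act_def)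
    then show ?thesis by (simp add: arc_rotation_map[OF c(2,3)] vimage_def)
  qed
  ultimately show ?thesis
  proof (rule near_free_action_rigid[OF inj_arc_map[OF c(2,3)]])
    fix \<phi> assume "inj \<phi>" "near \<phi> (arc_map a c)"
      and "\<And>m x. m \<in> rotation_group c \<Longrightarrow> \<phi> (x + m) = act a c m (\<phi> x)"
    then have "conjugator a c \<phi>" by (simp add: conjugator_def)
    then show ?thesis by (rule exI[of _ \<phi>])
  qed
qed

text \<open>An arbitrary choice; \<open>arc_support_moved\<close> shows that its range does not
  depend on it.\<close>

definition conj_map :: "circle \<Rightarrow> real \<Rightarrow> circle \<Rightarrow> circle"
  where "conj_map a c = (SOME \<phi>. conjugator a c \<phi>)"

text \<open>
  \<open>arc_support a c\<close> is a finite modification of the arc; it turns out to be the set of points moved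
  through \<open>\<alpha>\<close> by the rotations of the arc, and the arc with exactly one of its endpoints.
\<close>

definition arc_support :: "circle \<Rightarrow> real \<Rightarrow> circle set"
  where "arc_support a c = range (conj_map a c)"

lemma conj_map:
  assumes "lambda_arc a c"
  shows "inj (conj_map a c)" "near (conj_map a c) (arc_map a c)"
    "m \<in> rotation_group c \<Longrightarrow> conj_map a c (x + m) = act a c m (conj_map a c x)"
  using someI_ex[OF conjugator_exists[OF assms]] unfolding conj_map_def conjugator_def by blast+

lemma act_free:
  assumes "lambda_arc a c" "z \<in> arc_support a c" "m \<in> rotation_group c" "m \<noteq> 0"
  shows "act a c m z \<noteq> z"
proof -
  obtain x where x: "z = conj_map a c x" using assms(2) unfolding arc_support_def by blast
  have "conj_map a c (x + m) \<noteq> conj_map a c x" using assms(4) by (simp add: inj_eq[OF conj_map(1)[OF assms(1)]])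
  then show ?thesis by (simp add: x conj_map(3)[OF assms(1,3)])
qed

lemma finite_arc_support_diff:
  assumes "lambda_arc a c"
  shows "finite (arc_support a c - half_arc a c)"
proof (rule finite_subset)
  show "arc_support a c - half_arc a c \<subseteq> conj_map a c ` {x. conj_map a c x \<noteq> arc_map a c x}"
    using arc_map_mem[OF lambda_arcD(2,3)[OF assms]] by (fastforce simp: arc_support_def)
  show "finite (conj_map a c ` {x. conj_map a c x \<noteq> arc_map a c x})"
    using conj_map(2)[OF assms] by (simp add: near_def)
qed

text \<open>
  An interval exchange that is trivial on the arc commutes with its rotations, and a rotation
  moves a given point of the support to a point where \<open>\<alpha> f\<close> is known to be the identity.
\<close>

lemma trivial_on_arc_support:
  assumes I: "lambda_arc a c" and f: "f \<in> iet_maps \<Lambda>"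
    and fin: "finite {y \<in> half_arc a c. f y \<noteq> y}" and z: "z \<in> arc_support a c"
  shows "\<alpha> f z = z"
proof -
  note c = lambda_arcD[OF I]
  let ?B = "{y \<in> half_arc a c. f y \<noteq> y}"
  have commute: "\<alpha> f (act a c m x) = act a c m (\<alpha> f x)" if m: "m \<in> rotation_group c" for m x
  proof -
    let ?r = "arc_rotation a c m"
    note r = rotation_iet[OF I m]
    have "(f \<circ> ?r) y = (?r \<circ> f) y" if y: "y \<notin> ?r -` ?B \<union> ?B \<union> f -` ?B" for y
    proof (cases "y \<in> half_arc a c")
      case True
      then have "?r y \<in> half_arc a c" by (simp add: arc_rotation_mem[OF c(2,3)])
      with True y show ?thesis by auto
    next
      case False
      \<comment> \<open>If \<open>f y\<close> lay in the arc, it would be fixed by \<open>f\<close>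
        as y avoids the exceptional set, and injectivity would give \<open>f y = y\<close>.\<close>
      have "f y \<notin> half_arc a c"
      proof
        assume "f y \<in> half_arc a c"
        with y have "f (f y) = f y" by auto
        then have "f y = y" using iet_maps_inj[OF f] by (simp add: inj_eq)
        with False \<open>f y \<in> half_arc a c\<close> show False by simp
      qed
      with False show ?thesis by (simp add: arc_rotation_outside)
    qed
    then have "{y. (f \<circ> ?r) y \<noteq> (?r \<circ> f) y} \<subseteq> ?r -` ?B \<union> ?B \<union> f -` ?B" by blast
    moreover have "finite (?r -` ?B \<union> ?B \<union> f -` ?B)"
      using fin iet_maps_inj[OF f] iet_maps_inj[OF r] by (simp only: finite_UnI finite_vimageI)
    ultimately have "near (f \<circ> ?r) (?r \<circ> f)" unfolding near_def by (rule finite_subset)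
    then show ?thesis unfolding act_def by (rule \<alpha>_near_commute[OF f r f r])
  qed
  obtain x where x: "z = conj_map a c x" using z unfolding arc_support_def by blast
  \<comment> \<open>The parameters to be avoided: \<open>conj_map\<close> differs from
    \<open>arc_map\<close>, or \<open>f\<close> moves the point of the arc, or
    \<open>\<alpha> f\<close> differs from \<open>f\<close> there.\<close>
  let ?E = "{w. conj_map a c w \<noteq> arc_map a c w} \<union> arc_map a c -` (?B \<union> {y. \<alpha> f y \<noteq> f y})"
  have "finite ?E"
    using conj_map(2)[OF I] \<alpha>_near[OF f] fin
    by (intro finite_UnI finite_vimageI inj_arc_map c) (simp_all add: near_def)
  then have "finite ((\<lambda>m. x + m) -` ?E)" by (rule finite_vimageI) (simp add: inj_def)
  then have "infinite (rotation_group c - (\<lambda>m. x + m) -` ?E)"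
    by (rule Diff_infinite_finite[OF _ infinite_rotation_group[OF I]])
  then obtain m where m: "m \<in> rotation_group c" "x + m \<notin> ?E"
    by (metis (no_types, lifting) DiffE finite.emptyI equals0I vimageI)
  have "conj_map a c (x + m) = arc_map a c (x + m)" "f (arc_map a c (x + m)) = arc_map a c (x + m)"
    "\<alpha> f (arc_map a c (x + m)) = f (arc_map a c (x + m))"
    using m(2) arc_map_mem[OF c(2,3)] by auto
  then have "\<alpha> f (conj_map a c (x + m)) = conj_map a c (x + m)" by simp
  then have "act a c m (\<alpha> f z) = act a c m z"
    by (simp add: x conj_map(3)[OF I m(1)] commute[OF m(1)])
  then show ?thesis by (simp add: act_def \<alpha>_inj_eq rotation_iet[OF I m(1)])
qed

lemma act_trivial_on_disjoint:
  assumes "lambda_arc a c" "lambda_arc b d" "half_arc a c \<inter> half_arc b d = {}"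
    "m \<in> rotation_group c" "z \<in> arc_support b d"
  shows "act a c m z = z"
proof -
  have "{y \<in> half_arc b d. arc_rotation a c m y \<noteq> y} = {}"
    using assms(3) arc_rotation_outside by blast
  then have "finite {y \<in> half_arc b d. arc_rotation a c m y \<noteq> y}" by (simp only: finite.emptyI)
  then show ?thesis
    unfolding act_def by (rule trivial_on_arc_support[OF assms(2) rotation_iet[OF assms(1,4)] _ assms(5)])
qed

text \<open>A nonzero rotation of the first arc moves every point of its own support and fixes every
  point of the other.\<close>

lemma arc_support_disjoint:
  assumes "lambda_arc a c" "lambda_arc b d" "half_arc a c \<inter> half_arc b d = {}"
  shows "arc_support a c \<inter> arc_support b d = {}"
proof -
  obtain m where "m \<in> rotation_group c" "m \<noteq> 0" by (rule rotation_group_nonzero[OF assms(1)])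
  then show ?thesis using act_free[OF assms(1)] act_trivial_on_disjoint[OF assms] by blast
qed

text \<open>Composing the inverse arc maps with the conjugators glues to one injection near the
  identity, which is surjective by \<open>inj_near_id_surj\<close>; its values lie in the
  supports.\<close>

lemma arc_support_cover:
  assumes fin: "finite P" and arcs: "\<And>a c. (a, c) \<in> P \<Longrightarrow> lambda_arc a c"
    and disj: "\<And>a c b d. (a, c) \<in> P \<Longrightarrow> (b, d) \<in> P \<Longrightarrow> (a, c) \<noteq> (b, d) \<Longrightarrow> half_arc a c \<inter> half_arc b d = {}"
    and cover: "\<And>y. \<exists>(a, c)\<in>P. y \<in> half_arc a c"
  shows "\<exists>(a, c)\<in>P. z \<in> arc_support a c"
proof -
  have "\<exists>a c x. (a, c) \<in> P \<and> y = arc_map a c x" for y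
  proof -
    obtain a c where ac: "(a, c) \<in> P" "y \<in> half_arc a c" using cover by blast
    then show ?thesis using range_arc_map[OF lambda_arcD(2,3)[OF arcs[OF ac(1)]]] by blast
  qed
  then obtain a c x where acx: "(a y, c y) \<in> P" "y = arc_map (a y) (c y) (x y)" for y by metis
  define f where "f y = conj_map (a y) (c y) (x y)" for y
  have f_mem: "f y \<in> arc_support (a y) (c y)" for y by (simp add: f_def arc_support_def)
  have "inj f"
  proof
    fix y y' assume eq: "f y = f y'"
    then have "arc_support (a y) (c y) \<inter> arc_support (a y') (c y') \<noteq> {}" using f_mem[of y] f_mem[of y'] by auto
    then have ac: "a y = a y'" "c y = c y'"
      using arc_support_disjoint[OF arcs[OF acx(1)] arcs[OF acx(1)] disj[OF acx(1) acx(1)], of y y'] by auto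
    then have "x y = x y'"
      using eq conj_map(1)[OF arcs[OF acx(1)], of y'] by (simp add: f_def inj_eq)
    then show "y = y'" using acx(2)[of y] acx(2)[of y'] ac by simp
  qed
  moreover have "near f id"
  proof -
    have "{y. f y \<noteq> id y} \<subseteq> (\<Union>(a, c)\<in>P. arc_map a c ` {x. conj_map a c x \<noteq> arc_map a c x})"
    proof
      fix y assume "y \<in> {y. f y \<noteq> id y}"
      then have "x y \<in> {x. conj_map (a y) (c y) x \<noteq> arc_map (a y) (c y) x}"
        using acx(2)[of y] by (simp add: f_def)
      then show "y \<in> (\<Union>(a, c)\<in>P. arc_map a c ` {x. conj_map a c x \<noteq> arc_map a c x})"
        using acx(1)[of y] acx(2)[of y] by blast
    qed
    moreover have "finite (\<Union>(a, c)\<in>P. arc_map a c ` {x. conj_map a c x \<noteq> arc_map a c x})"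
      using fin conj_map(2)[OF arcs] by (auto simp: near_def)
    ultimately show ?thesis unfolding near_def by (rule finite_subset)
  qed
  ultimately have "surj f" by (rule inj_near_id_surj)
  then obtain y where "z = f y" by blast
  then show ?thesis using f_mem acx(1) by blast
qed

lemma arc_support_1:
  assumes "a \<in> \<Lambda>"
  shows "arc_support a 1 = UNIV"
proof -
  have "lambda_arc a 1" using assms by (auto simp: lambda_arc_def circle_of_Ints)
  then have "z \<in> arc_support a 1" for z
    using arc_support_cover[of "{(a, 1)}" z] by (auto simp: arc_1)
  then show ?thesis by blast
qed

lemma arc_support_complement:
  assumes I: "lambda_arc a c" "c < 1"
  shows "arc_support (a + circle_of c) (1 - c) = - arc_support a c"
proof -
  note J = lambda_arc_complement[OF I]
  have split: "half_arc a c \<union> half_arc (a + circle_of c) (1 - c) = UNIV"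
    "half_arc a c \<inter> half_arc (a + circle_of c) (1 - c) = {}"
    using arc_split[of c "1 - c" a] lambda_arcD[OF I(1)] I(2) by (simp_all add: arc_1)
  have "z \<in> arc_support a c \<or> z \<in> arc_support (a + circle_of c) (1 - c)" for z
    using arc_support_cover[of "{(a, c), (a + circle_of c, 1 - c)}" z] I J split by blast
  then show ?thesis using arc_support_disjoint[OF I(1) J split(2)] by blast
qed

text \<open>The smaller arc is disjoint from the complement of the larger one, and so are the
  supports.\<close>

lemma arc_support_mono:
  assumes "lambda_arc a c" "lambda_arc b d" "d < 1" "half_arc a c \<subseteq> half_arc b d"
  shows "arc_support a c \<subseteq> arc_support b d"
proof -
  have "half_arc b d \<inter> half_arc (b + circle_of d) (1 - d) = {}"
    using arc_split(2)[of d "1 - d" b] lambda_arcD[OF assms(2)] assms(3) by simp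
  then have "arc_support a c \<inter> arc_support (b + circle_of d) (1 - d) = {}"
    using assms by (intro arc_support_disjoint lambda_arc_complement) auto
  then show ?thesis using arc_support_complement[OF assms(2,3)] by blast
qed

text \<open>A third arc completes the two pieces to a partition of the circle; its support is the
  complement of that of the arc being split.\<close>

lemma arc_support_split:
  assumes I: "lambda_arc a c" "lambda_arc a d" and cd: "c < d" "d < 1" and z: "z \<in> arc_support a d"
  shows "z \<in> arc_support a c \<or> z \<in> arc_support (a + circle_of c) (d - c)"
proof -
  have I2: "lambda_arc (a + circle_of c) (d - c)"
    using I cd by (auto simp: lambda_arc_def circle_of_diff)
  note I3 = lambda_arc_complement[OF I(2) cd(2)]
  have s12: "half_arc a c \<union> half_arc (a + circle_of c) (d - c) = half_arc a d"
    "half_arc a c \<inter> half_arc (a + circle_of c) (d - c) = {}"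
    using arc_split[of c "d - c" a] lambda_arcD[OF I(1)] cd by simp_all
  have s3: "half_arc a d \<union> half_arc (a + circle_of d) (1 - d) = UNIV"
    "half_arc a d \<inter> half_arc (a + circle_of d) (1 - d) = {}"
    using arc_split[of d "1 - d" a] lambda_arcD[OF I(2)] cd by (simp_all add: arc_1)
  have "z \<notin> arc_support (a + circle_of d) (1 - d)" using arc_support_complement[OF I(2) cd(2)] z by blast
  moreover have "\<exists>(b, e)\<in>{(a, c), (a + circle_of c, d - c), (a + circle_of d, 1 - d)}. z \<in> arc_support b e"
  proof (rule arc_support_cover)
    show "\<exists>(b, e)\<in>{(a, c), (a + circle_of c, d - c), (a + circle_of d, 1 - d)}. y \<in> half_arc b e" for y
      using s12(1) s3(1) by blast
    have "half_arc a c \<inter> half_arc (a + circle_of d) (1 - d) = {}"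
      "half_arc (a + circle_of c) (d - c) \<inter> half_arc (a + circle_of d) (1 - d) = {}"
      using s12(1) s3(2) by blast+
    then show "half_arc b e \<inter> half_arc b' e' = {}"
      if "(b, e) \<in> {(a, c), (a + circle_of c, d - c), (a + circle_of d, 1 - d)}"
        "(b', e') \<in> {(a, c), (a + circle_of c, d - c), (a + circle_of d, 1 - d)}" "(b, e) \<noteq> (b', e')"
      for b e b' e'
      using that s12(2) by (simp add: Int_commute) (elim disjE; force simp: Int_commute)
  qed (use I I2 I3 in auto)
  ultimately show ?thesis by blast
qed

text \<open>A description free of the chosen conjugator, and therefore one that can be transported
  along \<open>\<alpha> g\<close>.\<close>

lemma arc_support_moved:
  assumes I: "lambda_arc a c"
  shows "z \<in> arc_support a c \<longleftrightarrow> (\<exists>m\<in>rotation_group c. act a c m z \<noteq> z)"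
proof
  assume "z \<in> arc_support a c"
  then show "\<exists>m\<in>rotation_group c. act a c m z \<noteq> z"
    using rotation_group_nonzero[OF I] act_free[OF I] by metis
next
  assume moved: "\<exists>m\<in>rotation_group c. act a c m z \<noteq> z"
  show "z \<in> arc_support a c"
  proof (cases "c < 1")
    case True
    have "half_arc a c \<inter> half_arc (a + circle_of c) (1 - c) = {}"
      using arc_split(2)[of c "1 - c" a] lambda_arcD[OF I] True by simp
    then have "z \<notin> arc_support (a + circle_of c) (1 - c)"
      using moved act_trivial_on_disjoint[OF I lambda_arc_complement[OF I True]] by blast
    then show ?thesis using arc_support_complement[OF I True] by blast
  next
    case False
    then have "c = 1" using lambda_arcD(3)[OF I] by simp
    then show ?thesis using arc_support_1[OF lambda_arcD(1)[OF I]] by simp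
  qed
qed

text \<open>Off a finite set \<open>g\<close> intertwines the rotations of the arc with those of the
  shifted arc by the same angle, so \<open>\<alpha> g\<close> carries moved points to moved
  points.\<close>

lemma arc_support_equivariant:
  assumes I: "lambda_arc a c" and l: "l \<in> \<Lambda>" and g: "g \<in> iet_maps \<Lambda>"
    and fin: "finite {y \<in> half_arc a c. g y \<noteq> y + l}" and z: "z \<in> arc_support a c"
  shows "\<alpha> g z \<in> arc_support (a + l) c"
proof -
  note c = lambda_arcD[OF I]
  note I' = lambda_arc_shift[OF I l]
  let ?B = "{y \<in> half_arc a c. g y \<noteq> y + l}"
  obtain m where m: "m \<in> rotation_group c" "act a c m z \<noteq> z" using arc_support_moved[OF I] z by blast
  let ?r = "arc_rotation a c m" and ?r' = "arc_rotation (a + l) c m"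
  note r = rotation_iet[OF I m(1)] and r' = rotation_iet[OF I' m(1)]
  have "(g \<circ> ?r) y = (?r' \<circ> g) y" if y: "y \<notin> ?r -` ?B \<union> ?B \<union> g -` (\<lambda>w. w + l) ` ?B" for y
  proof (cases "y \<in> half_arc a c")
    case True
    then have "?r y \<in> half_arc a c" by (simp add: arc_rotation_mem[OF c(2,3)])
    with True y have "g y = y + l" "g (?r y) = ?r y + l" by auto
    then show ?thesis by (simp add: arc_rotation_add[OF c(2,3)])
  next
    case False
    have "g y \<notin> half_arc (a + l) c"
    proof
      assume "g y \<in> half_arc (a + l) c"
      then have w: "g y - l \<in> half_arc a c" using arc_add[of "g y - l" l a c] by simp
      then have "g (g y - l) = g y" using y by (force simp: image_iff)
      then have "g y - l = y" using iet_maps_inj[OF g] by (simp add: inj_eq)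
      with False w show False by simp
    qed
    with False show ?thesis by (simp add: arc_rotation_outside)
  qed
  then have "{y. (g \<circ> ?r) y \<noteq> (?r' \<circ> g) y} \<subseteq> ?r -` ?B \<union> ?B \<union> g -` (\<lambda>w. w + l) ` ?B" by blast
  moreover have "finite (?r -` ?B \<union> ?B \<union> g -` (\<lambda>w. w + l) ` ?B)"
    using fin iet_maps_inj[OF g] iet_maps_inj[OF r] by (simp only: finite_UnI finite_vimageI finite_imageI)
  ultimately have "near (g \<circ> ?r) (?r' \<circ> g)" unfolding near_def by (rule finite_subset)
  then have "\<alpha> g (act a c m z) = act (a + l) c m (\<alpha> g z)"
    unfolding act_def by (rule \<alpha>_near_commute[OF g r g r'])
  moreover have "\<alpha> g (act a c m z) \<noteq> \<alpha> g z" using m(2) by (simp add: \<alpha>_inj_eq g)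
  ultimately show ?thesis using arc_support_moved[OF I'] m(1) by metis
qed

lemma lambda_arc_0_1: "lambda_arc 0 1"
  by (simp add: lambda_arc_def circle_of_Ints)

end

section \<open>Representations that fix all translations by \<Lambda>\<close>

locale normalized_near_representation = near_representation +
  assumes \<alpha>_translation: "l \<in> \<Lambda> \<Longrightarrow> \<alpha> (\<lambda>y. y + l) = (\<lambda>y. y + l)"
begin

text \<open>This is what the normalization buys: actual translations move supports to
  supports.\<close>

lemma arc_support_shift: "lambda_arc a c \<Longrightarrow> l \<in> \<Lambda> \<Longrightarrow> z \<in> arc_support a c \<Longrightarrow> z + l \<in> arc_support (a + l) c"
  using arc_support_equivariant[of a c l "\<lambda>y. y + l" z] by (simp add: translation_iet \<alpha>_translation)

text \<open>
  If a point of the support lay outside the closed arc, then so would infinitely many of its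
  translates with respect to a slightly larger arc containing all corresponding translates of
  the arc, although the support of that arc differs from it by a finite set.
\<close>

lemma arc_support_subset_closed_arc:
  assumes I: "lambda_arc a c" and z: "z \<in> arc_support a c"
  shows "\<exists>t. 0 \<le> t \<and> t \<le> c \<and> z = a + circle_of t"
proof (rule ccontr)
  note c = lambda_arcD[OF I]
  assume neg: "\<not> ?thesis"
  obtain t where t: "z = a + circle_of t" "0 < t" "t \<le> 1" by (rule circle_point)
  have away: "z \<noteq> a + circle_of s" if "0 \<le> s" "s \<le> c" for s using neg that by blast
  have "t \<noteq> 1" using away[of 0] t(1) c(2) by (auto simp: circle_of_Ints)
  moreover have "\<not> t \<le> c" using away[of t] t by auto
  ultimately have ct: "c < t" "t < 1" using t(3) by auto
  \<comment> \<open>The enlarged arc gains \<open>e\<close> at both ends. The bounds keep the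
    translates of \<open>z\<close> by less than \<open>e\<close> beyond its right end and short of a
    full turn.\<close>
  obtain e where e: "0 < e" "e < min (t - c) ((1 - t) / 2)" "circle_of e \<in> \<Lambda>"
    by (rule small_element[of "min (t - c) ((1 - t) / 2)"]) (use ct in auto)
  define b where "b = a - circle_of e"
  define d where "d = c + 2 * e"
  have d: "d < 1" "e + c < t" "t + 2 * e < 1" using e(1,2) by (auto simp: d_def)
  have "circle_of d \<in> \<Lambda>" unfolding d_def
    using c(4) e(3) int_multiple_mem[OF e(3), of 2] by (auto simp: circle_of_add)
  then have J: "lambda_arc b d"
    using c e d by (auto simp: lambda_arc_def b_def) (simp add: d_def)
  let ?S = "{\<delta>. 0 < \<delta> \<and> \<delta> < e \<and> circle_of \<delta> \<in> \<Lambda>}"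
  have "z + circle_of \<delta> \<in> arc_support b d - half_arc b d" if \<delta>: "\<delta> \<in> ?S" for \<delta>
  proof
    have I': "lambda_arc (a + circle_of \<delta>) c" using lambda_arc_shift[OF I] \<delta> by simp
    have "half_arc (a + circle_of \<delta>) c \<subseteq> half_arc b d"
    proof
      fix y assume "y \<in> half_arc (a + circle_of \<delta>) c"
      then obtain s where s: "y = a + circle_of \<delta> + circle_of s" "0 < s" "s \<le> c" by (auto simp: half_arc_def)
      then have "y = b + circle_of (e + \<delta> + s)" by (simp add: b_def circle_of_add add_ac)
      moreover have "0 < e + \<delta> + s" "e + \<delta> + s \<le> d" using s \<delta> e by (auto simp: d_def)
      ultimately show "y \<in> half_arc b d" unfolding half_arc_def by blast
    qed
    then have "arc_support (a + circle_of \<delta>) c \<subseteq> arc_support b d" by (rule arc_support_mono[OF I' J d(1)])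
    then show "z + circle_of \<delta> \<in> arc_support b d" using arc_support_shift[OF I _ z] \<delta> by blast
    have "z + circle_of \<delta> = b + circle_of (t + \<delta> + e)" by (simp add: t(1) b_def circle_of_add add_ac)
    moreover have "0 < t + \<delta> + e" "t + \<delta> + e \<le> 1" "\<not> t + \<delta> + e \<le> d"
      using t \<delta> e d by (auto simp: d_def)
    ultimately show "z + circle_of \<delta> \<notin> half_arc b d" using d(1) by (simp add: mem_arc_iff)
  qed
  then have "(\<lambda>\<delta>. z + circle_of \<delta>) ` ?S \<subseteq> arc_support b d - half_arc b d" by blast
  then have "finite ((\<lambda>\<delta>. z + circle_of \<delta>) ` ?S)"
    using finite_arc_support_diff[OF J] finite_subset by blast
  moreover have "inj_on (\<lambda>\<delta>. z + circle_of \<delta>) ?S"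
    using e c t by (intro inj_onI circle_of_inj_near) auto
  ultimately show False using infinite_small_elements[OF e(1)] finite_imageD by blast
qed

text \<open>Otherwise the point would lie in the support of the complementary arc, hence in the
  closed complementary arc.\<close>

lemma arc_support_interior:
  assumes I: "lambda_arc a c" "c < 1" and t: "0 < t" "t < c"
  shows "a + circle_of t \<in> arc_support a c"
proof (rule ccontr)
  assume "a + circle_of t \<notin> arc_support a c"
  then have "a + circle_of t \<in> arc_support (a + circle_of c) (1 - c)" using arc_support_complement[OF I] by blast
  then obtain s where s: "0 \<le> s" "s \<le> 1 - c" "a + circle_of t = a + circle_of c + circle_of s"
    using arc_support_subset_closed_arc[OF lambda_arc_complement[OF I]] by blast
  then have "circle_of t = circle_of (c + s)" by (simp add: circle_of_add add.assoc)
  then have "t = c + s" using s t by (intro circle_of_inj_near) auto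
  then show False using s t by simp
qed

text \<open>Cutting the longer arc at c leaves a remainder whose closure misses \<open>a\<close>; d
  < 1 excludes wrapping round.\<close>

lemma left_endpoint_independent:
  assumes I: "lambda_arc a c" "lambda_arc a d" and cd: "c < d" "d < 1"
  shows "a \<in> arc_support a c \<longleftrightarrow> a \<in> arc_support a d"
proof
  assume "a \<in> arc_support a c"
  moreover have "half_arc a c \<subseteq> half_arc a d" using cd by (auto simp: half_arc_def)
  ultimately show "a \<in> arc_support a d" using arc_support_mono[OF I cd(2)] by blast
next
  assume a: "a \<in> arc_support a d"
  have "a \<notin> arc_support (a + circle_of c) (d - c)"
  proof
    assume *: "a \<in> arc_support (a + circle_of c) (d - c)"
    have "lambda_arc (a + circle_of c) (d - c)"
      using I cd by (auto simp: lambda_arc_def circle_of_diff)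
    from arc_support_subset_closed_arc[OF this *]
    obtain s where s: "0 \<le> s" "s \<le> d - c" "a = a + circle_of c + circle_of s" by blast
    then have "circle_of (c + s) = circle_of 0" by (simp add: circle_of_add circle_of_0 add.assoc)
    then have "c + s = 0" using s cd lambda_arcD[OF I(1)] by (intro circle_of_inj_near) auto
    then show False using s lambda_arcD[OF I(1)] by simp
  qed
  then show "a \<in> arc_support a c" using arc_support_split[OF I cd a] by blast
qed

text \<open>\<open>Q\<close> is the bit that separates the two lifts. Position is removed by
  translating to 0, length by comparison with \<open>c0\<close>.\<close>

lemma left_endpoint_uniform:
  "\<exists>Q. \<forall>a c. lambda_arc a c \<longrightarrow> c < 1 \<longrightarrow> (a \<in> arc_support a c \<longleftrightarrow> Q)"
proof -
  obtain c0 where c0: "0 < c0" "c0 < 1" "circle_of c0 \<in> \<Lambda>" using small_element[of 1] by auto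
  then have I0: "lambda_arc 0 c0" by (simp add: lambda_arc_def)
  have "a \<in> arc_support a c \<longleftrightarrow> 0 \<in> arc_support 0 c0" if I: "lambda_arc a c" "c < 1" for a c
  proof -
    have I': "lambda_arc 0 c" using I by (simp add: lambda_arc_def)
    have "a \<in> arc_support a c \<longleftrightarrow> 0 \<in> arc_support 0 c"
    proof
      show "0 \<in> arc_support 0 c" if "a \<in> arc_support a c"
        using arc_support_shift[OF I(1) uminus_mem[OF lambda_arcD(1)[OF I(1)]] that] by simp
      show "a \<in> arc_support a c" if "0 \<in> arc_support 0 c"
        using arc_support_shift[OF I' lambda_arcD(1)[OF I(1)] that] by simp
    qed
    also have "\<dots> \<longleftrightarrow> 0 \<in> arc_support 0 c0"
    proof (cases c c0 rule: linorder_cases)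
      case less
      then show ?thesis by (rule left_endpoint_independent[OF I' I0 _ c0(2)])
    next
      case greater
      then show ?thesis by (rule left_endpoint_independent[OF I0 I' _ I(2), symmetric])
    qed simp
    finally show ?thesis .
  qed
  then show ?thesis by blast
qed

text \<open>The right endpoint is the left endpoint of the complementary arc, so the same bit
  decides it.\<close>

lemma right_endpoint:
  assumes I: "lambda_arc a c" "c < 1"
  shows "a + circle_of c \<in> arc_support a c \<longleftrightarrow> a + circle_of c \<notin> arc_support (a + circle_of c) (1 - c)"
  using arc_support_complement[OF I] by blast

lemma near_0_imp_0:
  assumes "\<And>e. 0 < e \<Longrightarrow> \<exists>t. \<bar>t\<bar> \<le> e \<and> w = circle_of t"
  shows "w = 0"
proof (rule ccontr)
  assume "w \<noteq> 0"
  obtain u where u: "w = circle_of u" "0 < u" "u \<le> 1" using upper_rep[of w] by metis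
  with \<open>w \<noteq> 0\<close> have "u < 1" by (cases "u = 1") (auto simp: circle_of_Ints)
  define e where "e = min u (1 - u) / 2"
  have "0 < e" using u \<open>u < 1\<close> by (simp add: e_def)
  then obtain t where t: "\<bar>t\<bar> \<le> e" "circle_of u = circle_of t" using assms u(1) by blast
  then have "u = t" using u \<open>u < 1\<close> by (intro circle_of_inj_near) (auto simp: e_def)
  then show False using t u by (auto simp: e_def)
qed

text \<open>Supports lie in closed arcs, so a short arc whose support contains \<open>z\<close>
  confines \<open>\<alpha> g z\<close> near \<open>z + l\<close>. The parameter s = u is exempt
  because \<open>g\<close> may take any value at \<open>z\<close> itself.\<close>

lemma \<alpha>_within_arc:
  assumes I: "lambda_arc a c" and g: "g \<in> iet_maps \<Lambda>" and l: "l \<in> \<Lambda>"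
    and a: "z = a + circle_of u" and ucd: "0 \<le> u" "u \<le> c" "c \<le> e"
    and g_eq: "\<And>s. 0 < s \<Longrightarrow> s \<le> c \<Longrightarrow> s \<noteq> u \<Longrightarrow> g (z + circle_of (s - u)) = z + circle_of (s - u) + l"
    and z: "z \<in> arc_support a c"
  shows "\<exists>t. \<bar>t\<bar> \<le> e \<and> \<alpha> g z - (z + l) = circle_of t"
proof -
  have "{y \<in> half_arc a c. g y \<noteq> y + l} \<subseteq> {z}"
  proof
    fix y assume y: "y \<in> {y \<in> half_arc a c. g y \<noteq> y + l}"
    then obtain s where s: "y = a + circle_of s" "0 < s" "s \<le> c" by (auto simp: half_arc_def)
    have "y = z + circle_of (s - u)" by (simp add: s a circle_of_diff)
    then have "s = u" using g_eq[OF s(2,3)] y by auto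
    then show "y \<in> {z}" by (simp add: s(1) a)
  qed
  then have "finite {y \<in> half_arc a c. g y \<noteq> y + l}" by (rule finite_subset) simp
  then have "\<alpha> g z \<in> arc_support (a + l) c" by (rule arc_support_equivariant[OF I l g _ z])
  then obtain t where t: "0 \<le> t" "t \<le> c" "\<alpha> g z = a + l + circle_of t"
    using arc_support_subset_closed_arc[OF lambda_arc_shift[OF I l]] by blast
  then have "\<alpha> g z - (z + l) = circle_of (t - u)" by (simp add: a circle_of_diff algebra_simps)
  moreover have "\<bar>t - u\<bar> \<le> e" using t ucd by auto
  ultimately show ?thesis by blast
qed

theorem \<alpha>_eq_side: "\<exists>F. one_sided F \<and> (\<forall>g\<in>iet_maps \<Lambda>. \<alpha> g = side F g)"
proof -
  obtain Q where Q: "\<And>a c. lambda_arc a c \<Longrightarrow> c < 1 \<Longrightarrow> (a \<in> arc_support a c \<longleftrightarrow> Q)"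
    using left_endpoint_uniform by blast
  \<comment> \<open>If supports keep left endpoints, \<open>z\<close> belongs to short arcs starting
    at \<open>z\<close>, and the behaviour of \<open>g\<close> just after \<open>z\<close>
    decides.\<close>
  define F where "F = (if Q then at_right (0::real) else at_left 0)"
  have F: "one_sided F" by (simp add: F_def)
  have "\<alpha> g z = side F g z" if g: "g \<in> iet_maps \<Lambda>" for g z
  proof -
    note pt = iet_maps_piecewise_translations[OF g]
    define l where "l = side F g z - z"
    have l: "germ F g z l" "l \<in> \<Lambda>" using germ_side[OF pt F] by (simp_all add: l_def)
    have "\<exists>t. \<bar>t\<bar> \<le> e \<and> \<alpha> g z - (z + l) = circle_of t" if e: "0 < e" for e
    proof (cases "z \<in> \<Lambda>")
      case z: True
      show ?thesis
      proof (cases Q)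
        case True
        then have "\<forall>\<^sub>F t in at_right 0. g (z + circle_of t) = z + circle_of t + l"
          using l(1) by (simp add: F_def germ_def)
        then obtain d where d: "0 < d" "\<And>t. 0 < t \<Longrightarrow> t < d \<Longrightarrow> g (z + circle_of t) = z + circle_of t + l"
          by (auto simp: eventually_at_right_field)
        obtain c where c: "0 < c" "c < min (min d e) 1" "circle_of c \<in> \<Lambda>"
          by (rule small_element[of "min (min d e) 1"]) (use d e in auto)
        have I: "lambda_arc z c" using z c by (simp add: lambda_arc_def)
        show ?thesis
          by (rule \<alpha>_within_arc[OF I g l(2), of z 0])
             (use c d(2) Q[OF I] True in \<open>auto simp: circle_of_0\<close>)
      next
        case False
        then have "\<forall>\<^sub>F t in at_left 0. g (z + circle_of t) = z + circle_of t + l"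
          using l(1) by (simp add: F_def germ_def)
        then obtain d where d: "d < 0" "\<And>t. d < t \<Longrightarrow> t < 0 \<Longrightarrow> g (z + circle_of t) = z + circle_of t + l"
          by (auto simp: eventually_at_left_field)
        obtain c where c: "0 < c" "c < min (min (- d) e) 1" "circle_of c \<in> \<Lambda>"
          by (rule small_element[of "min (min (- d) e) 1"]) (use d e in auto)
        have I: "lambda_arc (z - circle_of c) c" using z c by (auto simp: lambda_arc_def)
        \<comment> \<open>Since \<open>Q\<close> fails, \<open>z\<close> is not in the support of
          the complementary arc starting there, hence it is in that of the arc ending there.\<close>
        have "lambda_arc z (1 - c)" using lambda_arc_complement[OF I] c by simp
        then have "z \<notin> arc_support z (1 - c)" using Q[of z "1 - c"] False c by simp
        then have "z \<in> arc_support (z - circle_of c) c" using right_endpoint[OF I] c by simp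
        then show ?thesis
          by (intro \<alpha>_within_arc[OF I g l(2), of z c]) (use c d(2) in auto)
      qed
    next
      case z: False
      \<comment> \<open>No admissible arc ends at \<open>z\<close>, but both germs agree here, so a
        short arc with \<open>z\<close> in its interior serves.\<close>
      obtain m where m: "germ (at_left 0) g z m" "germ (at_right 0) g z m"
        by (rule iet_maps_two_sided[OF g z])
      then have "m = l" using l(1) F germ_unique one_sided_neq_bot
        by (metis F_def one_sided_left one_sided_right)
      with m have "\<forall>\<^sub>F t in at_left 0. g (z + circle_of t) = z + circle_of t + l"
        "\<forall>\<^sub>F t in at_right 0. g (z + circle_of t) = z + circle_of t + l"
        by (simp_all add: germ_def)
      then have "\<forall>\<^sub>F t in at 0. g (z + circle_of t) = z + circle_of t + l"
        by (simp add: eventually_at_split)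
      then obtain d where d: "0 < d" "\<And>t. t \<noteq> 0 \<Longrightarrow> \<bar>t\<bar> < d \<Longrightarrow> g (z + circle_of t) = z + circle_of t + l"
        by (auto simp: eventually_at dist_real_def)
      \<comment> \<open>An arc starting less than \<open>k\<close> before \<open>z\<close>, of
        length between \<open>k\<close> and \<open>2 * k\<close>, has \<open>z\<close> in its
        interior and respects the bounds d, e and 1.\<close>
      define k where "k = min (min d e) 1 / 2"
      have k: "0 < k" "2 * k \<le> d" "2 * k \<le> e" "2 * k \<le> 1" using d(1) e by (auto simp: k_def)
      obtain \<zeta> where \<zeta>: "z = circle_of \<zeta>" by (rule circle_of_cases)
      obtain x where x: "\<zeta> - k < x" "x < \<zeta>" "circle_of x \<in> \<Lambda>" using dense_element[of "\<zeta> - k" \<zeta>] k(1) by auto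
      obtain c where c: "k < c" "c < 2 * k" "circle_of c \<in> \<Lambda>" using dense_element[of k "2 * k"] k(1) by auto
      have I: "lambda_arc (circle_of x) c" using x c k by (simp add: lambda_arc_def)
      have z_eq: "z = circle_of x + circle_of (\<zeta> - x)" by (simp add: \<zeta> circle_of_diff)
      have "z \<in> arc_support (circle_of x) c"
        unfolding z_eq by (rule arc_support_interior[OF I]) (use x c k in auto)
      then show ?thesis
        by (intro \<alpha>_within_arc[OF I g l(2) z_eq]) (use x c k d(2) in auto)
    qed
    then have "\<alpha> g z - (z + l) = 0" by (rule near_0_imp_0)
    then show ?thesis by (simp add: l_def)
  qed
  then show ?thesis using F by blast
qed

end

context near_representation
begin

theorem conjugate_to_side:
  obtains s F where "bij s" "near s id" "one_sided F"
    "\<And>f. f \<in> iet_maps \<Lambda> \<Longrightarrow> perm_inv s \<circ> \<alpha> f \<circ> s = side F f"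
proof -
  \<comment> \<open>The arc of length 1 at 0 is the whole circle and its rotations are the
    translations, so conjugation by \<open>s\<close> normalizes \<open>\<alpha>\<close>.\<close>
  define s where "s = conj_map 0 1"
  have near: "near s id" using conj_map(2)[OF lambda_arc_0_1] by (simp add: s_def arc_map_0_1)
  have "inj s" using conj_map(1)[OF lambda_arc_0_1] by (simp add: s_def)
  with near have bij: "bij s" by (simp add: bij_def inj_near_id_surj)
  have inv_s: "perm_inv s (s x) = x" "s (perm_inv s x) = x" for x
    using bij by (simp_all add: bij_is_inj bij_is_surj surj_f_inv_f)
  define \<beta> where "\<beta> f = perm_inv s \<circ> \<alpha> f \<circ> s" for f
  have near_inv_s: "near (perm_inv s) id"
    using near_inv[OF near bij bij_id] by simp
  have "near (\<beta> f) f" if f: "f \<in> iet_maps \<Lambda>" for f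
  proof -
    have "near (perm_inv s \<circ> (\<alpha> f \<circ> s)) (id \<circ> (f \<circ> id))"
      using bij_is_inj[OF \<alpha>_bij[OF f]] bij_is_inj[OF bij]
      by (intro near_comp near_inv_s \<alpha>_near f near inj_compose)
    then show ?thesis by (simp add: \<beta>_def comp_assoc)
  qed
  moreover have "bij (\<beta> f)" if f: "f \<in> iet_maps \<Lambda>" for f
    unfolding \<beta>_def by (intro bij_comp bij \<alpha>_bij f bij_imp_bij_inv)
  moreover have "\<beta> (f \<circ> g) = \<beta> f \<circ> \<beta> g" if "f \<in> iet_maps \<Lambda>" "g \<in> iet_maps \<Lambda>" for f g
    using \<alpha>_comp[OF that] by (simp add: \<beta>_def fun_eq_iff inv_s)
  moreover have "\<beta> f = \<beta> g" if "f \<in> iet_maps \<Lambda>" "g \<in> iet_maps \<Lambda>" "near f g" for f g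
    using \<alpha>_cong[OF that] by (simp add: \<beta>_def)
  moreover have "\<beta> (\<lambda>y. y + l) = (\<lambda>y. y + l)" if l: "l \<in> \<Lambda>" for l
    using conj_map(3)[OF lambda_arc_0_1, of l] l
    by (simp add: \<beta>_def fun_eq_iff rotation_group_1 act_def arc_rotation_0_1 inv_s flip: s_def)
      (metis inv_s(1))
  ultimately interpret N: normalized_near_representation \<Lambda> \<beta> by unfold_locales
  obtain F where "one_sided F" "\<And>f. f \<in> iet_maps \<Lambda> \<Longrightarrow> \<beta> f = side F f" using N.\<alpha>_eq_side by blast
  then show ?thesis using that bij near by (simp add: \<beta>_def)
qed

end

section \<open>Lifts\<close>

lemma Bij_UNIV: "f \<in> Bij UNIV \<longleftrightarrow> bij f"
  by (simp add: Bij_def)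

lemma PC_hat_carrier: "f \<in> carrier PC_hat \<longleftrightarrow> bij f \<and> finite {x. \<not> isCont f x}"
  by (simp add: PC_hat_def Bij_UNIV)

lemma PC_hat_mult: "bij f \<Longrightarrow> bij g \<Longrightarrow> f \<otimes>\<^bsub>PC_hat\<^esub> g = f \<circ> g"
  by (simp add: PC_hat_def BijGroup_def Bij_UNIV compose_def fun_eq_iff)

lemma PC_hat_one: "\<one>\<^bsub>PC_hat\<^esub> = id"
  by (simp add: PC_hat_def BijGroup_def fun_eq_iff)

lemma fin_perms_iff: "f \<in> fin_perms \<longleftrightarrow> bij f \<and> near f id"
  by (simp add: fin_perms_def Bij_UNIV near_def)

text \<open>Stated for a variable carrier because inverses are taken both in \<open>PC_hat\<close>
  and in its restriction to \<open>IET_hat\<close>.\<close>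

lemma PC_hat_inv:
  assumes "bij f" "perm_inv f \<in> H" "H \<subseteq> carrier PC_hat"
  shows "inv\<^bsub>PC_hat\<lparr>carrier := H\<rparr>\<^esub> f = perm_inv f"
  unfolding m_inv_def
proof (rule the_equality)
  have "bij (perm_inv f)" using assms(1) by (rule bij_imp_bij_inv)
  then show "perm_inv f \<in> carrier (PC_hat\<lparr>carrier := H\<rparr>) \<and>
      f \<otimes>\<^bsub>PC_hat\<lparr>carrier := H\<rparr>\<^esub> perm_inv f = \<one>\<^bsub>PC_hat\<lparr>carrier := H\<rparr>\<^esub> \<and>
      perm_inv f \<otimes>\<^bsub>PC_hat\<lparr>carrier := H\<rparr>\<^esub> f = \<one>\<^bsub>PC_hat\<lparr>carrier := H\<rparr>\<^esub>"
    using assms by (simp add: PC_hat_mult PC_hat_one bij_is_inj bij_is_surj fun_eq_iff surj_f_inv_f)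
next
  fix g
  assume g: "g \<in> carrier (PC_hat\<lparr>carrier := H\<rparr>) \<and>
      f \<otimes>\<^bsub>PC_hat\<lparr>carrier := H\<rparr>\<^esub> g = \<one>\<^bsub>PC_hat\<lparr>carrier := H\<rparr>\<^esub> \<and>
      g \<otimes>\<^bsub>PC_hat\<lparr>carrier := H\<rparr>\<^esub> f = \<one>\<^bsub>PC_hat\<lparr>carrier := H\<rparr>\<^esub>"
  then have "bij g" using assms(3) PC_hat_carrier by auto
  with g have "f \<circ> g = id" using assms(1) by (simp add: PC_hat_mult PC_hat_one)
  then show "g = perm_inv f" using assms(1) by (metis bij_is_inj comp_assoc comp_id id_comp inv_o_cancel)
qed

lemma mem_PC_proj:
  assumes f: "bij f"
  shows "g \<in> PC_proj f \<longleftrightarrow> bij g \<and> near g f"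
proof
  assume "g \<in> PC_proj f"
  then obtain h where h: "h \<in> fin_perms" "g = h \<otimes>\<^bsub>PC_hat\<^esub> f" unfolding PC_proj_def r_coset_def by blast
  then have "bij h" "near h id" "g = h \<circ> f" using f by (simp_all add: fin_perms_iff PC_hat_mult)
  then show "bij g \<and> near g f"
    using near_comp[of h id f f] f by (simp add: bij_comp bij_is_inj)
next
  assume g: "bij g \<and> near g f"
  have inv: "bij (perm_inv f)" "f \<circ> perm_inv f = id" "perm_inv f \<circ> f = id"
    using f by (auto simp: bij_imp_bij_inv bij_is_surj bij_is_inj surj_f_inv_f fun_eq_iff)
  have "near (g \<circ> perm_inv f) (f \<circ> perm_inv f)"
    using g inv(1) by (intro near_comp) (auto simp: bij_is_inj)
  then have "g \<circ> perm_inv f \<in> fin_perms"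
    using g inv by (simp add: fin_perms_iff bij_comp)
  moreover have "g = (g \<circ> perm_inv f) \<otimes>\<^bsub>PC_hat\<^esub> f"
    using g inv f by (simp add: PC_hat_mult bij_comp comp_assoc)
  ultimately show "g \<in> PC_proj f" unfolding PC_proj_def r_coset_def by blast
qed

lemma PC_proj_eq_iff:
  assumes "bij f" "bij g"
  shows "PC_proj f = PC_proj g \<longleftrightarrow> near f g"
proof
  assume "PC_proj f = PC_proj g"
  then show "near f g" using mem_PC_proj[OF assms(1), of f] mem_PC_proj[OF assms(2), of f] assms(1) by simp
next
  assume fg: "near f g"
  have "near h f \<longleftrightarrow> near h g" for h
    by (rule iffI) (erule near_trans[OF _ fg], erule near_trans[OF _ near_sym[OF fg]])
  then show "PC_proj f = PC_proj g"
    by (intro Set.set_eqI) (simp add: mem_PC_proj assms)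
qed

lemma PC_carrier: "carrier PC = PC_proj ` carrier PC_hat"
  by (auto simp: PC_def FactGroup_def RCOSETS_def PC_proj_def)

lemma piecewise_translations_PC_hat:
  assumes "f \<in> piecewise_translations \<Lambda>"
  shows "f \<in> carrier PC_hat"
proof -
  have "{x. \<not> isCont f x} \<subseteq> {x. \<not> locally_translation_at \<Lambda> f x}"
    using isCont_locally_translation by blast
  then have "finite {x. \<not> isCont f x}"
    by (rule finite_subset) (use assms in \<open>simp add: piecewise_translations_def\<close>)
  then show ?thesis using assms by (simp add: PC_hat_carrier piecewise_translations_def)
qed

lemma piecewise_translations_mono:
  assumes "f \<in> piecewise_translations \<Lambda>" "\<Lambda> \<subseteq> \<Lambda>'"
  shows "f \<in> piecewise_translations \<Lambda>'"
proof -
  have "{x. \<not> locally_translation_at \<Lambda>' f x} \<subseteq> {x. \<not> locally_translation_at \<Lambda> f x}"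
    using locally_translation_at_mono[OF _ assms(2)] by blast
  then have "finite {x. \<not> locally_translation_at \<Lambda>' f x}"
    by (rule finite_subset) (use assms(1) in \<open>simp add: piecewise_translations_def\<close>)
  then show ?thesis using assms(1) by (simp add: piecewise_translations_def)
qed

lemma locally_translation_class:
  assumes "bij f" "g \<in> PC_proj f" "finite {x. \<not> locally_translation_at \<Lambda> g x}"
  shows "f \<in> piecewise_translations \<Lambda>"
proof -
  have g: "bij g" "near g f" using assms(2) by (simp_all add: mem_PC_proj[OF assms(1)])
  then have "g \<in> piecewise_translations \<Lambda>" using assms(3) by (simp add: piecewise_translations_def)
  then show ?thesis by (rule piecewise_translations_near[OF _ g(2) assms(1)])
qed

lemma mem_IET_iff:
  assumes "bij f"
  shows "PC_proj f \<in> IET \<and> f \<in> carrier PC_hat \<longleftrightarrow> f \<in> piecewise_translations UNIV"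
proof
  assume "PC_proj f \<in> IET \<and> f \<in> carrier PC_hat"
  then show "f \<in> piecewise_translations UNIV"
    using locally_translation_class[OF assms] unfolding IET_def by blast
next
  assume f: "f \<in> piecewise_translations UNIV"
  then have "f \<in> carrier PC_hat" by (rule piecewise_translations_PC_hat)
  moreover have "f \<in> PC_proj f" using assms by (simp add: mem_PC_proj)
  ultimately show "PC_proj f \<in> IET \<and> f \<in> carrier PC_hat"
    using f unfolding IET_def PC_carrier piecewise_translations_def by blast
qed

lemma IET_hat_eq: "IET_hat = piecewise_translations UNIV"
  using mem_IET_iff piecewise_translations_bij PC_hat_carrier unfolding IET_hat_def by blast

lemma germ_eq_if_isCont:
  assumes "isCont f x" "germ F f x l" "one_sided F"
  shows "f x = x + l"
proof -
  note F = one_sided_le[OF assms(3)] one_sided_neq_bot[OF assms(3)]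
  have "((\<lambda>t. f (x + circle_of t)) \<longlongrightarrow> f x) F"
    by (rule isCont_tendsto_compose[OF assms(1) tendsto_circle_of_0[OF F(1)]])
  then show ?thesis by (rule tendsto_unique[OF F(2) _ germ_tendsto[OF assms(2) F(1)]])
qed

lemma two_sided_germ_locally_translation:
  assumes "germ (at_left 0) f x l" "germ (at_right 0) f x l" "f x = x + l"
  shows "locally_translation_at UNIV f x"
proof -
  have "\<forall>\<^sub>F t in at 0. f (x + circle_of t) = x + circle_of t + l"
    using assms(1,2) by (simp add: germ_def eventually_at_split)
  then have "\<forall>\<^sub>F t in nhds 0. t \<noteq> 0 \<longrightarrow> f (x + circle_of t) = x + circle_of t + l"
    by (simp add: eventually_at_filter)
  then have "\<forall>\<^sub>F t in nhds 0. f (x + circle_of t) = x + circle_of t + l"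
    by eventually_elim (use assms(3) in \<open>auto simp: circle_of_0\<close>)
  then have "\<forall>\<^sub>F y in nhds x. f y = y + l"
    using nhds_circle_add[of x 0] by (simp add: circle_of_0 eventually_filtermap)
  then show ?thesis unfolding locally_translation_at_def by blast
qed

lemma at_left_to_0: "at_left a = filtermap (\<lambda>x. x + a) (at_left 0)" for a :: real
proof (rule filter_eqI)
  fix P
  have "(\<exists>b<a. \<forall>y>b. y < a \<longrightarrow> P y) \<longleftrightarrow> (\<exists>b<0. \<forall>y>b. y < 0 \<longrightarrow> P (y + a))"
  proof
    assume "\<exists>b<a. \<forall>y>b. y < a \<longrightarrow> P y"
    then obtain b where "b < a" "\<forall>y>b. y < a \<longrightarrow> P y" by blast
    then show "\<exists>b<0. \<forall>y>b. y < 0 \<longrightarrow> P (y + a)" by (intro exI[of _ "b - a"]) auto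
  next
    assume "\<exists>b<0. \<forall>y>b. y < 0 \<longrightarrow> P (y + a)"
    then obtain b where b: "b < 0" "\<forall>y>b. y < 0 \<longrightarrow> P (y + a)" by blast
    have "P y" if "y > b + a" "y < a" for y
      using b(2)[rule_format, of "y - a"] that by simp
    with b(1) show "\<exists>b<a. \<forall>y>b. y < a \<longrightarrow> P y" by (intro exI[of _ "b + a"]) auto
  qed
  then show "eventually P (at_left a) \<longleftrightarrow> eventually P (filtermap (\<lambda>x. x + a) (at_left 0))"
    by (simp add: eventually_at_left_field eventually_filtermap)
qed

text \<open>The germ computes the one-sided limit of \<open>f\<close>, and limits are unique;
  one-sided continuity thus means agreement with the one-sided representative.\<close>

lemma side_fixed_iff_tendsto:
  assumes "f \<in> piecewise_translations \<Lambda>" "one_sided F"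
  shows "side F f (circle_of t) = f (circle_of t) \<longleftrightarrow>
    ((f \<circ> circle_of) \<longlongrightarrow> (f \<circ> circle_of) t) (filtermap (\<lambda>s. s + t) F)"
proof -
  have "((\<lambda>s. f (circle_of t + circle_of s)) \<longlongrightarrow> side F f (circle_of t)) F"
    using germ_tendsto[OF germ_side(1)[OF assms] one_sided_le[OF assms(2)]] by simp
  then have *: "((f \<circ> circle_of) \<longlongrightarrow> side F f (circle_of t)) (filtermap (\<lambda>s. s + t) F)"
    by (simp add: filterlim_filtermap circle_of_add add.commute)
  have "filtermap (\<lambda>s. s + t) F \<noteq> bot"
    using one_sided_neq_bot[OF assms(2)] by (simp add: filtermap_bot_iff)
  then show ?thesis using * tendsto_unique by (metis comp_apply)
qed

context circle_subgroup
begin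

lemma mem_IET_over_iff: "f \<in> carrier PC_hat \<and> PC_proj f \<in> IET_over \<Lambda> \<longleftrightarrow> f \<in> iet_maps \<Lambda>"
proof
  assume asm: "f \<in> carrier PC_hat \<and> PC_proj f \<in> IET_over \<Lambda>"
  then have bij: "bij f" by (simp add: PC_hat_carrier)
  show "f \<in> iet_maps \<Lambda>"
  proof (rule iet_mapsI)
    show pt: "f \<in> piecewise_translations \<Lambda>"
      using asm locally_translation_class[OF bij] unfolding IET_over_def by blast
    fix x assume "x \<notin> \<Lambda>"
    \<comment> \<open>Some representative is continuous at x; its value there dictates both
      one-sided germs, which it shares with \<open>f\<close>.\<close>
    then obtain g where g: "g \<in> PC_proj f" "isCont g x"
      using asm unfolding IET_over_def discontinuities_def by blast
    then have near: "near f g" using mem_PC_proj[OF bij] near_sym by blast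
    have "germ F f x (g x - x)" if F: "one_sided F" for F
    proof -
      note f = germ_side(1)[OF pt F, of x]
      have "g x = x + (side F f x - x)"
        by (rule germ_eq_if_isCont[OF g(2) germ_near[OF f near one_sided_le[OF F]] F])
      then show ?thesis using f by simp
    qed
    then show "\<exists>l. germ (at_left 0) f x l \<and> germ (at_right 0) f x l"
      by (intro exI[of _ "g x - x"]) simp
  qed
next
  assume f: "f \<in> iet_maps \<Lambda>"
  note pt = iet_maps_piecewise_translations[OF f]
  note bij = piecewise_translations_bij[OF pt]
  have f_mem: "f \<in> PC_proj f" using bij by (simp add: mem_PC_proj)
  have IET: "PC_proj f \<in> IET" "f \<in> carrier PC_hat"
    using mem_IET_iff[OF bij] piecewise_translations_mono[OF pt] by auto
  have "x \<in> \<Lambda>" if x: "x \<in> discontinuities (PC_proj f)" for x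
  proof (rule ccontr)
    assume "x \<notin> \<Lambda>"
    then obtain l where l: "germ (at_left 0) f x l" "germ (at_right 0) f x l"
      by (rule iet_maps_two_sided[OF f])
    \<comment> \<open>As both germs agree at x, the left-continuous representative removes the
      discontinuity.\<close>
    let ?g = "side (at_left 0) f"
    have near: "near ?g f" by (rule near_side[OF pt one_sided_left])
    have "locally_translation_at UNIV ?g x"
      by (rule two_sided_germ_locally_translation[of _ _ l])
         (use germ_near[OF l(1) near_sym[OF near] at_left_0_le] germ_near[OF l(2) near_sym[OF near] at_right_0_le]
            side_eqI[OF l(1)] in simp_all)
    then have "isCont ?g x" by (rule isCont_locally_translation)
    moreover have "bij ?g"
      by (rule piecewise_translations_bij[OF side_piecewise_translation[OF pt one_sided_left]])
    then have "?g \<in> PC_proj f" using near bij by (simp add: mem_PC_proj)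
    ultimately show False using x unfolding discontinuities_def by blast
  qed
  then show "f \<in> carrier PC_hat \<and> PC_proj f \<in> IET_over \<Lambda>"
    using IET f_mem pt unfolding IET_over_def piecewise_translations_def by blast
qed

definition side_lift :: "real filter \<Rightarrow> (circle \<Rightarrow> circle) set"
  where "side_lift F = side F ` iet_maps \<Lambda>"

lemma mem_side_lift_iff:
  assumes F: "one_sided F"
  shows "f \<in> side_lift F \<longleftrightarrow> f \<in> iet_maps \<Lambda> \<and> (\<forall>t. side F f (circle_of t) = f (circle_of t))"
proof
  assume "f \<in> side_lift F"
  then obtain g where g: "g \<in> iet_maps \<Lambda>" "f = side F g" by (auto simp: side_lift_def)
  have "side F f = f"
    unfolding g(2) by (rule side_cong_near[OF near_side[OF iet_maps_piecewise_translations[OF g(1)] F] F])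
  then show "f \<in> iet_maps \<Lambda> \<and> (\<forall>t. side F f (circle_of t) = f (circle_of t))"
    using iet_maps_side[OF g(1) F] g(2) by simp
next
  assume f: "f \<in> iet_maps \<Lambda> \<and> (\<forall>t. side F f (circle_of t) = f (circle_of t))"
  have "side F f x = f x" for x using f by (cases x rule: circle_of_cases) simp
  then have "f = side F f" by (simp add: fun_eq_iff)
  then show "f \<in> side_lift F" using f unfolding side_lift_def by blast
qed

lemma left_lift_eq: "left_lift (IET_over \<Lambda>) = side_lift (at_left 0)"
proof -
  have "f \<in> left_lift (IET_over \<Lambda>) \<longleftrightarrow> f \<in> iet_maps \<Lambda> \<and> (\<forall>t. continuous (at_left t) (f \<circ> circle_of))" for f
    using mem_IET_over_iff[of f] by (auto simp: left_lift_def)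
  moreover have "continuous (at_left t) (f \<circ> circle_of) \<longleftrightarrow>
      side (at_left 0) f (circle_of t) = f (circle_of t)" if "f \<in> iet_maps \<Lambda>" for f t
    unfolding side_fixed_iff_tendsto[OF iet_maps_piecewise_translations[OF that] one_sided_left]
      at_left_to_0[symmetric] by (rule continuous_within)
  ultimately show ?thesis using mem_side_lift_iff[OF one_sided_left] by blast
qed

lemma right_lift_eq: "right_lift (IET_over \<Lambda>) = side_lift (at_right 0)"
proof -
  have "f \<in> right_lift (IET_over \<Lambda>) \<longleftrightarrow> f \<in> iet_maps \<Lambda> \<and> (\<forall>t. continuous (at_right t) (f \<circ> circle_of))" for f
    using mem_IET_over_iff[of f] by (auto simp: right_lift_def)
  moreover have "continuous (at_right t) (f \<circ> circle_of) \<longleftrightarrow>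
      side (at_right 0) f (circle_of t) = f (circle_of t)" if "f \<in> iet_maps \<Lambda>" for f t
    unfolding side_fixed_iff_tendsto[OF iet_maps_piecewise_translations[OF that] one_sided_right]
      at_right_to_0[symmetric] by (rule continuous_within)
  ultimately show ?thesis using mem_side_lift_iff[OF one_sided_right] by blast
qed

lemma iet_maps_bij: "f \<in> iet_maps \<Lambda> \<Longrightarrow> bij f"
  by (intro piecewise_translations_bij iet_maps_piecewise_translations)

lemma iet_maps_IET_hat: "f \<in> iet_maps \<Lambda> \<Longrightarrow> f \<in> IET_hat"
  unfolding IET_hat_eq by (rule piecewise_translations_mono[OF iet_maps_piecewise_translations]) simp_all

lemma IET_over_eq: "IET_over \<Lambda> = PC_proj ` iet_maps \<Lambda>"
proof -
  have "IET_over \<Lambda> \<subseteq> PC_proj ` carrier PC_hat"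
    unfolding IET_over_def IET_def PC_carrier by blast
  then show ?thesis using mem_IET_over_iff by blast
qed

text \<open>\<open>side F\<close> is multiplicative, depends on the class only and stays within the
  class.\<close>

lemma side_lift_is_lift:
  assumes F: "one_sided F"
  shows "is_lift (IET_over \<Lambda>) (side_lift F)"
  unfolding is_lift_def
proof
  note pt = iet_maps_piecewise_translations
  have IET_hat: "IET_hat \<subseteq> carrier PC_hat" by (auto simp: IET_hat_def)
  show "subgroup (side_lift F) (PC_hat\<lparr>carrier := IET_hat\<rparr>)"
  proof
    show "side_lift F \<subseteq> carrier (PC_hat\<lparr>carrier := IET_hat\<rparr>)"
      using iet_maps_IET_hat iet_maps_side[OF _ F] by (auto simp: side_lift_def)
    show "\<one>\<^bsub>PC_hat\<lparr>carrier := IET_hat\<rparr>\<^esub> \<in> side_lift F"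
      using id_iet_maps side_id[OF F] by (auto simp: PC_hat_one side_lift_def image_iff intro!: bexI[of _ id])
    show "f \<otimes>\<^bsub>PC_hat\<lparr>carrier := IET_hat\<rparr>\<^esub> g \<in> side_lift F"
      if fg: "f \<in> side_lift F" "g \<in> side_lift F" for f g
    proof -
      obtain f' g' where f': "f = side F f'" "f' \<in> iet_maps \<Lambda>" and g': "g = side F g'" "g' \<in> iet_maps \<Lambda>"
        using fg unfolding side_lift_def by blast
      have "f \<otimes>\<^bsub>PC_hat\<lparr>carrier := IET_hat\<rparr>\<^esub> g = f \<circ> g"
        using iet_maps_bij[OF iet_maps_side[OF f'(2) F]] iet_maps_bij[OF iet_maps_side[OF g'(2) F]]
        by (simp add: PC_hat_mult f' g')
      also have "\<dots> = side F (f' \<circ> g')" using side_comp[OF pt[OF f'(2)] pt[OF g'(2)] F] f' g' by simp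
      finally show ?thesis using iet_maps_comp[OF f'(2) g'(2)] unfolding side_lift_def by blast
    qed
    show "inv\<^bsub>PC_hat\<lparr>carrier := IET_hat\<rparr>\<^esub> f \<in> side_lift F" if f: "f \<in> side_lift F" for f
    proof -
      obtain f' where f': "f = side F f'" "f' \<in> iet_maps \<Lambda>" using f unfolding side_lift_def by blast
      have inv: "side F (perm_inv f') \<in> iet_maps \<Lambda>" by (intro iet_maps_side iet_maps_inv f' F)
      have eq: "perm_inv f = side F (perm_inv f')"
        unfolding f'(1) by (rule inv_unique_comp[OF side_inv[OF pt[OF f'(2)] F]])
      have "bij f" unfolding f'(1) by (intro iet_maps_bij iet_maps_side f' F)
      then have "inv\<^bsub>PC_hat\<lparr>carrier := IET_hat\<rparr>\<^esub> f = perm_inv f"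
        using iet_maps_IET_hat[OF inv] eq IET_hat by (intro PC_hat_inv) simp_all
      then show ?thesis using imageI[OF iet_maps_inv[OF f'(2)]] by (simp add: eq side_lift_def)
    qed
  qed
  show "bij_betw PC_proj (side_lift F) (IET_over \<Lambda>)"
    unfolding bij_betw_def
  proof
    have proj: "PC_proj (side F f) = PC_proj f" if "f \<in> iet_maps \<Lambda>" for f
      using near_side[OF pt[OF that] F] iet_maps_bij[OF that] iet_maps_bij[OF iet_maps_side[OF that F]]
      by (simp add: PC_proj_eq_iff)
    then show "PC_proj ` side_lift F = IET_over \<Lambda>"
      unfolding IET_over_eq side_lift_def image_image by (intro image_cong) simp_all
    show "inj_on PC_proj (side_lift F)"
    proof
      fix f g assume "f \<in> side_lift F" "g \<in> side_lift F" and eq: "PC_proj f = PC_proj g"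
      then obtain f' g' where f': "f = side F f'" "f' \<in> iet_maps \<Lambda>" and g': "g = side F g'" "g' \<in> iet_maps \<Lambda>"
        unfolding side_lift_def by blast
      have "near f' g'"
        using eq proj f' g' iet_maps_bij by (simp add: PC_proj_eq_iff)
      then show "f = g" unfolding f'(1) g'(1) by (rule side_cong_near[OF _ F])
    qed
  qed
qed

end

lemma fin_perms_inv:
  assumes "s \<in> fin_perms"
  shows "inv\<^bsub>PC_hat\<^esub> s = perm_inv s" "perm_inv s \<in> fin_perms"
proof -
  have s: "bij s" "near s id" using assms by (simp_all add: fin_perms_iff)
  then show inv: "perm_inv s \<in> fin_perms"
    using near_inv[of s id] by (simp add: fin_perms_iff bij_imp_bij_inv)
  then have "perm_inv s \<in> piecewise_translations UNIV"
    using piecewise_translations_near[OF circle_UNIV.id_piecewise_translation near_sym, of "perm_inv s"]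
    by (simp add: fin_perms_iff)
  then have "perm_inv s \<in> carrier PC_hat" by (rule piecewise_translations_PC_hat)
  from PC_hat_inv[OF s(1) this] show "inv\<^bsub>PC_hat\<^esub> s = perm_inv s" by simp
qed

lemma PC_hat_conjugate:
  assumes "s \<in> fin_perms" "bij f"
  shows "s \<otimes>\<^bsub>PC_hat\<^esub> f \<otimes>\<^bsub>PC_hat\<^esub> inv\<^bsub>PC_hat\<^esub> s = s \<circ> f \<circ> perm_inv s"
proof -
  have "bij s" "bij (perm_inv s)" using assms(1) by (simp_all add: fin_perms_iff bij_imp_bij_inv)
  then show ?thesis using assms by (simp add: fin_perms_inv PC_hat_mult bij_comp)
qed

context big_circle_subgroup
begin

lemma lift_conjugate_to_side_lift:
  assumes L: "is_lift (IET_over \<Lambda>) L"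
  shows "\<exists>F. one_sided F \<and> fin_conjugate L (side_lift F)"
proof -
  have sub: "subgroup L (PC_hat\<lparr>carrier := IET_hat\<rparr>)" and bb: "bij_betw PC_proj L (IET_over \<Lambda>)"
    using L by (simp_all add: is_lift_def)
  have L_iet: "f \<in> iet_maps \<Lambda>" if f: "f \<in> L" for f
  proof -
    have "f \<in> carrier PC_hat" using subgroup.mem_carrier[OF sub f] by (simp add: IET_hat_def)
    moreover have "PC_proj f \<in> IET_over \<Lambda>" using bb f by (auto simp: bij_betw_def)
    ultimately show ?thesis using mem_IET_over_iff by blast
  qed
  have ex: "\<exists>g\<in>L. near g f" if f: "f \<in> iet_maps \<Lambda>" for f
  proof -
    have "PC_proj f \<in> PC_proj ` L" using bb f by (simp add: bij_betw_def IET_over_eq)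
    then obtain g where g: "g \<in> L" "PC_proj f = PC_proj g" by blast
    then show ?thesis
      using PC_proj_eq_iff[OF iet_maps_bij[OF f] iet_maps_bij[OF L_iet[OF g(1)]]] near_sym by blast
  qed
  have unique: "g = h" if "g \<in> L" "h \<in> L" "near g h" for g h
    using bb that PC_proj_eq_iff[OF iet_maps_bij iet_maps_bij] L_iet unfolding bij_betw_def
    by (metis inj_onD)
  have comp: "g \<circ> h \<in> L" if "g \<in> L" "h \<in> L" for g h
    using subgroup.m_closed[OF sub that] PC_hat_mult iet_maps_bij L_iet that by simp
  \<comment> \<open>The lift has exactly one element near each \<open>f\<close> in
    \<open>iet_maps \<Lambda>\<close>, so the choice is forced there and uniqueness yields the
    homomorphism laws.\<close>
  define \<alpha> where "\<alpha> f = (SOME g. g \<in> L \<and> near g f)" for f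
  have \<alpha>: "\<alpha> f \<in> L" "near (\<alpha> f) f" if "f \<in> iet_maps \<Lambda>" for f
    using someI_ex[of "\<lambda>g. g \<in> L \<and> near g f"] ex[OF that] unfolding \<alpha>_def by blast+
  have \<alpha>_L: "\<alpha> f = f" if "f \<in> L" for f
    using unique \<alpha>[OF L_iet[OF that]] that by blast
  interpret near_representation \<Lambda> \<alpha>
  proof
    show "bij (\<alpha> f)" if "f \<in> iet_maps \<Lambda>" for f
      by (intro iet_maps_bij L_iet \<alpha> that)
    show "near (\<alpha> f) f" if "f \<in> iet_maps \<Lambda>" for f by (rule \<alpha>(2)[OF that])
    show "\<alpha> (f \<circ> g) = \<alpha> f \<circ> \<alpha> g" if fg: "f \<in> iet_maps \<Lambda>" "g \<in> iet_maps \<Lambda>" for f g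
    proof (rule unique)
      note fg' = iet_maps_comp[OF fg]
      show "\<alpha> (f \<circ> g) \<in> L" "\<alpha> f \<circ> \<alpha> g \<in> L" by (intro \<alpha> fg' comp fg)+
      have "near (\<alpha> f \<circ> \<alpha> g) (f \<circ> g)"
        by (intro near_comp \<alpha> fg bij_is_inj iet_maps_bij L_iet)
      then show "near (\<alpha> (f \<circ> g)) (\<alpha> f \<circ> \<alpha> g)" by (rule near_trans[OF \<alpha>(2)[OF fg'] near_sym])
    qed
    show "\<alpha> f = \<alpha> g" if fg: "f \<in> iet_maps \<Lambda>" "g \<in> iet_maps \<Lambda>" "near f g" for f g
      using near_trans[OF near_trans[OF \<alpha>(2)[OF fg(1)] fg(3)] near_sym[OF \<alpha>(2)[OF fg(2)]]]
      by (intro unique \<alpha> fg)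
  qed
  obtain s F where s: "bij s" "near s id" and F: "one_sided F"
    and conj: "\<And>f. f \<in> iet_maps \<Lambda> \<Longrightarrow> perm_inv s \<circ> \<alpha> f \<circ> s = side F f"
    by (rule conjugate_to_side) blast
  have s_fin: "perm_inv s \<in> fin_perms" using s by (intro fin_perms_inv) (simp add: fin_perms_iff)
  \<comment> \<open>Every class has a representative in \<open>L\<close>, and \<open>side F\<close>
    sees the class only.\<close>
  have "side_lift F = side F ` L"
  proof
    show "side F ` L \<subseteq> side_lift F" using L_iet by (auto simp: side_lift_def)
    show "side_lift F \<subseteq> side F ` L"
    proof
      fix f assume "f \<in> side_lift F"
      then obtain g where g: "g \<in> iet_maps \<Lambda>" "f = side F g" by (auto simp: side_lift_def)
      then have "f = side F (\<alpha> g)" using side_cong_near[OF \<alpha>(2)[OF g(1)] F] by simp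
      then show "f \<in> side F ` L" using \<alpha>(1)[OF g(1)] by blast
    qed
  qed
  also have "\<dots> = (\<lambda>f. perm_inv s \<otimes>\<^bsub>PC_hat\<^esub> f \<otimes>\<^bsub>PC_hat\<^esub> inv\<^bsub>PC_hat\<^esub> (perm_inv s)) ` L"
  proof (rule image_cong)
    fix f assume f: "f \<in> L"
    have "perm_inv s \<otimes>\<^bsub>PC_hat\<^esub> f \<otimes>\<^bsub>PC_hat\<^esub> inv\<^bsub>PC_hat\<^esub> (perm_inv s) = perm_inv s \<circ> f \<circ> s"
      using PC_hat_conjugate[OF s_fin iet_maps_bij[OF L_iet[OF f]]] s(1) by (simp add: inv_inv_eq)
    also have "\<dots> = side F f" using conj[OF L_iet[OF f]] \<alpha>_L[OF f] by simp
    finally show "side F f = perm_inv s \<otimes>\<^bsub>PC_hat\<^esub> f \<otimes>\<^bsub>PC_hat\<^esub> inv\<^bsub>PC_hat\<^esub> (perm_inv s)" ..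
  qed simp
  finally show ?thesis using s_fin F unfolding fin_conjugate_def by blast
qed

lemma infinite_\<Lambda>: "infinite \<Lambda>"
proof
  assume "finite \<Lambda>"
  then have "\<exists>h\<in>\<Lambda>. \<forall>t\<in>\<Lambda>. \<forall>i::int. h \<noteq> t + circle_of (of_int i * 0)"
    by (intro many_cosets) (auto simp: circle_of_0)
  then show False by (auto simp: circle_of_0)
qed

text \<open>A conjugating \<open>s\<close> commutes with all translations by \<Lambda>, so one moved
  point would give infinitely many. Hence \<open>s\<close> is the identity, and the two lifts would
  coincide.\<close>

lemma not_fin_conjugate_sides:
  "\<not> fin_conjugate (side_lift (at_left 0)) (side_lift (at_right 0))"
proof
  assume "fin_conjugate (side_lift (at_left 0)) (side_lift (at_right 0))"
  then obtain s where s: "s \<in> fin_perms"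
    and eq: "side_lift (at_right 0) =
      (\<lambda>f. s \<otimes>\<^bsub>PC_hat\<^esub> f \<otimes>\<^bsub>PC_hat\<^esub> inv\<^bsub>PC_hat\<^esub> s) ` side_lift (at_left 0)"
    unfolding fin_conjugate_def by blast
  have bij: "bij s" and near: "near s id" using s by (simp_all add: fin_perms_iff)
  have near_inv_s: "near (perm_inv s) id" using fin_perms_inv(2)[OF s] by (simp add: fin_perms_iff)
  have conj: "s \<circ> side (at_left 0) f \<circ> perm_inv s = side (at_right 0) f" if f: "f \<in> iet_maps \<Lambda>" for f
  proof -
    let ?l = "side (at_left 0) f" and ?r = "side (at_right 0) f"
    note l = iet_maps_side[OF f one_sided_left]
    note pt = iet_maps_piecewise_translations[OF f]
    have "?l \<in> side_lift (at_left 0)" using f by (auto simp: side_lift_def)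
    then have "s \<circ> ?l \<circ> perm_inv s \<in> side_lift (at_right 0)"
      unfolding eq using PC_hat_conjugate[OF s iet_maps_bij[OF l]] by (metis imageI)
    then obtain g where g: "g \<in> iet_maps \<Lambda>" "s \<circ> ?l \<circ> perm_inv s = side (at_right 0) g"
      by (auto simp: side_lift_def)
    \<comment> \<open>The conjugate is still near \<open>f\<close>, so within the right lift it can
      only be the right representative of \<open>f\<close>.\<close>
    have "near (s \<circ> (?l \<circ> perm_inv s)) (id \<circ> (f \<circ> id))"
      using bij_is_inj[OF bij_imp_bij_inv[OF bij]] bij_is_inj[OF iet_maps_bij[OF l]]
      by (intro near_comp near near_inv_s near_side[OF pt one_sided_left] inj_compose)
    then have "near (side (at_right 0) g) f" by (simp add: comp_assoc flip: g(2))
    then have "near g f"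
      using near_trans[OF near_sym[OF near_side[OF iet_maps_piecewise_translations[OF g(1)] one_sided_right]]]
      by blast
    then show ?thesis unfolding g(2) by (rule side_cong_near[OF _ one_sided_right])
  qed
  have "s x = x" for x
  proof (rule ccontr)
    assume x: "s x \<noteq> x"
    have "s (x + l) = s x + l" if l: "l \<in> \<Lambda>" for l
    proof -
      have tr: "side F (\<lambda>y. y + l) = (\<lambda>y. y + l)" if "one_sided F" for F
        by (rule ext) (use side_eqI[OF _ that] in \<open>simp add: germ_def\<close>)
      have "(s \<circ> (\<lambda>y. y + l) \<circ> perm_inv s) (s x) = s x + l"
        using conj[OF translation_iet[OF l]] by (simp only: tr one_sided_left one_sided_right)
      then show ?thesis using bij by (simp add: bij_is_inj)
    qed
    then have "(\<lambda>l. x + l) ` \<Lambda> \<subseteq> {y. s y \<noteq> id y}" using x by auto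
    then have "finite ((\<lambda>l. x + l) ` \<Lambda>)" using near finite_subset by (simp add: near_def)
    then show False using infinite_\<Lambda> finite_imageD[of "\<lambda>l. x + l" \<Lambda>] by (simp add: inj_on_def)
  qed
  then have s_id: "s = id" by (simp add: fun_eq_iff)
  \<comment> \<open>The arc starts at 0 and is not the whole circle: its rotation is the identity
    just before 0 and translates by \<open>r\<close> just after.\<close>
  obtain c where c: "0 < c" "c < 1" "circle_of c \<in> \<Lambda>" using small_element[of 1] by auto
  obtain r where r: "0 < r" "r < c" "circle_of r \<in> \<Lambda>" using small_element[OF c(1)] by auto
  define m where "m = circle_of (r / c)"
  let ?f = "arc_rotation 0 c m"
  have m: "c * upper_rep m = r" using c(1) r by (simp add: m_def upper_rep_circle_of)
  have "?f \<in> iet_maps \<Lambda>"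
    using c r by (intro arc_rotation_iet_map) (auto simp: m_def rotation_group_def)
  from conj[OF this] have "side (at_left 0) ?f 0 = side (at_right 0) ?f 0" by (simp add: s_id)
  moreover have "germ (at_left 0) ?f 0 0"
  proof -
    have "?f (circle_of t) = circle_of t" if t: "t \<in> {c - 1<..<0}" for t
    proof -
      have "circle_of t = circle_of (1 + t)" by (simp add: circle_of_eq_iff)
      then show ?thesis using arc_rotation_eval[of c "1 + t" 0 m] c r t by (simp add: m)
    qed
    moreover have "\<forall>\<^sub>F t in at_left 0. t \<in> {c - 1<..<0}" using c by (intro eventually_at_leftI[of "c - 1"]) auto
    ultimately show ?thesis unfolding germ_def by (auto elim: eventually_mono)
  qed
  moreover have "germ (at_right 0) ?f 0 (circle_of r)"
  proof -
    have "?f (circle_of t) = circle_of t + circle_of r" if t: "t \<in> {0<..<c - r}" for t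
      using arc_rotation_eval[of c t 0 m] c r t by (simp add: m circle_of_add)
    moreover have "\<forall>\<^sub>F t in at_right 0. t \<in> {0<..<c - r}" using r by (intro eventually_at_rightI[of _ "c - r"]) auto
    ultimately show ?thesis unfolding germ_def by (auto elim: eventually_mono)
  qed
  ultimately have "circle_of r = circle_of 0"
    by (simp add: side_eqI[OF _ one_sided_left] side_eqI[OF _ one_sided_right] circle_of_0)
  then show False using circle_of_inj_near[of r 0] r c by simp
qed

end

theorem corollary4p13:
  fixes \<Lambda> :: "circle set"
  assumes "subgroup \<Lambda> circle_group"
    and "rat_rank (circle_group\<lparr>carrier := \<Lambda>\<rparr>) \<ge> 2 \<or>
         (rat_rank (circle_group\<lparr>carrier := \<Lambda>\<rparr>) = 1 \<and>
          \<not> finitely_generated_group (circle_group\<lparr>carrier := \<Lambda>\<rparr>))"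
  shows "is_lift (IET_over \<Lambda>) (left_lift (IET_over \<Lambda>)) \<and>
         is_lift (IET_over \<Lambda>) (right_lift (IET_over \<Lambda>)) \<and>
         \<not> fin_conjugate (left_lift (IET_over \<Lambda>)) (right_lift (IET_over \<Lambda>)) \<and>
         (\<forall>L. is_lift (IET_over \<Lambda>) L \<longrightarrow>
              fin_conjugate L (left_lift (IET_over \<Lambda>)) \<or>
              fin_conjugate L (right_lift (IET_over \<Lambda>)))"
proof -
  interpret circle_subgroup \<Lambda> by (rule circle_group_subgroup[OF assms(1)])
  interpret big_circle_subgroup \<Lambda>
  proof
    have "rat_rank (circle_group\<lparr>carrier := \<Lambda>\<rparr>) \<noteq> 0" using assms(2) by auto
    then show "\<exists>\<kappa>. circle_of \<kappa> \<in> \<Lambda> \<and> \<kappa> \<notin> \<rat>" using irrational_mem by blast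
    show "\<exists>h\<in>\<Lambda>. \<forall>t\<in>T. \<forall>i::int. h \<noteq> t + circle_of (of_int i * \<kappa>)"
      if "circle_of \<kappa> \<in> \<Lambda>" "finite T" for \<kappa> T
    proof (rule ccontr)
      assume "\<not> ?thesis"
      \<comment> \<open>A finite covering would force rank at most 1 and finite generation together,
        against either alternative.\<close>
      then have "\<exists>t\<in>T. \<exists>i::int. h = t + circle_of (of_int i * \<kappa>)" if "h \<in> \<Lambda>" for h using that by blast
      from finitely_many_cosets[OF that this]
      have "rat_rank (circle_group\<lparr>carrier := \<Lambda>\<rparr>) \<le> 1" "finitely_generated_group (circle_group\<lparr>carrier := \<Lambda>\<rparr>)"
        by blast+
      moreover have "\<not> (2::enat) \<le> 1" by (simp add: numeral_eq_enat one_enat_def)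
      ultimately show False using assms(2) order_trans by blast
    qed
  qed
  show ?thesis
    unfolding left_lift_eq right_lift_eq
    using side_lift_is_lift not_fin_conjugate_sides lift_conjugate_to_side_lift
    unfolding one_sided_def by blast
qed

end
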